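(* Let $t>0$, let $\mathcal S=\{i_1,\dots,i_M\}$, $i_1<\dots<i_M$, let $\underline p=(p_1,\dots,p_M)\in\mathbb S^M$, let $\underline b=(b_2,\dots,b_{M-1})$ satisfy $-\frac{1}{i_{j+1}-i_j}<b_j<\frac{1}{i_j-i_{j-1}}$ for $j=2,\dots,M-1$, and let $\underline k=(k_2,\dots,k_{M-1})\in\mathbb R_+^{M-2}$. For any integer $r\ge1$ there exist $l\in\{2,\dots,M\}$, a vector $\underline\lambda=(\lambda_2,\dots,\lambda_{M-1})\in\mathbb R_+^{M-2}$, a $\beta\in(0,1]$ and an $h_0\in(0,1)$ such that for all $h\in(0,h_0)$ there is an $\alpha$ satisfying $$\alpha\in\Big[\Big(1+\frac{(k\lambda)^*t}{r}\Big)^{-r},1\Big],\qquad (k\lambda)^*=\max_{j\in\{2,\dots,M-1\}}\widetilde k_j\lambda_j,$$ such that $\widetilde P^{(h)}(\underline k,\underline\lambda)$ is the one-step transition matrix of a time homogeneous discrete time Markov chain $X^{(h)}$ on $\mathcal S\cup\{D\}$ with time step length $h$ satisfying $$(1-\beta)\,\mathbb P(X^{(h)}_{h\tau}=i_j\mid X^{(h)}_0=i_{l-1})+\beta\,\mathbb P(X^{(h)}_{h\tau}=i_j\mid X^{(h)}_0=i_l)=\alpha p_j,\qquad j=1,\dots,M,$$ where $\tau\sim NB\big(r,\frac{t}{t+hr}\big)$ is independent of $X^{(h)}$ (so $\mathbb E[h\tau]=t$). Taking the limit $h\to0$, there is a continuous time, time homogeneous Markov chain $Y$ on $\mathcal S\cup\{D\}$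 with transition intensity matrix $\Theta(\underline k,\underline\lambda)$ such that $$(1-\beta)\,\mathbb P(Y_T=i_j\mid Y_0=i_{l-1})+\beta\,\mathbb P(Y_T=i_j\mid Y_0=i_l)=\alpha p_j,\qquad j=1,\dots,M,$$ where $\alpha$ lies in the same interval $\big[(1+\frac{(k\lambda)^*t}{r})^{-r},1\big]$ and $T$ is independent of $Y$ with $T\sim\mathrm{Gamma}(r,\frac rt)$, i.e. $T$ has density $f_T(x)=\frac{r^r}{t^r}\frac{1}{\Gamma(r)}x^{r-1}e^{-xr/t}$, $x\ge0$, and $\mathbb E[T]=t$.
   Context: Conventions: $\mathbb R_+=[0,\infty)$, $M\ge3$, $\mathbb S^M=\{(p_1,\dots,p_M):0<p_j<1,\ \sum_jp_j=1\}$. $D$ is an absorbing cemetery state, identified with index $M+1$; state $i_j$ is identified with index $j$. $NB(r,a)$ is the law $\mathbb P(\tau=n)=\binom{r+n-1}{n}a^n(1-a)^r$, $n=0,1,2,\dots$. Set $\widetilde k_j=(i_{j+1}-i_j)(i_j-i_{j-1})k_j$ for $2\le j\le M-1$, $\widetilde k_1=\widetilde k_M=0$. For $2\le j\le M-1$ set $$q_{j,j+1}=\tfrac{i_j-i_{j-1}}{i_{j+1}-i_{j-1}}\big(1+(i_{j+1}-i_j)b_j\big),\qquad q_{j,j-1}=\tfrac{i_{j+1}-i_j}{i_{j+1}-i_{j-1}}\big(1-(i_j-i_{j-1})b_j\big).$$ Transition matrix: $\widetilde P^{(h)}=\widetilde P^{(h)}(\underline k,\underline\lambda)$ is the $(M+1)\times(M+1)$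 matrix whose rows $1$, $M$, $M+1$ are those of the identity matrix and, for $2\le j\le M-1$, $\widetilde P^{(h)}_{j,j\pm1}=h\lambda_jq_{j,j\pm1}$ (the neighbours $j\pm1$ lying in $\{1,\dots,M\}$), $\widetilde P^{(h)}_{jj}=1-\lambda_j(1+\widetilde k_j)h$, $\widetilde P^{(h)}_{j,M+1}=h\lambda_j\widetilde k_j$, all other entries $0$. Intensity matrix: $\Theta(\underline k,\underline\lambda)=\lim_{h\to0}\frac1h(\widetilde P^{(h)}-I)$. *)

theory Defs
  imports "HOL-Probability.Probability"
begin

text \<open>
  Vectors \<open>(v\<^sub>1, \<dots>, v\<^sub>M)\<close> or \<open>(v\<^sub>2, \<dots>, v\<^bsub>M-1\<^esub>)\<close> are functions on \<^typ>\<open>nat\<close> of which only the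
  values at the relevant indices matter; an \<open>n \<times> n\<close> matrix is a function
  \<^typ>\<open>nat \<Rightarrow> nat \<Rightarrow> real\<close> used on \<open>{1..n} \<times> {1..n}\<close>. A state space with \<open>n\<close> points is enumerated by
  an injection \<open>st\<close> on \<open>{1..n}\<close>.
\<close>

definition id_entry :: "nat \<Rightarrow> nat \<Rightarrow> real" where
  "id_entry a c = (if a = c then 1 else 0)"

definition stochastic_matrix :: "nat \<Rightarrow> (nat \<Rightarrow> nat \<Rightarrow> real) \<Rightarrow> bool" where
  "stochastic_matrix n P \<longleftrightarrow>
     (\<forall>a\<in>{1..n}. \<forall>c\<in>{1..n}. 0 \<le> P a c) \<and> (\<forall>a\<in>{1..n}. (\<Sum>c=1..n. P a c) = 1)"

definition ktilde :: "nat \<Rightarrow> (nat \<Rightarrow> real) \<Rightarrow> (nat \<Rightarrow> real) \<Rightarrow> nat \<Rightarrow> real" where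
  "ktilde M i k j =
     (if j \<in> {2..M-1} then (i (j+1) - i j) * (i j - i (j-1)) * k j else 0)"

definition q_up :: "(nat \<Rightarrow> real) \<Rightarrow> (nat \<Rightarrow> real) \<Rightarrow> nat \<Rightarrow> real" where
  "q_up i b j = (i j - i (j-1)) / (i (j+1) - i (j-1)) * (1 + (i (j+1) - i j) * b j)"

definition q_down :: "(nat \<Rightarrow> real) \<Rightarrow> (nat \<Rightarrow> real) \<Rightarrow> nat \<Rightarrow> real" where
  "q_down i b j = (i (j+1) - i j) / (i (j+1) - i (j-1)) * (1 - (i j - i (j-1)) * b j)"

definition trans_matrix ::
  "nat \<Rightarrow> (nat \<Rightarrow> real) \<Rightarrow> (nat \<Rightarrow> real) \<Rightarrow> (nat \<Rightarrow> real) \<Rightarrow> (nat \<Rightarrow> real) \<Rightarrow> real \<Rightarrow> nat \<Rightarrow> nat \<Rightarrow> real"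
where
  "trans_matrix M i b k lam h j m =
     (if j \<in> {2..M-1} then
        (if m = j + 1 then h * lam j * q_up i b j
         else if m = j - 1 then h * lam j * q_down i b j
         else if m = j then 1 - lam j * (1 + ktilde M i k j) * h
         else if m = M + 1 then h * lam j * ktilde M i k j
         else 0)
      else id_entry j m)"

definition intensity_matrix ::
  "nat \<Rightarrow> (nat \<Rightarrow> real) \<Rightarrow> (nat \<Rightarrow> real) \<Rightarrow> (nat \<Rightarrow> real) \<Rightarrow> (nat \<Rightarrow> real) \<Rightarrow> nat \<Rightarrow> nat \<Rightarrow> real"
where
  "intensity_matrix M i b k lam j m =
     Lim (at_right 0) (\<lambda>h. (trans_matrix M i b k lam h j m - id_entry j m) / h)"

text \<open>
  The state space \<open>\<S> \<union> {D}\<close>: the point \<open>i\<^sub>j\<close> is \<^term>\<open>Some (i j)\<close>, the cemetery \<open>D\<close> (index \<open>M + 1\<close>) is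
  \<^term>\<open>None\<close>.
\<close>

definition state :: "nat \<Rightarrow> (nat \<Rightarrow> real) \<Rightarrow> nat \<Rightarrow> real option" where
  "state M i j = (if j \<le> M then Some (i j) else None)"

text \<open>
  A chain with time step \<open>h\<close> is indexed by the times \<open>0, h, 2h, \<dots>\<close>; its values at other times are
  irrelevant.
\<close>

definition discrete_markov_chain ::
  "'w measure \<Rightarrow> real \<Rightarrow> nat \<Rightarrow> (nat \<Rightarrow> 's) \<Rightarrow> (nat \<Rightarrow> nat \<Rightarrow> real) \<Rightarrow> (real \<Rightarrow> 'w \<Rightarrow> 's) \<Rightarrow> bool"
where
  "discrete_markov_chain \<Omega> h n st P X \<longleftrightarrow>
     prob_space \<Omega> \<and> 0 < h \<and> stochastic_matrix n P \<and>
     (\<forall>k::nat. X (h * real k) \<in> measurable \<Omega> (count_space (st ` {1..n}))) \<and>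
     (\<forall>(m::nat) x. (\<forall>k\<le>Suc m. x k \<in> {1..n}) \<longrightarrow>
        \<P>(w in \<Omega>. \<forall>k\<le>m. X (h * real k) w = st (x k)) > 0 \<longrightarrow>
        \<P>(w in \<Omega>. X (h * real (Suc m)) w = st (x (Suc m)) \<bar> \<forall>k\<le>m. X (h * real k) w = st (x k))
          = P (x m) (x (Suc m)))"

definition transition_function :: "nat \<Rightarrow> (real \<Rightarrow> nat \<Rightarrow> nat \<Rightarrow> real) \<Rightarrow> bool" where
  "transition_function n p \<longleftrightarrow>
     (\<forall>u\<ge>0. stochastic_matrix n (p u)) \<and>
     (\<forall>a\<in>{1..n}. \<forall>c\<in>{1..n}. p 0 a c = id_entry a c) \<and>
     (\<forall>u\<ge>0. \<forall>v\<ge>0. \<forall>a\<in>{1..n}. \<forall>c\<in>{1..n}. p (u + v) a c = (\<Sum>d=1..n. p u a d * p v d c))"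

text \<open>
  Right-continuity of the paths (in the discrete topology) is part of the notion of a continuous
  time chain: without it the value \<open>Y\<^sub>T\<close> at an independent random time is not determined by the
  finite dimensional distributions of \<open>Y\<close> and the law of \<open>T\<close>.
\<close>

definition continuous_markov_chain ::
  "'w measure \<Rightarrow> nat \<Rightarrow> (nat \<Rightarrow> 's) \<Rightarrow> (nat \<Rightarrow> nat \<Rightarrow> real) \<Rightarrow> (real \<Rightarrow> 'w \<Rightarrow> 's) \<Rightarrow> bool"
where
  "continuous_markov_chain \<Omega> n st Q Y \<longleftrightarrow>
     prob_space \<Omega> \<and>
     (\<forall>s\<ge>0. Y s \<in> measurable \<Omega> (count_space (st ` {1..n}))) \<and>
     (\<forall>w\<in>space \<Omega>. \<forall>s\<ge>0. \<forall>\<^sub>F u in at_right s. Y u w = Y s w) \<and>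
     (\<exists>p. transition_function n p \<and>
        (\<forall>a\<in>{1..n}. \<forall>c\<in>{1..n}. ((\<lambda>u. (p u a c - id_entry a c) / u) \<longlongrightarrow> Q a c) (at_right 0)) \<and>
        (\<forall>(m::nat) s x. 0 \<le> s 0 \<longrightarrow> (\<forall>k\<le>m. s k < s (Suc k)) \<longrightarrow> (\<forall>k\<le>Suc m. x k \<in> {1..n}) \<longrightarrow>
           \<P>(w in \<Omega>. \<forall>k\<le>m. Y (s k) w = st (x k)) > 0 \<longrightarrow>
           \<P>(w in \<Omega>. Y (s (Suc m)) w = st (x (Suc m)) \<bar> \<forall>k\<le>m. Y (s k) w = st (x k))
             = p (s (Suc m) - s m) (x m) (x (Suc m))))"

text \<open>
  An initial law charging every state makes all conditional probabilities given the initial state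
  well defined.
\<close>

definition initial_full_support ::
  "'w measure \<Rightarrow> nat \<Rightarrow> (nat \<Rightarrow> 's) \<Rightarrow> (real \<Rightarrow> 'w \<Rightarrow> 's) \<Rightarrow> bool"
where
  "initial_full_support \<Omega> n st X \<longleftrightarrow> (\<forall>a\<in>{1..n}. \<P>(w in \<Omega>. X 0 w = st a) > 0)"

text \<open>
  Independence of the random variable \<open>Z\<close> and the process \<open>(X\<^sub>s)\<^bsub>s\<in>I\<^esub>\<close>, via the generated
  \<open>\<sigma>\<close>-algebras; \<^const>\<open>prob_space.indep_var\<close> does not apply as it needs both variables to take
  values in the same type.
\<close>

definition indep_of_process ::
  "'w measure \<Rightarrow> 'z measure \<Rightarrow> ('w \<Rightarrow> 'z) \<Rightarrow> real set \<Rightarrow> 's set \<Rightarrow> (real \<Rightarrow> 'w \<Rightarrow> 's) \<Rightarrow> bool"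
where
  "indep_of_process \<Omega> N Z I S X \<longleftrightarrow>
     prob_space.indep_set \<Omega>
       (sets (vimage_algebra (space \<Omega>) Z N))
       (sets (vimage_algebra (space \<Omega>) (\<lambda>w. \<lambda>s\<in>I. X s w) (Pi\<^sub>M I (\<lambda>_. count_space S))))"

definition has_NB_law :: "'w measure \<Rightarrow> ('w \<Rightarrow> nat) \<Rightarrow> nat \<Rightarrow> real \<Rightarrow> bool" where
  "has_NB_law \<Omega> \<tau> r a \<longleftrightarrow>
     \<tau> \<in> measurable \<Omega> (count_space UNIV) \<and>
     (\<forall>n. \<P>(w in \<Omega>. \<tau> w = n) = real ((r + n - 1) choose n) * a ^ n * (1 - a) ^ r)"

definition gamma_density :: "nat \<Rightarrow> real \<Rightarrow> real \<Rightarrow> real" where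
  "gamma_density r t x =
     (if x < 0 then 0
      else real r ^ r / t ^ r * (1 / Gamma (real r)) * x ^ (r - 1) * exp (- x * real r / t))"

definition klam_max :: "nat \<Rightarrow> (nat \<Rightarrow> real) \<Rightarrow> (nat \<Rightarrow> real) \<Rightarrow> (nat \<Rightarrow> real) \<Rightarrow> real" where
  "klam_max M i k lam = (MAX j\<in>{2..M-1}. ktilde M i k j * lam j)"

definition alpha_interval ::
  "nat \<Rightarrow> (nat \<Rightarrow> real) \<Rightarrow> (nat \<Rightarrow> real) \<Rightarrow> (nat \<Rightarrow> real) \<Rightarrow> real \<Rightarrow> nat \<Rightarrow> real set" where
  "alpha_interval M i k lam t r = {(1 + klam_max M i k lam * t / real r) powi (- int r) .. 1}"

end

theory Submission
  imports Defs
begin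

text \<open>
  Write \<open>\<Theta>\<close> for the intensity matrix and \<open>c = t / r\<close>, so that the one-step matrix is \<open>I + h \<Theta>\<close>. Averaging its
  powers over the negative binomial law, or the semigroup of \<open>\<Theta>\<close> over the Gamma law (a Gamma mixture of
  Poisson laws is negative binomial), gives the same matrix \<open>(I - c \<Theta>)\<^sup>-\<^sup>r\<close>, in which \<open>h\<close> no longer occurs.
  Hence both parts reduce to finding rates for which a convex combination of two neighbouring rows of
  this matrix is proportional to \<open>p\<close>, and these come from Brouwer's fixed point theorem.

  The continuous time chain jumps at the times of a Poisson process with rate \<open>1 / h\<close> according to
  \<open>I + h \<Theta>\<close>. Its Markov property follows because both sides of the defining identity solve the same
  renewal equation, whose bounded solutions are unique.
\<close>

section \<open>Brouwer's theorem on a cube of variable dimension\<close>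

text \<open>The rates that solve the problem come with no evident upper bound: a state with small
  \<open>p j\<close> has to be left quickly, while killing may remove most of the mass. Brouwer's
  theorem needs a compact set of rates, so everything rests on an a priori bound whose constant
  involves neither the rates nor \<open>h\<close>: \<open>c * lam j\<close> times the mass at
  \<open>j\<close> is at most \<open>steep ^ (2 * M + 1)\<close> times the surviving mass. It comes
  from the test functions \<open>steep ^ y\<close> and \<open>steep ^ (M + 1) - steep ^ y\<close>,
  whose base is so large that upward jumps outweigh downward jumps and killing. The bound fixes the
  box \<open>[0, L]\<close> of rates, the box fixes one admissible \<open>h\<close>, and with a
  common \<open>h\<close> the fixed point map is continuous. As the number of states is a variable,
  points of the cube are sequences that vanish from index \<open>n\<close> on. No limit
  \<open>h -> 0\<close> is taken for the continuous time part: it uses the one \<open>h\<close> of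
  the fixed point. Its paths are built explicitly, because right-continuity is demanded of every
  path and evaluation at a random time needs joint measurability.\<close>

definition unit_cube :: "nat \<Rightarrow> (nat \<Rightarrow> real) set" where
  "unit_cube n = {x. (\<forall>i<n. 0 \<le> x i \<and> x i \<le> 1) \<and> (\<forall>i\<ge>n. x i = 0)}"

lemma compact_unit_interval_functions: "compact (PiE UNIV (\<lambda>_::nat. {0..1::real}))"
proof -
  have "compactin (product_topology (\<lambda>_::nat. euclidean :: real topology) UNIV)
          (PiE UNIV (\<lambda>_::nat. {0..1::real}))"
    by (subst compactin_PiE) auto
  then show ?thesis
    by (simp add: euclidean_product_topology)
qed

lemma tendsto_coordinate:
  fixes X :: "nat \<Rightarrow> nat \<Rightarrow> real"
  assumes "X \<longlonglongrightarrow> x"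
  shows "(\<lambda>m. X m i) \<longlonglongrightarrow> x i"
proof -
  have "continuous_on UNIV (\<lambda>y::nat \<Rightarrow> real. y i)"
    by (rule continuous_on_product_coordinates)
  then have "isCont (\<lambda>y::nat \<Rightarrow> real. y i) x"
    using continuous_on_eq_continuous_at[of UNIV "\<lambda>y::nat \<Rightarrow> real. y i"] by blast
  then show ?thesis
    by (rule isCont_tendsto_compose) (rule assms)
qed

lemma tendsto_coordinatewise:
  fixes X :: "nat \<Rightarrow> nat \<Rightarrow> real"
  assumes "\<And>i. (\<lambda>m. X m i) \<longlonglongrightarrow> x i"
  shows "X \<longlonglongrightarrow> x"
proof -
  have "limitin (product_topology (\<lambda>_::nat. euclidean :: real topology) UNIV) X x sequentially"
    using assms by (simp add: limitin_componentwise)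
  then show ?thesis
    by (simp add: euclidean_product_topology)
qed

text \<open>Kuhn's labelling lemma on the grid of mesh \<open>1 / p\<close> yields a cell that
  contains, for each coordinate \<open>i\<close>, a vertex where \<open>F\<close> does not decrease
  coordinate \<open>i\<close> and one where \<open>F\<close> does not increase it. As the cells
  shrink to a limit point, both inequalities pass to the limit by continuity.\<close>

theorem brouwer_unit_cube:
  fixes F :: "(nat \<Rightarrow> real) \<Rightarrow> nat \<Rightarrow> real"
  assumes cont: "\<And>i. i < n \<Longrightarrow> continuous_on (unit_cube n) (\<lambda>x. F x i)"
    and range: "\<And>x i. x \<in> unit_cube n \<Longrightarrow> i < n \<Longrightarrow> 0 \<le> F x i \<and> F x i \<le> 1"
  obtains x where "x \<in> unit_cube n" "\<And>i. i < n \<Longrightarrow> F x i = x i"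
proof -
  define sc where "sc p y = (\<lambda>i. if i < n then real (y i) / real p else 0)" for p :: nat and y :: "nat \<Rightarrow> nat"
  have sc_cube: "sc p y \<in> unit_cube n" if "0 < p" "\<forall>i<n. y i \<le> p" for p y
    using that by (auto simp: sc_def unit_cube_def)
  define cell where "cell q r \<longleftrightarrow> (\<forall>j<n. q j \<le> r j \<and> r j \<le> q j + 1)" for q r :: "nat \<Rightarrow> nat"
  define low where "low p r i \<longleftrightarrow> sc p r i \<le> F (sc p r) i" for p r i
  define high where "high p s i \<longleftrightarrow> F (sc p s) i \<le> sc p s i" for p s i
  have step: "\<exists>q. (\<forall>i<n. q i < p) \<and>
      (\<forall>i<n. \<exists>r s. cell q r \<and> cell q s \<and> low p r i \<and> high p s i)"
    if p: "0 < p" for p :: nat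
  proof -
    \<comment> \<open>Label 0 says that \<open>F\<close> does not decrease the coordinate. The
      clause \<open>y i \<noteq> p\<close> forces label 1 on the upper face, as Kuhn's lemma
      demands; \<open>high\<close> still holds there because \<open>F\<close> is at most 1.\<close>
    define lab where "lab y i = (if y i \<noteq> p \<and> sc p y i \<le> F (sc p y) i then 0 else 1::nat)" for y i
    have lab0: "lab y i = 0" if "\<forall>i<n. y i \<le> p" "i < n" "y i = 0" for y i
      using range[OF sc_cube[OF p that(1)] that(2)] that p by (auto simp: lab_def sc_def)
    have low: "low p y i" if "lab y i = 0" for y i
      using that by (auto simp: lab_def low_def split: if_splits)
    have high: "high p y i" if "\<forall>i<n. y i \<le> p" "i < n" "lab y i = 1" for y i
      using range[OF sc_cube[OF p that(1)] that(2)] that p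
      by (auto simp: lab_def sc_def high_def split: if_splits)
    obtain q where q: "\<forall>i<n. q i < p"
      and rs: "\<forall>i<n. \<exists>r s. (\<forall>j<n. q j \<le> r j \<and> r j \<le> q j + 1) \<and> (\<forall>j<n. q j \<le> s j \<and> s j \<le> q j + 1) \<and> lab r i \<noteq> lab s i"
    proof (rule kuhn_lemma[of p n lab, OF p])
      show "\<forall>x. (\<forall>i<n. x i \<le> p) \<longrightarrow> (\<forall>i<n. lab x i = 0 \<or> lab x i = 1)"
        by (simp add: lab_def)
      show "\<forall>x. (\<forall>i<n. x i \<le> p) \<longrightarrow> (\<forall>i<n. x i = 0 \<longrightarrow> lab x i = 0)"
        using lab0 by blast
      show "\<forall>x. (\<forall>i<n. x i \<le> p) \<longrightarrow> (\<forall>i<n. x i = p \<longrightarrow> lab x i = 1)"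
        by (simp add: lab_def)
    qed
    have "\<exists>r s. cell q r \<and> cell q s \<and> low p r i \<and> high p s i" if i: "i < n" for i
    proof -
      obtain r s where *: "cell q r" "cell q s" "lab r i \<noteq> lab s i"
        using rs i unfolding cell_def by blast
      have le: "\<forall>j<n. y j \<le> p" if "cell q y" for y
        using that q unfolding cell_def by (metis Suc_eq_plus1 Suc_leI le_trans)
      consider "lab r i = 0" "lab s i = 1" | "lab s i = 0" "lab r i = 1"
        using *(3) by (simp add: lab_def split: if_splits)
      then show ?thesis
      proof cases
        case 1
        show ?thesis
          using * low[OF 1(1)] high[OF le[OF *(2)] i 1(2)] by blast
      next
        case 2
        show ?thesis
          using * low[OF 2(1)] high[OF le[OF *(1)] i 2(2)] by blast
      qed
    qed
    then show ?thesis
      using q by blast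
  qed
  obtain q where q: "\<And>m i. i < n \<Longrightarrow> q m i < Suc m"
    and qrs: "\<And>m i. i < n \<Longrightarrow> \<exists>r s. cell (q m) r \<and> cell (q m) s \<and> low (Suc m) r i \<and> high (Suc m) s i"
    using step[OF zero_less_Suc] by metis
  have "\<forall>m i. \<exists>r. i < n \<longrightarrow> cell (q m) r \<and> low (Suc m) r i"
    using qrs by blast
  then have "\<exists>R. \<forall>m i. i < n \<longrightarrow> cell (q m) (R m i) \<and> low (Suc m) (R m i) i"
    by metis
  moreover have "\<forall>m i. \<exists>s. i < n \<longrightarrow> cell (q m) s \<and> high (Suc m) s i"
    using qrs by blast
  then have "\<exists>S. \<forall>m i. i < n \<longrightarrow> cell (q m) (S m i) \<and> high (Suc m) (S m i) i"
    by metis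
  ultimately obtain R S where R: "\<And>m i. i < n \<Longrightarrow> cell (q m) (R m i)" and S: "\<And>m i. i < n \<Longrightarrow> cell (q m) (S m i)"
    and FR: "\<And>m i. i < n \<Longrightarrow> low (Suc m) (R m i) i" and FS: "\<And>m i. i < n \<Longrightarrow> high (Suc m) (S m i) i"
    by blast
  define z where "z m = sc (Suc m) (q m)" for m
  have z_cube: "z m \<in> unit_cube n" for m
    unfolding z_def using q by (intro sc_cube) (auto simp: less_imp_le)
  have "\<forall>m. z m \<in> PiE UNIV (\<lambda>_::nat. {0..1::real})"
    using z_cube by (auto simp: unit_cube_def) (metis linorder_not_le order_refl zero_le_one)+
  then obtain x \<phi> where \<phi>: "strict_mono \<phi>" and lim: "(z \<circ> \<phi>) \<longlonglongrightarrow> x"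
    using compact_unit_interval_functions[unfolded compact_eq_seq_compact_metric seq_compact_def] by metis
  have zlim: "(\<lambda>m. z (\<phi> m) i) \<longlonglongrightarrow> x i" for i
    using tendsto_coordinate[OF lim] by (simp add: o_def)
  have x_cube: "x \<in> unit_cube n"
  proof -
    have "0 \<le> x i \<and> x i \<le> 1" if "i < n" for i
      using z_cube that
      by (auto simp: unit_cube_def intro!: LIMSEQ_le_const[OF zlim] LIMSEQ_le_const2[OF zlim])
    moreover have "x i = 0" if "i \<ge> n" for i
      using z_cube that LIMSEQ_unique[OF zlim[of i], of 0] by (auto simp: unit_cube_def)
    ultimately show ?thesis by (simp add: unit_cube_def)
  qed
  \<comment> \<open>Any choice of one vertex per cell has the same limit as the base corners
    \<open>z\<close>, since it differs from them by at most one mesh width in every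
    coordinate.\<close>
  have close: "(\<lambda>m. sc (Suc (\<phi> m)) (T (\<phi> m))) \<longlonglongrightarrow> x"
    if "\<And>m. cell (q m) (T m)" for T
  proof (rule tendsto_coordinatewise)
    fix j
    have T: "q m j \<le> T m j \<and> T m j \<le> q m j + 1" if "j < n" for m
      using \<open>cell (q m) (T m)\<close> that by (auto simp: cell_def)
    have inv: "(\<lambda>m. z (\<phi> m) j + 1 / real (Suc (\<phi> m))) \<longlonglongrightarrow> x j + 0"
      using LIMSEQ_subseq_LIMSEQ[OF LIMSEQ_inverse_real_of_nat \<phi>]
      by (intro tendsto_add zlim) (simp add: o_def inverse_eq_divide)
    show "(\<lambda>m. sc (Suc (\<phi> m)) (T (\<phi> m)) j) \<longlonglongrightarrow> x j"
    proof (rule tendsto_sandwich[OF _ _ zlim[of j]])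
      show "\<forall>\<^sub>F m in sequentially. z (\<phi> m) j \<le> sc (Suc (\<phi> m)) (T (\<phi> m)) j"
        using T by (auto simp: z_def sc_def divide_simps intro!: always_eventually)
      show "\<forall>\<^sub>F m in sequentially. sc (Suc (\<phi> m)) (T (\<phi> m)) j \<le> z (\<phi> m) j + 1 / real (Suc (\<phi> m))"
      proof (rule always_eventually, rule allI)
        fix m
        have "real (T (\<phi> m) j) \<le> real (q (\<phi> m) j) + 1" if "j < n"
          using T[OF that, of "\<phi> m"] by linarith
        then show "sc (Suc (\<phi> m)) (T (\<phi> m)) j \<le> z (\<phi> m) j + 1 / real (Suc (\<phi> m))"
          by (auto simp: z_def sc_def divide_simps)
      qed
      show "(\<lambda>m. z (\<phi> m) j + 1 / real (Suc (\<phi> m))) \<longlonglongrightarrow> x j"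
        using inv by simp
    qed
  qed
  have "F x i = x i" if i: "i < n" for i
  proof -
    have lims: "(\<lambda>m. F (sc (Suc (\<phi> m)) (T (\<phi> m))) i) \<longlonglongrightarrow> F x i"
        "(\<lambda>m. sc (Suc (\<phi> m)) (T (\<phi> m)) i) \<longlonglongrightarrow> x i"
      if "\<And>m. cell (q m) (T m)" for T
    proof -
      have "T m j \<le> Suc m" if "j < n" for m j
        using \<open>cell (q m) (T m)\<close> q[OF that, of m] that by (force simp: cell_def)
      then have "sc (Suc (\<phi> m)) (T (\<phi> m)) \<in> unit_cube n" for m
        by (intro sc_cube) auto
      then show "(\<lambda>m. F (sc (Suc (\<phi> m)) (T (\<phi> m))) i) \<longlonglongrightarrow> F x i"
        using continuous_on_tendsto_compose[OF cont[OF i] close[OF \<open>\<And>m. cell (q m) (T m)\<close>] x_cube] by simp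
      show "(\<lambda>m. sc (Suc (\<phi> m)) (T (\<phi> m)) i) \<longlonglongrightarrow> x i"
        by (rule tendsto_coordinate[OF close[OF \<open>\<And>m. cell (q m) (T m)\<close>]])
    qed
    have "x i \<le> F x i"
      using LIMSEQ_le[OF lims(2)[of "\<lambda>m. R m i"] lims(1)[of "\<lambda>m. R m i"]] R i FR unfolding low_def by blast
    moreover have "F x i \<le> x i"
      using LIMSEQ_le[OF lims(1)[of "\<lambda>m. S m i"] lims(2)[of "\<lambda>m. S m i"]] S i FS unfolding high_def by blast
    ultimately show ?thesis by simp
  qed
  then show thesis using x_cube that by blast
qed

section \<open>Negative binomial mixtures of matrix powers\<close>

primrec mat_power :: "nat \<Rightarrow> (nat \<Rightarrow> nat \<Rightarrow> real) \<Rightarrow> nat \<Rightarrow> nat \<Rightarrow> nat \<Rightarrow> real" where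
  "mat_power n P 0 = id_entry"
| "mat_power n P (Suc m) = (\<lambda>x y. \<Sum>z=1..n. P x z * mat_power n P m z y)"

lemma sum_id_entry:
  fixes g :: "nat \<Rightarrow> real"
  assumes "finite A" "x \<in> A"
  shows "(\<Sum>z\<in>A. id_entry x z * g z) = g x" "(\<Sum>z\<in>A. g z * id_entry z x) = g x"
proof -
  have "(\<Sum>z\<in>A. id_entry x z * g z) = (\<Sum>z\<in>A. if x = z then g z else 0)"
    "(\<Sum>z\<in>A. g z * id_entry z x) = (\<Sum>z\<in>A. if z = x then g z else 0)"
    by (auto intro!: sum.cong simp: id_entry_def)
  then show "(\<Sum>z\<in>A. id_entry x z * g z) = g x" "(\<Sum>z\<in>A. g z * id_entry z x) = g x"
    using assms by simp_all
qed

lemma mat_power_Suc_right: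
  assumes "x \<in> {1..n}" "y \<in> {1..n}"
  shows "mat_power n P (Suc m) x y = (\<Sum>z=1..n. mat_power n P m x z * P z y)"
  using assms
proof (induction m arbitrary: x)
  case 0
  then show ?case by (simp add: sum_id_entry del: atLeastAtMost_iff)
next
  case (Suc m)
  have "mat_power n P (Suc (Suc m)) x y = (\<Sum>w=1..n. P x w * (\<Sum>z=1..n. mat_power n P m w z * P z y))"
    using Suc by (simp only: mat_power.simps(2)[of n P "Suc m"]) (auto intro!: sum.cong)
  also have "\<dots> = (\<Sum>z=1..n. (\<Sum>w=1..n. P x w * mat_power n P m w z) * P z y)"
    unfolding sum_distrib_left sum_distrib_right by (subst sum.swap) (simp add: mult.assoc)
  finally show ?case by simp
qed

lemma stochastic_mat_power:
  assumes "stochastic_matrix n P"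
  shows "stochastic_matrix n (mat_power n P m)"
proof (induction m)
  case 0
  have "(\<Sum>z=1..n. id_entry x z) = 1" if "x \<in> {1..n}" for x
    using sum_id_entry(1)[of "{1..n}" x "\<lambda>_. 1"] that by simp
  then show ?case
    by (auto simp: stochastic_matrix_def id_entry_def)
next
  case (Suc m)
  have nonneg: "0 \<le> P x z" "0 \<le> mat_power n P m x z" if "x \<in> {1..n}" "z \<in> {1..n}" for x z
    using that assms Suc by (auto simp: stochastic_matrix_def)
  have "(\<Sum>y=1..n. \<Sum>z=1..n. P x z * mat_power n P m z y) = 1" if x: "x \<in> {1..n}" for x
  proof -
    have "(\<Sum>y=1..n. \<Sum>z=1..n. P x z * mat_power n P m z y)
        = (\<Sum>z=1..n. P x z * (\<Sum>y=1..n. mat_power n P m z y))"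
      by (subst sum.swap) (simp add: sum_distrib_left)
    also have "\<dots> = (\<Sum>z=1..n. P x z)"
      using Suc by (intro sum.cong) (auto simp: stochastic_matrix_def)
    finally show ?thesis
      using assms x by (simp add: stochastic_matrix_def)
  qed
  then show ?case
    unfolding stochastic_matrix_def using nonneg by (auto intro!: sum_nonneg)
qed

lemma stochastic_matrix_le_1:
  assumes "stochastic_matrix n P" "x \<in> {1..n}" "y \<in> {1..n}"
  shows "0 \<le> P x y" "P x y \<le> 1"
proof -
  show "0 \<le> P x y"
    using assms by (simp add: stochastic_matrix_def)
  have "P x y \<le> (\<Sum>z=1..n. P x z)"
    using assms by (intro member_le_sum) (auto simp: stochastic_matrix_def)
  then show "P x y \<le> 1"
    using assms by (simp add: stochastic_matrix_def)
qed

lemma abs_mat_power_le_1: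
  assumes "stochastic_matrix n P" "x \<in> {1..n}" "y \<in> {1..n}"
  shows "\<bar>mat_power n P m x y\<bar> \<le> 1"
  using stochastic_matrix_le_1[OF stochastic_mat_power[OF assms(1)] assms(2,3), of m] by auto

text \<open>Truncated subtraction makes \<open>r = 0\<close> the point mass at 0, as
  \<open>(m - 1) choose m\<close> vanishes for \<open>m > 0\<close>. This is the base case of the
  inductions on \<open>r\<close>.\<close>

definition nb_mass :: "nat \<Rightarrow> real \<Rightarrow> nat \<Rightarrow> real" where
  "nb_mass r a m = real ((r + m - 1) choose m) * a ^ m * (1 - a) ^ r"

lemma nb_mass_eq_pmf:
  assumes "0 \<le> a" "a < 1"
  shows "nb_mass r a m = pmf (neg_binomial_pmf r (1 - a)) m"
  using assms by (simp add: nb_mass_def pmf_neg_binomial add.commute mult_ac)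

lemma nb_mass_sums:
  assumes "0 \<le> a" "a < 1"
  shows "nb_mass r a sums 1"
proof -
  have "pmf (neg_binomial_pmf r (1 - a)) sums (\<integral>m. pmf (neg_binomial_pmf r (1 - a)) m \<partial>count_space UNIV)"
    by (intro sums_integral_count_space_nat integrable_pmf)
  moreover have "nb_mass r a = pmf (neg_binomial_pmf r (1 - a))"
    using assms by (simp add: nb_mass_eq_pmf fun_eq_iff)
  ultimately show ?thesis
    by (simp add: integral_pmf)
qed

lemma nb_mass_nonneg: "0 \<le> a \<Longrightarrow> a < 1 \<Longrightarrow> 0 \<le> nb_mass r a m"
  by (simp add: nb_mass_def)

lemma nb_mass_Suc_0: "nb_mass (Suc r) a 0 = (1 - a) * nb_mass r a 0"
  by (simp add: nb_mass_def)

text \<open>The law counts the outcomes of probability \<open>a\<close> that precede outcome number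
  \<open>r\<close> of probability \<open>1 - a\<close>; the recursion conditions on the first trial.
  Algebraically it is Pascal's rule.\<close>

lemma nb_mass_Suc_Suc:
  "nb_mass (Suc r) a (Suc m) = a * nb_mass (Suc r) a m + (1 - a) * nb_mass r a (Suc m)"
  by (simp add: nb_mass_def algebra_simps)

lemma summable_nb_mass_mult:
  assumes "0 \<le> a" "a < 1" "\<And>m. \<bar>f m\<bar> \<le> B"
  shows "summable (\<lambda>m. nb_mass r a m * f m)"
proof (rule summable_comparison_test')
  show "summable (\<lambda>m. nb_mass r a m * B)"
    using nb_mass_sums[OF assms(1,2)] by (intro summable_mult2) (auto simp: sums_iff)
  show "norm (nb_mass r a m * f m) \<le> nb_mass r a m * B" for m
    using assms nb_mass_nonneg[OF assms(1,2), of r m] by (auto simp: abs_mult intro!: mult_left_mono)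
qed

lemma nb_sum_step:
  assumes a: "0 \<le> a" "a < 1" and f: "\<And>m. \<bar>f m\<bar> \<le> B"
  shows "(\<Sum>m. nb_mass (Suc r) a m * f m)
    = a * (\<Sum>m. nb_mass (Suc r) a m * f (Suc m)) + (1 - a) * (\<Sum>m. nb_mass r a m * f m)"
proof -
  have s0: "summable (\<lambda>m. nb_mass r a m * f m)" for r
    by (rule summable_nb_mass_mult[OF a f])
  have s1: "summable (\<lambda>m. nb_mass (Suc r) a m * f (Suc m))"
    by (rule summable_nb_mass_mult[OF a, where B = B]) (rule f)
  have s2: "summable (\<lambda>m. nb_mass r a (Suc m) * f (Suc m))"
    using s0 by (subst summable_Suc_iff[of "\<lambda>m. nb_mass r a m * f m"])
  have "(\<Sum>m. nb_mass (Suc r) a m * f m)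
      = (\<Sum>m. nb_mass (Suc r) a (Suc m) * f (Suc m)) + nb_mass (Suc r) a 0 * f 0"
    using suminf_split_head[OF s0, of "Suc r"] by simp
  also have "(\<Sum>m. nb_mass (Suc r) a (Suc m) * f (Suc m))
      = (\<Sum>m. a * (nb_mass (Suc r) a m * f (Suc m)) + (1 - a) * (nb_mass r a (Suc m) * f (Suc m)))"
    by (simp add: nb_mass_Suc_Suc algebra_simps)
  also have "\<dots> = a * (\<Sum>m. nb_mass (Suc r) a m * f (Suc m)) + (1 - a) * (\<Sum>m. nb_mass r a (Suc m) * f (Suc m))"
    using s1 s2 by (simp add: suminf_add[symmetric] suminf_mult summable_mult)
  also have "(\<Sum>m. nb_mass r a (Suc m) * f (Suc m)) = (\<Sum>m. nb_mass r a m * f m) - nb_mass r a 0 * f 0"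
    using suminf_split_head[OF s0, of r] by simp
  finally show ?thesis
    by (simp add: nb_mass_Suc_0 algebra_simps)
qed

text \<open>This is \<open>((1 - a) (I - a P)^-1)^r\<close>, written as a power series so that
  nonnegativity and row sums can be read off and no inverse has to be formed.\<close>

definition nb_mixture :: "nat \<Rightarrow> (nat \<Rightarrow> nat \<Rightarrow> real) \<Rightarrow> nat \<Rightarrow> real \<Rightarrow> nat \<Rightarrow> nat \<Rightarrow> real" where
  "nb_mixture n P r a x y = (\<Sum>m. nb_mass r a m * mat_power n P m x y)"

context
  fixes n :: nat and P :: "nat \<Rightarrow> nat \<Rightarrow> real" and a :: real
  assumes P: "stochastic_matrix n P" and a: "0 \<le> a" "a < 1"
begin

lemma nb_mixture_summable:
  "x \<in> {1..n} \<Longrightarrow> y \<in> {1..n} \<Longrightarrow> summable (\<lambda>m. nb_mass r a m * mat_power n P m x y)"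
  by (rule summable_nb_mass_mult[OF a abs_mat_power_le_1[OF P]])

lemma nb_mixture_0: "x \<in> {1..n} \<Longrightarrow> y \<in> {1..n} \<Longrightarrow> nb_mixture n P 0 a x y = id_entry x y"
proof -
  have "nb_mass 0 a m * mat_power n P m x y = (if m = 0 then id_entry x y else 0)" for m
    by (cases m) (simp_all add: nb_mass_def)
  then have "nb_mixture n P 0 a x y = (\<Sum>m. if m = 0 then id_entry x y else 0)"
    by (simp only: nb_mixture_def)
  also have "\<dots> = id_entry x y"
    using sums_unique[OF sums_single[of 0 "\<lambda>_. id_entry x y"]] by simp
  finally show ?thesis .
qed

lemma stochastic_nb_mixture: "stochastic_matrix n (nb_mixture n P r a)"
  unfolding stochastic_matrix_def
proof (intro conjI ballI)
  fix x y assume xy: "x \<in> {1..n}" "y \<in> {1..n}"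
  show "0 \<le> nb_mixture n P r a x y"
    unfolding nb_mixture_def
    using stochastic_matrix_le_1[OF stochastic_mat_power[OF P]] xy nb_mass_nonneg[OF a]
    by (intro suminf_nonneg nb_mixture_summable) auto
next
  fix x assume x: "x \<in> {1..n}"
  have "(\<Sum>y=1..n. nb_mixture n P r a x y) = (\<Sum>m. \<Sum>y=1..n. nb_mass r a m * mat_power n P m x y)"
    unfolding nb_mixture_def using x nb_mixture_summable by (intro suminf_sum[symmetric]) auto
  also have "\<dots> = (\<Sum>m. nb_mass r a m)"
    using stochastic_mat_power[OF P] x by (simp add: stochastic_matrix_def sum_distrib_left[symmetric])
  also have "\<dots> = 1"
    using nb_mass_sums[OF a] by (simp add: sums_iff)
  finally show "(\<Sum>y=1..n. nb_mixture n P r a x y) = 1" .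
qed

text \<open>The mixture of order \<open>Suc r\<close> times \<open>I - a P\<close> is
  \<open>1 - a\<close> times the mixture of order \<open>r\<close>. With \<open>P\<close> on the
  right the identity can be tested against functions; its twin with \<open>P\<close> on the left
  shows that the columns solve the resolvent equation. Together they stand in for uniqueness of the
  inverse.\<close>

lemma nb_mixture_step_right:
  assumes xy: "x \<in> {1..n}" "y \<in> {1..n}"
  shows "nb_mixture n P (Suc r) a x y
    = a * (\<Sum>z=1..n. nb_mixture n P (Suc r) a x z * P z y) + (1 - a) * nb_mixture n P r a x y"
proof -
  have "(\<Sum>m. nb_mass (Suc r) a m * mat_power n P (Suc m) x y)
      = (\<Sum>m. \<Sum>z=1..n. nb_mass (Suc r) a m * mat_power n P m x z * P z y)"
    using xy by (simp add: mat_power_Suc_right sum_distrib_left mult.assoc del: mat_power.simps atLeastAtMost_iff)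
  also have "\<dots> = (\<Sum>z=1..n. \<Sum>m. nb_mass (Suc r) a m * mat_power n P m x z * P z y)"
    using xy nb_mixture_summable by (intro suminf_sum summable_mult2) auto
  also have "\<dots> = (\<Sum>z=1..n. nb_mixture n P (Suc r) a x z * P z y)"
    unfolding nb_mixture_def using xy nb_mixture_summable
    by (intro sum.cong refl suminf_mult2[symmetric]) auto
  finally show ?thesis
    using nb_sum_step[OF a abs_mat_power_le_1[OF P xy], of r] by (simp add: nb_mixture_def)
qed

lemma nb_mixture_step_left:
  assumes xy: "x \<in> {1..n}" "y \<in> {1..n}"
  shows "nb_mixture n P (Suc r) a x y
    = a * (\<Sum>z=1..n. P x z * nb_mixture n P (Suc r) a z y) + (1 - a) * nb_mixture n P r a x y"
proof -
  have "(\<Sum>m. nb_mass (Suc r) a m * mat_power n P (Suc m) x y)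
      = (\<Sum>m. \<Sum>z=1..n. P x z * (nb_mass (Suc r) a m * mat_power n P m z y))"
    by (simp add: sum_distrib_left mult_ac)
  also have "\<dots> = (\<Sum>z=1..n. \<Sum>m. P x z * (nb_mass (Suc r) a m * mat_power n P m z y))"
    using xy nb_mixture_summable by (intro suminf_sum summable_mult) auto
  also have "\<dots> = (\<Sum>z=1..n. P x z * nb_mixture n P (Suc r) a z y)"
    unfolding nb_mixture_def using xy nb_mixture_summable
    by (intro sum.cong refl suminf_mult) auto
  finally show ?thesis
    using nb_sum_step[OF a abs_mat_power_le_1[OF P xy], of r] by (simp add: nb_mixture_def)
qed

end

text \<open>
  With \<open>P = I + h G\<close> and success parameter \<open>c / (c + h)\<close> the mixture is the resolvent power
  \<open>(I - c G)\<^sup>-\<^sup>r\<close>, which does not involve \<open>h\<close>.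
\<close>

definition euler_step :: "(nat \<Rightarrow> nat \<Rightarrow> real) \<Rightarrow> real \<Rightarrow> nat \<Rightarrow> nat \<Rightarrow> real" where
  "euler_step G h x y = id_entry x y + h * G x y"

text \<open>With \<open>c = t / r\<close> the parameter \<open>c / (c + h)\<close> is the
  \<open>t / (t + h r)\<close> of the statement. The step stays an argument because the
  probabilistic representation needs \<open>I + h G\<close> to be stochastic.\<close>

definition resolvent_power :: "nat \<Rightarrow> (nat \<Rightarrow> nat \<Rightarrow> real) \<Rightarrow> real \<Rightarrow> real \<Rightarrow> nat \<Rightarrow> nat \<Rightarrow> nat \<Rightarrow> real" where
  "resolvent_power n G c h r = nb_mixture n (euler_step G h) r (c / (c + h))"

locale resolvent =
  fixes n :: nat and G :: "nat \<Rightarrow> nat \<Rightarrow> real" and c h :: real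
  assumes c: "0 < c" and h: "0 < h" and stoch: "stochastic_matrix n (euler_step G h)"
begin

lemma ratio: "0 \<le> c / (c + h)" "c / (c + h) < 1" "1 - c / (c + h) = h / (c + h)"
  using c h by (auto simp: field_simps)

lemma stochastic_resolvent_power: "stochastic_matrix n (resolvent_power n G c h r)"
  unfolding resolvent_power_def by (rule stochastic_nb_mixture[OF stoch ratio(1,2)])

lemma resolvent_power_0:
  "x \<in> {1..n} \<Longrightarrow> y \<in> {1..n} \<Longrightarrow> resolvent_power n G c h 0 x y = id_entry x y"
  unfolding resolvent_power_def by (rule nb_mixture_0[OF stoch ratio(1,2)])

text \<open>Here \<open>h\<close> disappears: after multiplication by \<open>c + h\<close> the terms
  \<open>c * s\<close> cancel, and what remains is \<open>h\<close> times the claim.\<close>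

lemma resolvent_eqI:
  assumes "s = c / (c + h) * (s + h * g) + (1 - c / (c + h)) * s0"
  shows "s - c * g = s0"
proof -
  have "(c + h) * s = (c + h) * (c / (c + h) * (s + h * g) + h / (c + h) * s0)"
    using assms unfolding ratio(3) by simp
  also have "\<dots> = c * (s + h * g) + h * s0"
    using c h by (simp add: distrib_left del: distrib_left_numeral)
  finally have "(c + h) * s = c * (s + h * g) + h * s0" .
  then have "h * (s - c * g - s0) = 0"
    by (simp add: algebra_simps)
  then show ?thesis using h by simp
qed

lemma resolvent_power_right:
  assumes xy: "x \<in> {1..n}" "y \<in> {1..n}"
  shows "resolvent_power n G c h (Suc r) x y - c * (\<Sum>z=1..n. resolvent_power n G c h (Suc r) x z * G z y)
    = resolvent_power n G c h r x y"
proof (rule resolvent_eqI)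
  let ?S = "resolvent_power n G c h (Suc r)"
  have "(\<Sum>z=1..n. ?S x z * euler_step G h z y) = ?S x y + h * (\<Sum>z=1..n. ?S x z * G z y)"
    using xy sum_id_entry(2)[of "{1..n}" y "?S x"]
    by (simp add: euler_step_def distrib_left sum.distrib sum_distrib_left mult.left_commute)
  then show "?S x y = c / (c + h) * (?S x y + h * (\<Sum>z=1..n. ?S x z * G z y))
      + (1 - c / (c + h)) * resolvent_power n G c h r x y"
    using nb_mixture_step_right[OF stoch ratio(1,2) xy, of r] by (simp add: resolvent_power_def)
qed

lemma resolvent_power_left:
  assumes xy: "x \<in> {1..n}" "y \<in> {1..n}"
  shows "resolvent_power n G c h (Suc r) x y - c * (\<Sum>z=1..n. G x z * resolvent_power n G c h (Suc r) z y)
    = resolvent_power n G c h r x y"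
proof (rule resolvent_eqI)
  let ?S = "resolvent_power n G c h (Suc r)"
  have "(\<Sum>z=1..n. euler_step G h x z * ?S z y) = ?S x y + h * (\<Sum>z=1..n. G x z * ?S z y)"
    using xy sum_id_entry(1)[of "{1..n}" x "\<lambda>z. ?S z y"]
    by (simp add: euler_step_def distrib_right sum.distrib sum_distrib_left mult.assoc)
  then show "?S x y = c / (c + h) * (?S x y + h * (\<Sum>z=1..n. G x z * ?S z y))
      + (1 - c / (c + h)) * resolvent_power n G c h r x y"
    using nb_mixture_step_left[OF stoch ratio(1,2) xy, of r] by (simp add: resolvent_power_def)
qed

text \<open>The resolvent form of Dynkin's formula. The estimates of survival and occupation below
  all come from a function \<open>g\<close> for which \<open>g - c G g\<close> is bounded from one
  side.\<close>

lemma resolvent_power_test_function: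
  assumes x: "x \<in> {1..n}"
  shows "(\<Sum>z=1..n. resolvent_power n G c h (Suc r) x z * (g z - c * (\<Sum>y=1..n. G z y * g y)))
    = (\<Sum>y=1..n. resolvent_power n G c h r x y * g y)"
proof -
  let ?S = "resolvent_power n G c h (Suc r)"
  have "(\<Sum>z=1..n. ?S x z * (\<Sum>y=1..n. G z y * g y)) = (\<Sum>y=1..n. (\<Sum>z=1..n. ?S x z * G z y) * g y)"
    unfolding sum_distrib_left sum_distrib_right by (subst sum.swap) (simp add: mult.assoc)
  then have "(\<Sum>z=1..n. ?S x z * (g z - c * (\<Sum>y=1..n. G z y * g y)))
      = (\<Sum>y=1..n. (?S x y - c * (\<Sum>z=1..n. ?S x z * G z y)) * g y)"
    by (simp add: algebra_simps sum_subtractf sum_distrib_left[symmetric])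
  also have "\<dots> = (\<Sum>y=1..n. resolvent_power n G c h r x y * g y)"
    by (intro sum.cong refl) (simp only: resolvent_power_right[OF x])
  finally show ?thesis .
qed

end

text \<open>By the left identity the column \<open>?g\<close> of the first power, built with step
  \<open>h\<close>, solves \<open>(I - c G) g = e_y\<close>. Testing a power built with an arbitrary
  step \<open>e\<close> against this same column expresses order \<open>Suc r\<close> by order
  \<open>r\<close> with coefficients free of \<open>e\<close>, so induction on \<open>r\<close>
  applies.\<close>

lemma resolvent_power_step_independent:
  assumes "resolvent n G c h" "resolvent n G c h'" and xy: "x \<in> {1..n}" "y \<in> {1..n}"
  shows "resolvent_power n G c h r x y = resolvent_power n G c h' r x y"
  using xy
proof (induction r arbitrary: y)
  case 0
  then show ?case
    using assms by (simp add: resolvent.resolvent_power_0 del: atLeastAtMost_iff)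
next
  case (Suc r)
  let ?g = "\<lambda>z. resolvent_power n G c h 1 z y"
  have g: "?g z - c * (\<Sum>w=1..n. G z w * ?g w) = id_entry z y" if "z \<in> {1..n}" for z
    using resolvent.resolvent_power_left[OF assms(1) that Suc.prems(2), of 0]
      resolvent.resolvent_power_0[OF assms(1) that Suc.prems(2)] by simp
  have *: "resolvent_power n G c e (Suc r) x y = (\<Sum>z=1..n. resolvent_power n G c e r x z * ?g z)"
    if "resolvent n G c e" for e
  proof -
    have "(\<Sum>z=1..n. resolvent_power n G c e (Suc r) x z * id_entry z y)
        = (\<Sum>z=1..n. resolvent_power n G c e r x z * ?g z)"
      using resolvent.resolvent_power_test_function[OF that xy(1), of r ?g] g by simp
    then show ?thesis
      using Suc.prems by (simp add: sum_id_entry del: atLeastAtMost_iff)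
  qed
  show ?case
    unfolding *[OF assms(1)] *[OF assms(2)] using Suc by (intro sum.cong) auto
qed

section \<open>Birth and death generators with killing\<close>

definition bd_generator ::
  "nat \<Rightarrow> (nat \<Rightarrow> real) \<Rightarrow> (nat \<Rightarrow> real) \<Rightarrow> (nat \<Rightarrow> real) \<Rightarrow> (nat \<Rightarrow> real) \<Rightarrow> nat \<Rightarrow> nat \<Rightarrow> real" where
  "bd_generator M qu qd kt lam j m =
     (if j \<in> {2..M-1} then
        (if m = j + 1 then lam j * qu j
         else if m = j - 1 then lam j * qd j
         else if m = j then - (lam j * (1 + kt j))
         else if m = M + 1 then lam j * kt j
         else 0)
      else 0)"

text \<open>The levels, the drift and the killing enter the embedding only through the jump weights
  \<open>qu\<close>, \<open>qd\<close> and the killing weight \<open>kt\<close>, which is relative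
  to the rate: killing happens at rate \<open>lam j * kt j\<close>.\<close>

locale birth_death =
  fixes M :: nat and qu qd kt :: "nat \<Rightarrow> real"
  assumes M: "M \<ge> 3"
    and qu: "\<And>j. j \<in> {2..M-1} \<Longrightarrow> 0 < qu j"
    and qd: "\<And>j. j \<in> {2..M-1} \<Longrightarrow> 0 < qd j"
    and q1: "\<And>j. j \<in> {2..M-1} \<Longrightarrow> qu j + qd j = 1"
    and kt: "\<And>j. j \<in> {2..M-1} \<Longrightarrow> 0 \<le> kt j"
begin

abbreviation gen :: "(nat \<Rightarrow> real) \<Rightarrow> nat \<Rightarrow> nat \<Rightarrow> real" where
  "gen \<equiv> bd_generator M qu qd kt"

lemma gen_boundary: "j \<notin> {2..M-1} \<Longrightarrow> gen lam j m = 0"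
  unfolding bd_generator_def by (rule if_not_P)

lemma gen_apply:
  assumes j: "j \<in> {2..M-1}"
  shows "(\<Sum>m=1..M+1. gen lam j m * g m)
    = lam j * (qu j * g (j + 1) + qd j * g (j - 1) + kt j * g (M + 1) - (1 + kt j) * g j)"
proof -
  have "(\<Sum>m=1..M+1. gen lam j m * g m)
      = (\<Sum>m=1..M+1. (if m = j + 1 then lam j * qu j * g m else 0) + (if m = j - 1 then lam j * qd j * g m else 0)
          + (if m = M + 1 then lam j * kt j * g m else 0) - (if m = j then lam j * (1 + kt j) * g m else 0))"
    using j M by (intro sum.cong refl) (auto simp: bd_generator_def)
  also have "\<dots> = lam j * qu j * g (j + 1) + lam j * qd j * g (j - 1) + lam j * kt j * g (M + 1) - lam j * (1 + kt j) * g j"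
    using j M by (subst sum_subtractf, subst sum.distrib, subst sum.distrib) (auto simp: sum.delta)
  finally show ?thesis
    by (simp add: algebra_simps)
qed

lemma stochastic_euler_step:
  assumes h: "0 \<le> h" and lam: "\<And>j. j \<in> {2..M-1} \<Longrightarrow> 0 \<le> lam j"
    and hlam: "\<And>j. j \<in> {2..M-1} \<Longrightarrow> h * (lam j * (1 + kt j)) \<le> 1"
  shows "stochastic_matrix (M + 1) (euler_step (gen lam) h)"
  unfolding stochastic_matrix_def
proof (intro conjI ballI)
  fix j m assume "j \<in> {1..M+1}" "m \<in> {1..M+1}"
  show "0 \<le> euler_step (gen lam) h j m"
  proof (cases "j \<in> {2..M-1}")
    case True
    then show ?thesis
      using lam[OF True] qu[OF True] qd[OF True] kt[OF True] hlam[OF True] h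
      by (auto simp: euler_step_def bd_generator_def id_entry_def)
  next
    case False
    then show ?thesis
      by (simp add: euler_step_def gen_boundary id_entry_def)
  qed
next
  fix j assume j: "j \<in> {1..M+1}"
  have id1: "(\<Sum>m=1..M+1. id_entry j m) = 1"
    using sum_id_entry(1)[of "{1..M+1}" j "\<lambda>_. 1"] j by simp
  have "(\<Sum>m=1..M+1. gen lam j m) = 0"
  proof (cases "j \<in> {2..M-1}")
    case True
    then show ?thesis
      using gen_apply[OF True, of lam "\<lambda>_. 1"] q1[OF True] by simp
  next
    case False
    then show ?thesis by (simp add: gen_boundary)
  qed
  then show "(\<Sum>m=1..M+1. euler_step (gen lam) h j m) = 1"
    using id1 by (simp only: euler_step_def sum.distrib sum_distrib_left[symmetric])
qed

text \<open>A base so large that \<open>qu j * steep \<ge> 2 + kt j\<close> at every interior state: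
  for the function \<open>steep ^ y\<close> an upward jump then outweighs holding, killing and a
  downward jump. The sum is a convenient bound for the maximum of the ratios, and the leading 2
  keeps \<open>steep - 1\<close> at least 1.\<close>

definition steep :: real where
  "steep = 2 + (\<Sum>j=2..M-1. (2 + kt j) / qu j)"

lemma steep_ge_2: "2 \<le> steep"
  unfolding steep_def using qu kt by (auto intro!: sum_nonneg divide_nonneg_pos simp: add_nonneg_nonneg)

lemma qu_steep:
  assumes "j \<in> {2..M-1}"
  shows "2 + kt j \<le> qu j * steep"
proof -
  have "(2 + kt j) / qu j \<le> (\<Sum>j=2..M-1. (2 + kt j) / qu j)"
    using assms qu kt by (intro member_le_sum) (auto intro!: divide_nonneg_pos simp: add_nonneg_nonneg)
  then have "(2 + kt j) / qu j \<le> steep"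
    by (simp add: steep_def)
  then show ?thesis
    using qu[OF assms] by (simp add: divide_simps mult.commute)
qed

end

section \<open>Survival, occupation and blocking for the resolvent powers\<close>

locale birth_death_resolvent = birth_death +
  fixes lam :: "nat \<Rightarrow> real" and c h :: real
  assumes lam: "\<And>j. 0 \<le> lam j"
    and c: "0 < c" and h: "0 < h"
    and hlam: "\<And>j. j \<in> {2..M-1} \<Longrightarrow> h * (lam j * (1 + kt j)) \<le> 1"
begin

sublocale resolvent "M + 1" "gen lam" c h
proof unfold_locales
  show "stochastic_matrix (M + 1) (euler_step (gen lam) h)"
    using h lam hlam by (intro stochastic_euler_step) (auto simp: less_imp_le)
qed (fact c h)+

abbreviation S :: "nat \<Rightarrow> nat \<Rightarrow> nat \<Rightarrow> real" where
  "S \<equiv> resolvent_power (M + 1) (gen lam) c h"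

abbreviation alive :: "nat \<Rightarrow> nat \<Rightarrow> real" where
  "alive r x \<equiv> (\<Sum>y=1..M. S r x y)"

lemma S_nonneg: "x \<in> {1..M} \<Longrightarrow> y \<in> {1..M+1} \<Longrightarrow> 0 \<le> S r x y"
  using stochastic_matrix_le_1(1)[OF stochastic_resolvent_power] by simp

lemma alive_le_1:
  assumes "x \<in> {1..M}"
  shows "alive r x \<le> 1"
proof -
  have "(\<Sum>y=1..M+1. S r x y) = 1"
    using stochastic_resolvent_power[of r] assms by (simp add: stochastic_matrix_def)
  then show ?thesis
    using S_nonneg[OF assms, of "M+1" r] by simp
qed

text \<open>The cemetery row of \<open>gen\<close> vanishes, so for a function that is 0 there the
  index \<open>M + 1\<close> drops out of both outer sums.\<close>

lemma test_function:
  assumes x: "x \<in> {1..M}" and D: "g (M + 1) = 0"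
  shows "(\<Sum>z=1..M. S (Suc r) x z * (g z - c * (\<Sum>y=1..M+1. gen lam z y * g y))) = (\<Sum>y=1..M. S r x y * g y)"
proof -
  have "gen lam (M+1) y = 0" for y
    by (rule gen_boundary) auto
  then show ?thesis
    using resolvent_power_test_function[of x r g] x D by simp
qed

text \<open>Test with the indicator of the living states: its generator is minus the killing rate,
  hence at least \<open>- K\<close>, and each order of the resolvent loses at most the factor
  \<open>1 + c * K\<close>. With \<open>c = t / r\<close> and the maximal killing rate as
  \<open>K\<close> this is the lower end of \<open>alpha_interval\<close>.\<close>

lemma alive_lower_bound:
  assumes x: "x \<in> {1..M}" and K: "0 \<le> K" "\<And>j. j \<in> {2..M-1} \<Longrightarrow> kt j * lam j \<le> K"
  shows "1 \<le> (1 + c * K) ^ r * alive r x"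
proof (induction r)
  case 0
  have "(\<Sum>y=1..M. id_entry x y) = 1"
    using sum_id_entry(1)[of "{1..M}" x "\<lambda>_. 1"] x by simp
  then have "alive 0 x = 1"
    using resolvent_power_0[of x] x by simp
  then show ?case by simp
next
  case (Suc r)
  let ?g = "\<lambda>y. if y = M + 1 then 0 else 1::real"
  let ?G = "\<lambda>z. \<Sum>y=1..M+1. gen lam z y * ?g y"
  have "alive r x = (\<Sum>y=1..M. S r x y * ?g y)"
    by (intro sum.cong) auto
  also have "\<dots> = (\<Sum>z=1..M. S (Suc r) x z * (?g z - c * ?G z))"
    by (rule test_function[symmetric]) (use x in auto)
  also have "\<dots> \<le> (\<Sum>z=1..M. S (Suc r) x z * (1 + c * K))"
  proof (intro sum_mono mult_left_mono)
    fix z assume z: "z \<in> {1..M}"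
    show "?g z - c * ?G z \<le> 1 + c * K"
    proof (cases "z \<in> {2..M-1}")
      case True
      have "?G z = - (kt z * lam z)"
      proof -
        have "qu z = 1 - qd z" "z + 1 \<noteq> M + 1" "z - 1 \<noteq> M + 1" "z \<noteq> M + 1"
          using q1[OF True] True by auto
        then show ?thesis
          unfolding gen_apply[OF True] by (simp add: algebra_simps)
      qed
      then show ?thesis
        using K(2)[OF True] c z by (simp add: mult_left_mono)
    next
      case False
      then show ?thesis
        using K(1) c by (simp add: gen_boundary)
    qed
    show "0 \<le> S (Suc r) x z" using S_nonneg[OF x] z by simp
  qed
  also have "\<dots> = (1 + c * K) * alive (Suc r) x"
    by (simp add: sum_distrib_left mult.commute)
  finally have "(1 + c * K) ^ r * alive r x \<le> (1 + c * K) ^ r * ((1 + c * K) * alive (Suc r) x)"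
    using K(1) c by (intro mult_left_mono) auto
  then show ?case
    using Suc by (simp add: mult_ac)
qed

lemma alive_pos:
  assumes x: "x \<in> {1..M}"
  shows "0 < alive r x"
proof -
  \<comment> \<open>Positivity follows from any finite bound on the killing rates; their sum is
    one.\<close>
  let ?K = "\<Sum>j=2..M-1. kt j * lam j"
  have "0 \<le> ?K"
    using kt lam by (auto intro!: sum_nonneg)
  moreover have "kt j * lam j \<le> ?K" if "j \<in> {2..M-1}" for j
    using that kt lam by (intro member_le_sum) auto
  ultimately have "1 \<le> (1 + c * ?K) ^ r * alive r x" "0 < (1 + c * ?K) ^ r"
    using alive_lower_bound[OF x] c by (auto intro!: zero_less_power add_pos_nonneg)
  then show ?thesis
    by (meson less_le_trans zero_less_mult_pos zero_less_one)
qed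

text \<open>\<open>steep\<^sup>y\<close> is subharmonic, so killing cannot destroy too much mass.\<close>

lemma alive_ratio:
  assumes x: "x \<in> {1..M}"
  shows "alive r x \<le> steep ^ M * alive (Suc r) x"
proof -
  \<comment> \<open>The indicator of the living states would give a constant that grows with the
    rates. The exponential lies between 1 and \<open>steep ^ M\<close> on the living states, and
    this range is all that enters the constant.\<close>
  let ?g = "\<lambda>y. if y = M + 1 then 0 else steep ^ y"
  let ?G = "\<lambda>z. \<Sum>y=1..M+1. gen lam z y * ?g y"
  have "alive r x \<le> (\<Sum>y=1..M. S r x y * ?g y)"
  proof (intro sum_mono)
    fix y assume y: "y \<in> {1..M}"
    have "1 \<le> ?g y"
      using y steep_ge_2 by simp
    then show "S r x y \<le> S r x y * ?g y"
      using mult_left_mono[of 1 "?g y" "S r x y"] S_nonneg[OF x, of y r] y by simp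
  qed
  also have "\<dots> = (\<Sum>z=1..M. S (Suc r) x z * (?g z - c * ?G z))"
    by (rule test_function[symmetric]) (use x in auto)
  also have "\<dots> \<le> (\<Sum>z=1..M. S (Suc r) x z * steep ^ M)"
  proof (intro sum_mono mult_left_mono)
    fix z assume z: "z \<in> {1..M}"
    have "0 \<le> ?G z"
    proof (cases "z \<in> {2..M-1}")
      case True
      \<comment> \<open>By the choice of \<open>steep\<close> the upward jump alone pays for holding
        and killing; the downward term only helps.\<close>
      have "(1 + kt z) * steep ^ z \<le> qu z * steep * steep ^ z"
        using qu_steep[OF True] steep_ge_2 by (intro mult_right_mono) auto
      moreover have "0 \<le> qd z * steep ^ (z - 1)"
        using qd[OF True] steep_ge_2 by simp
      ultimately show ?thesis
        using True by (subst gen_apply[OF True]) (auto intro!: mult_nonneg_nonneg lam simp: mult_ac)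
    next
      case False
      then show ?thesis by (simp add: gen_boundary)
    qed
    then have "?g z - c * ?G z \<le> ?g z"
      using c by simp
    also have "\<dots> \<le> steep ^ M"
      using z steep_ge_2 by (auto intro!: power_increasing)
    finally show "?g z - c * ?G z \<le> steep ^ M" .
    show "0 \<le> S (Suc r) x z" using S_nonneg[OF x] z by simp
  qed
  also have "\<dots> = steep ^ M * alive (Suc r) x"
    by (simp add: sum_distrib_left mult.commute)
  finally show ?thesis .
qed

text \<open>\<open>steep\<^bsup>M+1\<^esup> - steep\<^sup>y\<close> is superharmonic, which bounds the expected number of visits to \<open>j\<close>.\<close>

lemma fast_state_bound:
  assumes x: "x \<in> {1..M}" and j: "j \<in> {2..M-1}"
  shows "c * lam j * S (Suc r) x j \<le> steep ^ (2 * M + 1) * alive (Suc r) x"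
proof -
  let ?g = "\<lambda>y. if y = M + 1 then 0 else steep ^ (M + 1) - steep ^ y"
  let ?G = "\<lambda>z. \<Sum>y=1..M+1. gen lam z y * ?g y"
  have g_nonneg: "0 \<le> ?g y" if "y \<in> {1..M}" for y
    using that steep_ge_2 power_increasing[of y "M + 1" steep] by simp
  \<comment> \<open>At an interior state the generator of the reversed exponential is at most
    \<open>- lam z\<close>. So \<open>g - c G g\<close> dominates the weight
    \<open>c * lam z\<close> whose expectation is to be estimated.\<close>
  have lower: "(if z \<in> {2..M-1} then c * lam z else 0) \<le> ?g z - c * ?G z"
    if z: "z \<in> {1..M}" for z
  proof (cases "z \<in> {2..M-1}")
    case True
    have z1: "steep ^ z = steep * steep ^ (z - 1)" "steep ^ (z + 1) = steep * steep * steep ^ (z - 1)"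
      using True by (cases z; simp)+
    have q: "1 \<le> qu z * steep - qd z"
      using qu_steep[OF True] kt[OF True] q1[OF True] qu[OF True] by linarith
    \<comment> \<open>The drift of \<open>steep ^ y\<close> at \<open>z\<close> factors as
      \<open>steep ^ (z - 1) * (steep - 1) * (qu z * steep - qd z)\<close>, and each factor is at
      least 1.\<close>
    have "1 * (1 * 1) \<le> steep ^ (z - 1) * ((steep - 1) * (qu z * steep - qd z))"
      using steep_ge_2 q by (intro mult_mono) auto
    also have "\<dots> = qu z * (steep ^ (z + 1) - steep ^ z) + qd z * (steep ^ (z - 1) - steep ^ z)"
      unfolding z1 by (simp add: algebra_simps)
    also have "\<dots> = ?g z - qu z * ?g (z + 1) - qd z * ?g (z - 1)"
    proof -
      have "qd z = 1 - qu z" "z + 1 \<noteq> M + 1" "z - 1 \<noteq> M + 1" "z \<noteq> M + 1"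
        using q1[OF True] True by auto
      then show ?thesis
        by (simp only: if_False) (simp add: algebra_simps)
    qed
    also have "\<dots> \<le> (1 + kt z) * ?g z - qu z * ?g (z + 1) - qd z * ?g (z - 1)"
      using kt[OF True] g_nonneg[OF z] by (simp add: algebra_simps)
    finally have "c * lam z * 1 \<le> c * lam z * ((1 + kt z) * ?g z - qu z * ?g (z + 1) - qd z * ?g (z - 1))"
      using c lam by (intro mult_left_mono) auto
    also have "\<dots> = - c * ?G z"
      unfolding gen_apply[OF True] by (simp add: algebra_simps)
    finally show ?thesis
      using True g_nonneg[OF z] by simp
  next
    case False
    have "?G z = 0"
      by (simp only: gen_boundary[OF False] mult_zero_left sum.neutral_const)
    then show ?thesis
      using False g_nonneg[OF z] by (simp only: if_False)
  qed
  have "c * lam j * S (Suc r) x j = S (Suc r) x j * (if j \<in> {2..M-1} then c * lam j else 0)"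
    using j by (simp only: if_True mult.commute)
  also have "\<dots> \<le> (\<Sum>z=1..M. S (Suc r) x z * (if z \<in> {2..M-1} then c * lam z else 0))"
    using j c lam S_nonneg[OF x] by (intro member_le_sum) auto
  also have "\<dots> \<le> (\<Sum>z=1..M. S (Suc r) x z * (?g z - c * ?G z))"
    using S_nonneg[OF x] lower by (intro sum_mono mult_left_mono) auto
  also have "\<dots> = (\<Sum>y=1..M. S r x y * ?g y)"
    by (rule test_function) (use x in auto)
  also have "\<dots> \<le> (\<Sum>y=1..M. S r x y * steep ^ (M + 1))"
    using S_nonneg[OF x] steep_ge_2 by (intro sum_mono mult_left_mono) auto
  also have "\<dots> = steep ^ (M + 1) * alive r x"
    by (simp add: sum_distrib_left mult.commute)
  \<comment> \<open>Testing has lowered the order from \<open>Suc r\<close> to \<open>r\<close>; the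
    survival ratio returns to order \<open>Suc r\<close>, and the exponents \<open>M + 1\<close> and
    \<open>M\<close> add up to \<open>2 * M + 1\<close>.\<close>
  also have "\<dots> \<le> steep ^ (M + 1) * (steep ^ M * alive (Suc r) x)"
    using alive_ratio[OF x] steep_ge_2 by (intro mult_left_mono) auto
  also have "\<dots> = steep ^ (2 * M + 1) * alive (Suc r) x"
    unfolding mult.assoc[symmetric] power_add[symmetric] by (simp add: mult_2)
  finally show ?thesis .
qed

lemma resolvent_power_eqI:
  assumes "\<And>m. mat_power (M + 1) (euler_step (gen lam) h) m x y = (v :: real)"
  shows "S r x y = v"
  unfolding resolvent_power_def nb_mixture_def assms
  using sums_mult2[OF nb_mass_sums[OF ratio(1,2), of r], of v] by (simp add: sums_iff)

lemma absorbing: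
  assumes x: "x \<in> {1..M+1}" and abs: "x \<in> {2..M-1} \<Longrightarrow> lam x = 0"
  shows "mat_power (M + 1) (euler_step (gen lam) h) m x y = id_entry x y"
proof (induction m)
  case (Suc m)
  have "gen lam x z = 0" for z
    using abs by (simp add: bd_generator_def)
  then have "mat_power (M + 1) (euler_step (gen lam) h) (Suc m) x y
      = (\<Sum>z=1..M+1. id_entry x z * mat_power (M + 1) (euler_step (gen lam) h) m z y)"
    by (simp add: euler_step_def)
  also have "\<dots> = mat_power (M + 1) (euler_step (gen lam) h) m x y"
    using x by (intro sum_id_entry) auto
  finally show ?case using Suc by simp
qed simp

lemma S_boundary: "x \<in> {1, M, M + 1} \<Longrightarrow> S r x y = id_entry x y"
  using M by (intro resolvent_power_eqI absorbing) auto

text \<open>Apart from killing, the chain moves to neighbours only, so it has to step on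
  \<open>j\<close> before reaching the other side, and with rate 0 it never leaves \<open>j\<close>.
  The start \<open>x = j\<close> is included.\<close>

lemma S_blocked:
  assumes j: "j \<in> {2..M-1}" "lam j = 0" and xy: "x \<in> {1..M}" "y \<in> {1..M}"
    and sep: "x \<le> j \<and> j < y \<or> j \<le> x \<and> y < j"
  shows "S r x y = 0"
proof (rule resolvent_power_eqI)
  fix m
  let ?P = "euler_step (gen lam) h"
  show "mat_power (M + 1) ?P m x y = 0"
    using xy(1) sep
  proof (induction m arbitrary: x)
    case 0
    then show ?case by (auto simp: id_entry_def)
  next
    case (Suc m)
    have "?P x z * mat_power (M + 1) ?P m z y = 0" if z: "z \<in> {1..M+1}" for z
    proof (cases "z = M + 1")
      case True
      then show ?thesis
        using absorbing[of "M + 1" m y] xy(2) by (simp add: id_entry_def)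
    next
      case False
      show ?thesis
      proof (cases "z \<le> j \<and> j < y \<or> j \<le> z \<and> y < j")
        case True
        then show ?thesis using Suc.IH[of z] z False by simp
      next
        case nsep: False
        then have "?P x z = 0"
        proof -
          have "x \<noteq> z" "x = j \<or> z \<noteq> x + 1 \<and> z \<noteq> x - 1"
            using nsep Suc.prems by auto
          then have "gen lam x z = 0"
            using j(2) False by (auto simp: bd_generator_def)
          then show ?thesis
            using \<open>x \<noteq> z\<close> by (simp add: euler_step_def id_entry_def)
        qed
        then show ?thesis by simp
      qed
    qed
    then show ?case
      by (simp only: mat_power.simps(2)) (rule sum.neutral, blast)
  qed
qed

end

section \<open>Solving for the rates and the starting law\<close>

lemma continuous_on_coordinate: "continuous_on A (\<lambda>w::nat \<Rightarrow> real. w i)"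
  by (rule continuous_on_subset[OF continuous_on_product_coordinates subset_UNIV])

lemma continuous_on_mat_power:
  assumes "\<And>x y. continuous_on A (\<lambda>w. P w x y)"
  shows "continuous_on A (\<lambda>w. mat_power n (P w) m x y)"
proof (induction m arbitrary: x)
  case (Suc m)
  show ?case
    unfolding mat_power.simps by (intro continuous_on_sum continuous_on_mult assms Suc)
qed simp

text \<open>The entries of the powers are bounded by 1, so the masses \<open>nb_mass r a m\<close>
  majorise the series uniformly in \<open>w\<close>. This uses one \<open>a\<close>, hence one step
  \<open>h\<close>, for all \<open>w\<close>.\<close>

lemma continuous_on_nb_mixture:
  assumes P: "\<And>w. w \<in> A \<Longrightarrow> stochastic_matrix n (P w)" and a: "0 \<le> a" "a < 1"
    and cont: "\<And>x y. continuous_on A (\<lambda>w. P w x y)" and xy: "x \<in> {1..n}" "y \<in> {1..n}"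
  shows "continuous_on A (\<lambda>w. nb_mixture n (P w) r a x y)"
proof -
  have ul: "uniform_limit A (\<lambda>N w. \<Sum>m<N. nb_mass r a m * mat_power n (P w) m x y)
      (\<lambda>w. \<Sum>m. nb_mass r a m * mat_power n (P w) m x y) sequentially"
  proof (rule Weierstrass_m_test)
    fix m w assume w: "w \<in> A"
    show "norm (nb_mass r a m * mat_power n (P w) m x y) \<le> nb_mass r a m"
      using abs_mat_power_le_1[OF P[OF w] xy, of m] nb_mass_nonneg[OF a, of r m]
      by (simp add: abs_mult mult_left_le)
  next
    show "summable (nb_mass r a)"
      using nb_mass_sums[OF a] by (simp add: sums_iff)
  qed
  have "continuous_on A (\<lambda>w. \<Sum>m<N. nb_mass r a m * mat_power n (P w) m x y)" for N
    by (intro continuous_on_sum continuous_on_mult continuous_on_const continuous_on_mat_power cont)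
  then show ?thesis
    unfolding nb_mixture_def
    by (intro uniform_limit_theorem[OF always_eventually[OF allI] ul sequentially_bot])
qed

text \<open>Linear interpolation between the unit masses at the integers: for \<open>s\<close> in
  \<open>[l - 1, l]\<close> the weights are \<open>1 - \<beta>\<close> at \<open>l - 1\<close> and
  \<open>\<beta>\<close> at \<open>l\<close>. A single continuous coordinate thus runs through all
  pairs of \<open>l\<close> and \<beta>.\<close>

definition hat :: "real \<Rightarrow> nat \<Rightarrow> real" where
  "hat s x = max 0 (1 - \<bar>s - real x\<bar>)"

lemma hat_sum:
  assumes s: "1 \<le> s" "s \<le> real M" "2 \<le> M"
  obtains l \<beta> where "l \<in> {2..M}" "0 \<le> \<beta>" "\<beta> \<le> 1" "s = real l - 1 + \<beta>" "s > 1 \<Longrightarrow> 0 < \<beta>"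
    "\<And>f :: nat \<Rightarrow> real. (\<Sum>x=1..M. hat s x * f x) = (1 - \<beta>) * f (l - 1) + \<beta> * f l"
proof -
  \<comment> \<open>The ceiling of \<open>s\<close>, except that \<open>s = 1\<close> is assigned to
    the interval \<open>[1, 2]\<close> with \<open>\<beta> = 0\<close>, because \<open>l\<close> has
    to be at least 2.\<close>
  define l where "l = (if s = 1 then 2 else nat \<lceil>s\<rceil>)"
  define \<beta> where "\<beta> = s - (real l - 1)"
  have l: "l \<in> {2..M}" "real l - 1 \<le> s" "s \<le> real l" "s > 1 \<Longrightarrow> real l - 1 < s"
  proof -
    have *: "2 \<le> nat \<lceil>s\<rceil> \<and> nat \<lceil>s\<rceil> \<le> M \<and> real (nat \<lceil>s\<rceil>) - 1 < s \<and> s \<le> real (nat \<lceil>s\<rceil>)" if "s > 1"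
    proof -
      have "1 < \<lceil>s\<rceil>" "\<lceil>s\<rceil> \<le> int M"
        using that s by (auto simp: ceiling_le_iff less_ceiling_iff)
      moreover have "real (nat \<lceil>s\<rceil>) = of_int \<lceil>s\<rceil>"
        using calculation by simp
      ultimately show ?thesis
        using ceiling_correct[of s] by (simp add: nat_le_iff le_nat_iff)
    qed
    have "l \<in> {2..M} \<and> real l - 1 \<le> s \<and> s \<le> real l \<and> (s > 1 \<longrightarrow> real l - 1 < s)"
    proof (cases "s = 1")
      case True
      then show ?thesis using s by (simp add: l_def)
    next
      case False
      then have "s > 1" using s by simp
      then show ?thesis using * False by (simp add: l_def)
    qed
    then show "l \<in> {2..M}" "real l - 1 \<le> s" "s \<le> real l" "s > 1 \<Longrightarrow> real l - 1 < s"
      by blast+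
  qed
  have "(\<Sum>x=1..M. hat s x * f x) = (1 - \<beta>) * f (l - 1) + \<beta> * f l" for f :: "nat \<Rightarrow> real"
  proof -
    have "hat s x * f x = (if x = l - 1 then (1 - \<beta>) * f x else 0) + (if x = l then \<beta> * f x else 0)" for x
    proof -
      consider "x = l - 1" | "x = l" | "x + 2 \<le> l" | "l + 1 \<le> x"
        by linarith
      then show ?thesis
      proof cases
        case 1
        then have "real x = real l - 1" "x \<noteq> l" using l(1) by auto
        then have "hat s x = 1 - \<beta>" using l unfolding hat_def \<beta>_def by linarith
        then show ?thesis using 1 \<open>x \<noteq> l\<close> by simp
      next
        case 2
        then have "real x = real l" "x \<noteq> l - 1" using l(1) by auto
        then have "hat s x = \<beta>" using l unfolding hat_def \<beta>_def by linarith
        then show ?thesis using 2 \<open>x \<noteq> l - 1\<close> by simp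
      next
        case 3
        then have "real x + 2 \<le> real l" "x \<noteq> l - 1" "x \<noteq> l" by auto
        then have "hat s x = 0" using l unfolding hat_def by linarith
        then show ?thesis using \<open>x \<noteq> l - 1\<close> \<open>x \<noteq> l\<close> by simp
      next
        case 4
        then have "real l + 1 \<le> real x" "x \<noteq> l - 1" "x \<noteq> l" by auto
        then have "hat s x = 0" using l unfolding hat_def by linarith
        then show ?thesis using \<open>x \<noteq> l - 1\<close> \<open>x \<noteq> l\<close> by simp
      qed
    qed
    then have "(\<Sum>x=1..M. hat s x * f x)
        = (\<Sum>x=1..M. if x = l - 1 then (1 - \<beta>) * f x else 0) + (\<Sum>x=1..M. if x = l then \<beta> * f x else 0)"
      by (simp only: sum.distrib)
    also have "\<dots> = (1 - \<beta>) * f (l - 1) + \<beta> * f l"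
      using l(1) by (subst sum.delta, simp, subst sum.delta, simp) auto
    finally show ?thesis .
  qed
  then show thesis
    using l by (intro that[of l \<beta>]) (auto simp: \<beta>_def)
qed

text \<open>Complementarity: at a fixed point of the clamped map the displacement \<open>f\<close>
  vanishes, unless the point lies on a face and \<open>f\<close> points outwards.\<close>

lemma clamp_fixpoint:
  fixes x f :: real
  assumes "max 0 (min 1 (x + f)) = x"
  shows "f = 0 \<or> x = 0 \<and> f \<le> 0 \<or> x = 1 \<and> 0 \<le> f"
  using assms by (auto simp: max_def min_def split: if_splits)

context birth_death
begin

text \<open>
  The unknowns are the starting position \<open>s \<in> [1, M]\<close> and the rates \<open>\<lambda>\<^sub>j \<in> [0, L]\<close>. The clamped map
  raises \<open>\<lambda>\<^sub>j\<close> while the chain puts too much mass on \<open>j\<close> and moves \<open>s\<close> so as to balance the masses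
  of the two end points. At a fixed point no rate is \<open>L\<close>, and a state \<open>j\<close> with too little mass would
  have \<open>\<lambda>\<^sub>j = 0\<close> and separate the starting position from one of the ends, while the balance
  forces both ends to carry mass.
\<close>

theorem embedding_exists:
  assumes p: "\<And>j. j \<in> {1..M} \<Longrightarrow> 0 < p j" and psum: "(\<Sum>j=1..M. p j) = 1" and c: "0 < c"
  obtains l lam \<beta> \<alpha> h where "l \<in> {2..M}" "0 < \<beta>" "\<beta> \<le> 1" "birth_death_resolvent M qu qd kt lam c h"
    "\<And>j. j \<in> {1..M} \<Longrightarrow> (1 - \<beta>) * resolvent_power (M + 1) (gen lam) c h (Suc r) (l - 1) j
        + \<beta> * resolvent_power (M + 1) (gen lam) c h (Suc r) l j = \<alpha> * p j"
proof -
  \<comment> \<open>Chosen so that \<open>c * L * p j\<close> exceeds the constant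
    \<open>steep ^ (2 * M + 1)\<close> of \<open>fast_state_bound\<close> for every
    \<open>j\<close>: a state with rate \<open>L\<close> then holds less than its share
    \<open>p j\<close> of the surviving mass.\<close>
  define L where "L = (\<Sum>j=1..M. (steep ^ (2 * M + 1) + 1) / (c * p j))"
  \<comment> \<open>Small enough for all rates in \<open>[0, L]\<close> at once, so that one step
    serves the whole cube.\<close>
  define h where "h = inverse (1 + L * (\<Sum>j=2..M-1. 1 + kt j))"
  have L_large: "steep ^ (2 * M + 1) < c * L * p j" if j: "j \<in> {1..M}" for j
  proof -
    have "(steep ^ (2 * M + 1) + 1) / (c * p j) \<le> L"
      unfolding L_def using j p c steep_ge_2
      by (intro member_le_sum) (auto intro!: divide_nonneg_pos add_nonneg_nonneg)
    then show ?thesis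
      using p[OF j] c by (simp add: divide_simps mult_ac)
  qed
  have L0: "0 < L"
  proof -
    have "0 < steep ^ (2 * M + 1)" using steep_ge_2 by simp
    then have "0 < c * L * p 1" using L_large[of 1] M by simp
    then show ?thesis using c p[of 1] M by (simp add: zero_less_mult_iff)
  qed
  have ksum: "0 \<le> (\<Sum>j=2..M-1. 1 + kt j)"
    using kt by (auto intro!: sum_nonneg add_nonneg_nonneg)
  have h0: "0 < h"
    unfolding h_def using L0 ksum by (simp add: add_pos_nonneg)
  have hL: "h * (lam * (1 + kt j)) \<le> 1" if j: "j \<in> {2..M-1}" and lam: "lam \<le> L" for j lam
  proof -
    have "1 + kt j \<le> (\<Sum>j=2..M-1. 1 + kt j)"
      using j kt by (intro member_le_sum) (auto intro!: add_nonneg_nonneg)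
    then have "lam * (1 + kt j) \<le> L * (\<Sum>j=2..M-1. 1 + kt j)"
      using lam L0 kt[OF j] by (intro mult_mono) auto
    then have "h * (lam * (1 + kt j)) \<le> h * (1 + L * (\<Sum>j=2..M-1. 1 + kt j))"
      using h0 by (intro mult_left_mono) auto
    also have "\<dots> = 1"
      unfolding h_def using L0 ksum by (intro left_inverse) (smt (verit) mult_nonneg_nonneg)
    finally show ?thesis .
  qed
  \<comment> \<open>Coordinate 0 of the cube carries the starting position and coordinate
    \<open>j - 1\<close> the rate of the interior state \<open>j\<close>, whence the dimension
    \<open>(M - 2) + 1\<close>.\<close>
  define rate where "rate w j = (if j \<in> {2..M-1} then L * w (j - 1) else 0)" for w :: "nat \<Rightarrow> real" and j
  define start where "start w = 1 + (real M - 1) * w 0" for w :: "nat \<Rightarrow> real"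
  define S where "S w = resolvent_power (M + 1) (gen (rate w)) c h (Suc r)" for w
  define u where "u w y = (\<Sum>x=1..M. hat (start w) x * S w x y)" for w y
  define \<sigma> where "\<sigma> w = (\<Sum>y=1..M. u w y)" for w
  \<comment> \<open>For \<open>i = 0\<close> the sign makes too much mass at the lower end push the
    start upwards; for \<open>i > 0\<close> the coordinate belongs to state \<open>i + 1\<close>.
    The target is \<open>\<sigma> w * p (i + 1)\<close>, proportional to the surviving mass, since
    killed mass is lost.\<close>
  define f where "f w i = (if i = 0 then u w 1 * p M - u w M * p 1 else u w (i + 1) - \<sigma> w * p (i + 1))"
    for w and i :: nat
  let ?C = "unit_cube (M - 1)"
  have rate: "0 \<le> rate w j" "rate w j \<le> L" if "w \<in> ?C" for w j
    using that L0 unfolding rate_def unit_cube_def by (auto simp: mult_left_le)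
  have bd: "birth_death_resolvent M qu qd kt (rate w) c h" if "w \<in> ?C" for w
    using rate[OF that] c h0 hL by unfold_locales auto
  have contS: "continuous_on ?C (\<lambda>w. S w x y)" if "x \<in> {1..M}" "y \<in> {1..M}" for x y
    unfolding S_def resolvent_power_def
  proof (rule continuous_on_nb_mixture)
    show "stochastic_matrix (M + 1) (euler_step (gen (rate w)) h)" if "w \<in> ?C" for w
      by (intro stochastic_euler_step) (use rate[OF that] hL h0 in auto)
    have "euler_step (gen (rate w)) h x y = id_entry x y + h * (rate w x * gen (\<lambda>_. 1) x y)" for w x y
      by (simp add: euler_step_def bd_generator_def algebra_simps)
    moreover have "continuous_on ?C (\<lambda>w. rate w x)" for x
      unfolding rate_def
      by (cases "x \<in> {2..M-1}")
        (simp_all only: if_True if_False, auto intro!: continuous_intros continuous_on_coordinate)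
    ultimately show "continuous_on ?C (\<lambda>w. euler_step (gen (rate w)) h x y)" for x y
      by (auto intro!: continuous_intros)
  qed (use c h0 that in \<open>auto simp: field_simps\<close>)
  have contu: "continuous_on ?C (\<lambda>w. u w y)" if "y \<in> {1..M}" for y
    unfolding u_def hat_def start_def using contS that
    by (auto intro!: continuous_intros continuous_on_coordinate)
  have contf: "continuous_on ?C (\<lambda>w. f w i)" if "i < M - 1" for i
  proof (cases "i = 0")
    case True
    then show ?thesis
      unfolding f_def using M contu[of 1] contu[of M] by (auto intro!: continuous_intros)
  next
    case False
    then have "f w i = u w (i + 1) - \<sigma> w * p (i + 1)" for w
      by (simp add: f_def)
    then show ?thesis
      unfolding \<sigma>_def using that contu by (auto intro!: continuous_intros)
  qed
  obtain w where w: "w \<in> ?C" and fix_w: "\<And>i. i < M - 1 \<Longrightarrow> max 0 (min 1 (w i + f w i)) = w i"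
  proof (rule brouwer_unit_cube[of "M - 1" "\<lambda>w i. max 0 (min 1 (w i + f w i))"])
    show "continuous_on ?C (\<lambda>w. max 0 (min 1 (w i + f w i)))" if "i < M - 1" for i
      using contf[OF that]
      by (auto intro!: continuous_intros continuous_on_coordinate)
  qed auto
  interpret birth_death_resolvent M qu qd kt "rate w" c h
    by (rule bd[OF w])
  have SS: "S w = resolvent_power (M + 1) (gen (rate w)) c h (Suc r)"
    by (simp add: S_def)
  have s: "1 \<le> start w" "start w \<le> real M"
  proof -
    have "0 \<le> w 0" "w 0 \<le> 1"
      using w M by (auto simp: unit_cube_def)
    then have "(real M - 1) * w 0 \<le> real M - 1" "0 \<le> (real M - 1) * w 0"
      using M by (intro mult_left_le mult_nonneg_nonneg; simp)+
    then show "1 \<le> start w" "start w \<le> real M"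
      unfolding start_def by linarith+
  qed
  obtain l \<beta> where l: "l \<in> {2..M}" and \<beta>: "0 \<le> \<beta>" "\<beta> \<le> 1" "start w = real l - 1 + \<beta>" "start w > 1 \<Longrightarrow> 0 < \<beta>"
    and hat: "\<And>f :: nat \<Rightarrow> real. (\<Sum>x=1..M. hat (start w) x * f x) = (1 - \<beta>) * f (l - 1) + \<beta> * f l"
    using hat_sum[OF s] M by auto
  have u: "u w y = (1 - \<beta>) * S w (l - 1) y + \<beta> * S w l y" for y
    unfolding u_def by (rule hat)
  have l': "l - 1 \<in> {1..M}" "l \<in> {1..M}"
    using l by auto
  have S0: "0 \<le> S w x y" if "x \<in> {1..M}" "y \<in> {1..M}" for x y
    unfolding SS using S_nonneg that by simp
  have mix_pos: "0 < (1 - \<beta>) * v + \<beta> * v'" if "0 < v" "0 < v'" for v v'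
    using that \<beta> by (cases "\<beta> = 0") (auto intro!: add_nonneg_pos)
  have \<sigma>: "\<sigma> w = (1 - \<beta>) * (\<Sum>y=1..M. S w (l - 1) y) + \<beta> * (\<Sum>y=1..M. S w l y)"
    by (simp add: \<sigma>_def u sum.distrib sum_distrib_left)
  have \<sigma>0: "0 < \<sigma> w"
    unfolding \<sigma> using alive_pos l' by (intro mix_pos) (simp_all only: SS)
  have u0: "0 \<le> u w y" if "y \<in> {1..M}" for y
    unfolding u using S0 l' that \<beta> by (intro add_nonneg_nonneg mult_nonneg_nonneg) auto
  \<comment> \<open>The start cannot be an end point. At \<open>w 0 = 0\<close> it is the absorbing
    state 1, where \<open>f w 0 = p M\<close> is positive, while the clamp allows only
    \<open>f w 0 \<le> 0\<close> on that face; \<open>w 0 = 1\<close> is symmetric. So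
    \<open>f w 0\<close> vanishes.\<close>
  have balance: "u w 1 * p M = u w M * p 1" and s1: "start w > 1"
  proof -
    have pM: "0 < p 1" "0 < p M" using p M by auto
    have e1: "u w y = id_entry 1 y" if "w 0 = 0" for y
    proof -
      have "\<beta> = 2 - real l" using \<beta>(3) that by (simp add: start_def)
      then have "l = 2" "\<beta> = 0" using l \<beta> by auto
      then show ?thesis using S_boundary[of 1 "Suc r" y] by (simp add: u SS)
    qed
    have eM: "u w y = id_entry M y" if "w 0 = 1" for y
    proof -
      have "real M = real l - 1 + \<beta>" using \<beta>(3) that by (simp add: start_def)
      then have "real M \<le> real l" using \<beta> by linarith
      then have "l = M" "\<beta> = 1" using l \<open>real M = real l - 1 + \<beta>\<close> by auto
      then show ?thesis using S_boundary[of M "Suc r" y] by (simp add: u SS)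
    qed
    have "f w 0 = 0 \<or> w 0 = 0 \<and> f w 0 \<le> 0 \<or> w 0 = 1 \<and> 0 \<le> f w 0"
      by (rule clamp_fixpoint) (use fix_w[of 0] M in auto)
    moreover have "f w 0 = p M" if "w 0 = 0"
      using e1[OF that] M by (simp add: f_def id_entry_def)
    moreover have "f w 0 = - p 1" if "w 0 = 1"
      using eM[OF that] M by (simp add: f_def id_entry_def)
    ultimately have *: "f w 0 = 0" "w 0 \<noteq> 0"
      using pM by auto
    then show "u w 1 * p M = u w M * p 1"
      by (simp add: f_def)
    have "0 < w 0"
      using * w M by (auto simp: unit_cube_def less_le)
    then show "start w > 1"
      using M by (simp add: start_def)
  qed
  have rows: "u w j \<le> \<sigma> w * p j \<and> (u w j < \<sigma> w * p j \<longrightarrow> rate w j = 0)" if j: "j \<in> {2..M-1}" for j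
  proof -
    have j1: "j - 1 < M - 1" "j - 1 \<noteq> 0" "j - 1 + 1 = j"
      using j by auto
    have fj: "f w (j - 1) = u w j - \<sigma> w * p j"
      using j1 by (simp add: f_def)
    have "f w (j - 1) = 0 \<or> w (j - 1) = 0 \<and> f w (j - 1) \<le> 0 \<or> w (j - 1) = 1 \<and> 0 \<le> f w (j - 1)"
      by (rule clamp_fixpoint) (use fix_w[OF j1(1)] in auto)
    \<comment> \<open>At the top rate \<open>L\<close> the mass at \<open>j\<close> falls short of
      its share, which contradicts the outward displacement required on that face. Hence no interior
      state has too much mass, and a shortage occurs only at rate 0.\<close>
    moreover have "f w (j - 1) < 0" if "w (j - 1) = 1"
    proof -
      have rL: "rate w j = L" using j that unfolding rate_def by (simp only: if_True mult_1_right)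
      have "S w x j < p j * (\<Sum>y=1..M. S w x y)" if x: "x \<in> {1..M}" for x
      proof -
        have "c * L * S w x j \<le> steep ^ (2 * M + 1) * (\<Sum>y=1..M. S w x y)"
          using fast_state_bound[OF x j, of r] unfolding rL SS .
        also have "\<dots> < c * L * p j * (\<Sum>y=1..M. S w x y)"
          using L_large[of j] j alive_pos[OF x, of "Suc r"] unfolding SS by (intro mult_strict_right_mono) auto
        finally have "(c * L) * S w x j < (c * L) * (p j * (\<Sum>y=1..M. S w x y))"
          by (simp only: mult.assoc)
        then show ?thesis
          using c L0 by (simp add: mult_less_cancel_left)
      qed
      then have "0 < (1 - \<beta>) * (p j * (\<Sum>y=1..M. S w (l-1) y) - S w (l-1) j) + \<beta> * (p j * (\<Sum>y=1..M. S w l y) - S w l j)"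
        using l' by (intro mix_pos) (auto simp del: One_nat_def)
      also have "\<dots> = - f w (j - 1)"
        unfolding fj u \<sigma> by (simp add: algebra_simps)
      finally show ?thesis by simp
    qed
    moreover have "rate w j = 0" if "w (j - 1) = 0"
      using that by (simp add: rate_def)
    ultimately show ?thesis
      unfolding fj by auto
  qed
  have split: "(\<Sum>y=1..M. g y) = g 1 + g M + (\<Sum>y=2..M-1. g y)" for g :: "nat \<Rightarrow> real"
  proof -
    have "{1..M} = insert 1 (insert M {2..M-1})"
      using M by auto
    then show ?thesis
      using M by (simp add: add.assoc)
  qed
  \<comment> \<open>The masses and their targets have the same total, so the deficits of the
    interior states reappear as an excess of the two ends.\<close>
  have ends: "u w 1 + u w M - \<sigma> w * (p 1 + p M) = (\<Sum>y=2..M-1. \<sigma> w * p y - u w y)"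
  proof -
    have "(\<Sum>y=1..M. u w y) = \<sigma> w * (\<Sum>y=1..M. p y)"
      by (simp only: psum \<sigma>_def mult_1_right)
    then show ?thesis
      unfolding split by (simp add: sum_subtractf sum_distrib_left algebra_simps)
  qed
  have pos_ends: "0 < u w 1" "0 < u w M"
  proof -
    have "0 \<le> (\<Sum>y=2..M-1. \<sigma> w * p y - u w y)"
      using rows by (intro sum_nonneg) auto
    moreover have "0 < \<sigma> w * (p 1 + p M)"
      using \<sigma>0 p M by (intro mult_pos_pos add_pos_pos) auto
    ultimately have "0 < u w 1 + u w M"
      using ends by simp
    \<comment> \<open>By the balance equation the end masses are in the ratio of \<open>p 1\<close>
      to \<open>p M\<close>, so neither vanishes alone.\<close>
    moreover have "u w 1 = 0 \<longleftrightarrow> u w M = 0"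
      using balance p[of 1] p[of M] M by auto
    ultimately show "0 < u w 1" "0 < u w M"
      using u0[of 1] u0[of M] M by (auto simp: less_le)
  qed
  have interior: "u w j = \<sigma> w * p j" if j: "j \<in> {2..M-1}" for j
  proof (rule ccontr)
    assume "u w j \<noteq> \<sigma> w * p j"
    then have r0: "rate w j = 0"
      using rows[OF j] by auto
    \<comment> \<open>As \<open>l - 1\<close> and \<open>l\<close> are adjacent, \<open>j\<close>
      lies weakly on one side of both starting states and, having rate 0, cuts them off from the end
      beyond it. That end would carry no mass.\<close>
    have "l \<le> j \<or> j \<le> l - 1" by linarith
    then show False
    proof
      assume "l \<le> j"
      then have "S w (l - 1) M = 0" "S w l M = 0"
        unfolding SS using j l' M by (intro S_blocked[OF j r0]; auto)+
      then have "u w M = 0"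
        by (simp only: u mult_zero_right add_0)
      then show False using pos_ends by simp
    next
      assume "j \<le> l - 1"
      then have "S w (l - 1) 1 = 0" "S w l 1 = 0"
        unfolding SS using j l' M by (intro S_blocked[OF j r0]; auto)+
      then have "u w 1 = 0"
        by (simp only: u mult_zero_right add_0)
      then show False using pos_ends by simp
    qed
  qed
  have e: "u w 1 + u w M = \<sigma> w * (p 1 + p M)"
    using ends interior by simp
  have pp: "0 < p 1 + p M" using p[of 1] p[of M] M by simp
  \<comment> \<open>The ratio and the sum of the two end masses determine both of them.\<close>
  have "(u w 1 - \<sigma> w * p 1) * (p 1 + p M) = p 1 * (u w 1 + u w M) - \<sigma> w * p 1 * (p 1 + p M)"
    "(u w M - \<sigma> w * p M) * (p 1 + p M) = p M * (u w 1 + u w M) - \<sigma> w * p M * (p 1 + p M)"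
    using balance by (simp_all add: algebra_simps)
  then have "(u w 1 - \<sigma> w * p 1) * (p 1 + p M) = 0" "(u w M - \<sigma> w * p M) * (p 1 + p M) = 0"
    unfolding e by (simp_all add: algebra_simps)
  then have "u w 1 = \<sigma> w * p 1" "u w M = \<sigma> w * p M"
    using pp by auto
  then have "u w j = \<sigma> w * p j" if "j \<in> {1..M}" for j
    using interior[of j] that by (cases "j = 1 \<or> j = M") auto
  then show thesis
    using l \<beta> s1 bd[OF w] unfolding u SS
    by (intro that[of l \<beta> "rate w" h "\<sigma> w"]) auto
qed

end

section \<open>Jump paths driven by a random stream\<close>

text \<open>The stream pairs waiting times with random seeds, and index 0 is the first jump. For
  nonnegative waiting times the path is therefore in \<open>visit \<phi> k a \<omega>\<close>
  strictly before \<open>jump_time k \<omega>\<close> and, for \<open>k > 0\<close>, from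
  \<open>jump_time (k - 1) \<omega>\<close> on.\<close>

primrec jump_time :: "nat \<Rightarrow> (real \<times> 'd) stream \<Rightarrow> real" where
  "jump_time 0 \<omega> = fst (shd \<omega>)"
| "jump_time (Suc k) \<omega> = fst (shd \<omega>) + jump_time k (stl \<omega>)"

primrec visit :: "(nat \<Rightarrow> 'd \<Rightarrow> nat) \<Rightarrow> nat \<Rightarrow> nat \<Rightarrow> (real \<times> 'd) stream \<Rightarrow> nat" where
  "visit \<phi> 0 a \<omega> = a"
| "visit \<phi> (Suc k) a \<omega> = visit \<phi> k (\<phi> a (snd (shd \<omega>))) (stl \<omega>)"

text \<open>
  The value \<open>1\<close> after infinitely many jumps is arbitrary: the renewal equation determines all laws
  without it.
\<close>

definition jump_path :: "(nat \<Rightarrow> 'd \<Rightarrow> nat) \<Rightarrow> nat \<Rightarrow> real \<Rightarrow> (real \<times> 'd) stream \<Rightarrow> nat" where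
  "jump_path \<phi> a s \<omega> =
     (if \<exists>k. s < jump_time k \<omega> then visit \<phi> (LEAST k. s < jump_time k \<omega>) a \<omega> else 1)"

text \<open>The pathwise restart at the first jump, from which the renewal equations are derived.
  The default 1 does not depend on the starting state, so the identity also holds where no jump time
  exceeds \<open>s\<close>.\<close>

lemma path_Stream:
  "jump_path \<phi> a s (x ## \<omega>) = (if s < fst x then a else jump_path \<phi> (\<phi> a (snd x)) (s - fst x) \<omega>)"
proof (cases "s < fst x")
  case True
  then have "s < jump_time 0 (x ## \<omega>)" by simp
  then have "(LEAST k. s < jump_time k (x ## \<omega>)) = 0" "\<exists>k. s < jump_time k (x ## \<omega>)"
    by (rule Least_eq_0, blast)
  then show ?thesis
    using True by (simp add: jump_path_def)
next
  case False
  have 0: "\<not> s < jump_time 0 (x ## \<omega>)" using False by simp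
  have iff: "s < jump_time (Suc k) (x ## \<omega>) \<longleftrightarrow> s - fst x < jump_time k \<omega>" for k
    by auto
  have ex: "(\<exists>k. s < jump_time k (x ## \<omega>)) \<longleftrightarrow> (\<exists>k. s - fst x < jump_time k \<omega>)"
    using 0 iff by (metis not0_implies_Suc)
  show ?thesis
  proof (cases "\<exists>k. s - fst x < jump_time k \<omega>")
    case True
    then obtain k where "s - fst x < jump_time k \<omega>" by blast
    then have "s < jump_time (Suc k) (x ## \<omega>)"
      using iff by blast
    then have "(LEAST k. s < jump_time k (x ## \<omega>)) = Suc (LEAST k. s < jump_time (Suc k) (x ## \<omega>))"
      by (rule Least_Suc) (rule 0)
    also have "\<dots> = Suc (LEAST k. s - fst x < jump_time k \<omega>)"
      by (simp only: iff)
    finally show ?thesis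
      using False True ex by (simp add: jump_path_def)
  next
    case nex: False
    then show ?thesis
      using False ex by (simp only: jump_path_def if_False)
  qed
qed

text \<open>This holds for every stream: until the jump time that ends the current sojourn the least
  index stays the same, and if no jump time exceeds \<open>s\<close>, none exceeds a later
  time.\<close>

lemma path_right_continuous: "\<forall>\<^sub>F u in at_right s. jump_path \<phi> a u \<omega> = jump_path \<phi> a s \<omega>"
proof (cases "\<exists>k. s < jump_time k \<omega>")
  case True
  define k where "k = (LEAST k. s < jump_time k \<omega>)"
  have k: "s < jump_time k \<omega>"
    unfolding k_def using True by (rule LeastI_ex)
  have "jump_path \<phi> a u \<omega> = jump_path \<phi> a s \<omega>" if u: "s < u" "u < jump_time k \<omega>" for u
  proof -
    have "(LEAST k. u < jump_time k \<omega>) = k"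
    proof (rule Least_equality)
      fix m assume "u < jump_time m \<omega>"
      then show "k \<le> m"
        unfolding k_def using u by (intro Least_le) simp
    qed fact
    then show ?thesis
      using True u k_def by (auto simp: jump_path_def)
  qed
  then show ?thesis
    using k unfolding eventually_at_right_field by blast
next
  case False
  then have "jump_path \<phi> a u \<omega> = jump_path \<phi> a s \<omega>" if "s < u" for u
    using that unfolding jump_path_def by (metis order.strict_trans)
  then show ?thesis
    unfolding eventually_at_right_field by (meson gt_ex)
qed

text \<open>A random map representation of the transition matrix: one seed \<open>d\<close>
  prescribes through \<open>\<phi> a d\<close> the next state from every \<open>a\<close>, so the
  paths from all starting states are functions of the same stream.\<close>

locale jump_process = D: prob_space D for D :: "'d measure" +
  fixes n :: nat and P :: "nat \<Rightarrow> nat \<Rightarrow> real" and \<theta> :: real and \<phi> :: "nat \<Rightarrow> 'd \<Rightarrow> nat"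
  assumes n: "1 \<le> n" and \<theta>: "0 < \<theta>"
    and \<phi>_measurable[measurable]: "\<And>a. \<phi> a \<in> measurable D (count_space UNIV)"
    and \<phi>_range: "\<And>a d. a \<in> {1..n} \<Longrightarrow> d \<in> space D \<Longrightarrow> \<phi> a d \<in> {1..n}"
    and \<phi>_law: "\<And>a b. a \<in> {1..n} \<Longrightarrow> b \<in> {1..n} \<Longrightarrow> measure D {d \<in> space D. \<phi> a d = b} = P a b"
begin

definition E :: "real measure" where "E = density lborel (exponential_density \<theta>)"

definition W :: "(real \<times> 'd) stream measure" where "W = stream_space (E \<Otimes>\<^sub>M D)"

sublocale E: prob_space E
  unfolding E_def using \<theta> by (rule prob_space_exponential_density)

sublocale ED: pair_prob_space E D ..

sublocale W: prob_space W
  unfolding W_def by (rule ED.prob_space_stream_space)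

lemma sets_E[measurable_cong]: "sets E = sets borel" and space_E[simp]: "space E = UNIV"
  by (simp_all add: E_def)

lemma sets_W[measurable_cong]: "sets W = sets (stream_space (borel \<Otimes>\<^sub>M D))"
  unfolding W_def by (intro sets_stream_space_cong sets_pair_measure_cong sets_E refl)

lemma measurable_jump_time[measurable]: "jump_time k \<in> borel_measurable W"
proof (induction k)
  case (Suc k)
  then have [measurable]: "jump_time k \<in> borel_measurable (stream_space (borel \<Otimes>\<^sub>M D))"
    by (simp cong: measurable_cong_sets[OF sets_W])
  show ?case by simp measurable
qed (simp, measurable)

lemma measurable_visit[measurable]: "visit \<phi> k a \<in> measurable W (count_space UNIV)"
proof (induction k arbitrary: a)
  case (Suc k)
  then have [measurable]: "visit \<phi> k b \<in> measurable (stream_space (borel \<Otimes>\<^sub>M D)) (count_space UNIV)" for b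
    by (simp cong: measurable_cong_sets[OF sets_W])
  have "(\<lambda>\<omega>. visit \<phi> k (\<phi> a (snd (shd \<omega>))) (stl \<omega>)) \<in> measurable W (count_space UNIV)"
    by (rule measurable_compose_countable[where f = "\<lambda>b \<omega>. visit \<phi> k b (stl \<omega>)"]) measurable
  then show ?case by simp
next
  case 0
  have "visit \<phi> 0 a = (\<lambda>_. a)"
    by (simp add: fun_eq_iff)
  then show ?case by simp
qed

abbreviation BW :: "(real \<times> (real \<times> 'd) stream) measure" where "BW \<equiv> borel \<Otimes>\<^sub>M W"

text \<open>Joint measurability in time and stream is what allows the path to be evaluated at a
  random time.\<close>

lemma measurable_path_pair:
  "(\<lambda>x. jump_path \<phi> a (fst x) (snd x)) \<in> measurable BW (count_space UNIV)"
proof -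
  have [measurable]: "(\<lambda>x. LEAST k. fst x < jump_time k (snd x)) \<in> measurable BW (count_space UNIV)"
    by measurable
  have [measurable]: "(\<lambda>x. visit \<phi> (LEAST k. fst x < jump_time k (snd x)) a (snd x))
      \<in> measurable BW (count_space UNIV)"
    by (rule measurable_compose_countable[where f = "\<lambda>k x. visit \<phi> k a (snd x)"]) measurable
  show ?thesis
    unfolding jump_path_def by measurable
qed

lemma measurable_path[measurable (raw)]:
  assumes [measurable]: "f \<in> borel_measurable N" "g \<in> measurable N W"
  shows "(\<lambda>x. jump_path \<phi> a (f x) (g x)) \<in> measurable N (count_space UNIV)"
  using measurable_compose[OF measurable_Pair[OF assms] measurable_path_pair[of a]] by simp

lemma space_W: "space W = streams (UNIV \<times> space D)"
  by (simp add: W_def space_stream_space space_pair_measure)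

lemma visit_range: "a \<in> {1..n} \<Longrightarrow> \<omega> \<in> space W \<Longrightarrow> visit \<phi> k a \<omega> \<in> {1..n}"
proof (induction k arbitrary: a \<omega>)
  case (Suc k)
  have "snd (shd \<omega>) \<in> space D" "stl \<omega> \<in> space W"
    using Suc.prems by (auto simp: space_W elim: streams.cases)
  then show ?case
    unfolding visit.simps using Suc.IH \<phi>_range Suc.prems by blast
qed simp

lemma path_range: "a \<in> {1..n} \<Longrightarrow> \<omega> \<in> space W \<Longrightarrow> jump_path \<phi> a s \<omega> \<in> {1..n}"
  unfolding jump_path_def using visit_range n by (auto simp del: atLeastAtMost_iff) auto

lemma \<phi>_law_nn:
  assumes a: "a \<in> {1..n}"
  shows "(\<integral>\<^sup>+d. ennreal (g (\<phi> a d)) \<partial>D) = (\<Sum>b=1..n. ennreal (P a b) * ennreal (g b))"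
proof -
  have "(\<integral>\<^sup>+d. ennreal (g (\<phi> a d)) \<partial>D)
      = (\<integral>\<^sup>+d. (\<Sum>b=1..n. ennreal (g b) * indicator {d\<in>space D. \<phi> a d = b} d) \<partial>D)"
  proof (rule nn_integral_cong)
    fix d assume d: "d \<in> space D"
    have "(\<Sum>b=1..n. ennreal (g b) * indicator {d\<in>space D. \<phi> a d = b} d)
        = (\<Sum>b=1..n. if \<phi> a d = b then ennreal (g b) else 0)"
      using d by (intro sum.cong) (auto simp: indicator_def)
    also have "\<dots> = ennreal (g (\<phi> a d))"
      using \<phi>_range[OF a d] by simp
    finally show "ennreal (g (\<phi> a d)) = (\<Sum>b=1..n. ennreal (g b) * indicator {d\<in>space D. \<phi> a d = b} d)" ..
  qed
  also have "\<dots> = (\<Sum>b=1..n. ennreal (g b) * emeasure D {d\<in>space D. \<phi> a d = b})"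
    by (subst nn_integral_sum) (auto intro!: sum.cong nn_integral_cmult_indicator)
  also have "\<dots> = (\<Sum>b=1..n. ennreal (P a b) * ennreal (g b))"
    using \<phi>_law[OF a] by (intro sum.cong refl) (simp add: D.emeasure_eq_measure mult.commute)
  finally show ?thesis .
qed

lemma P_nonneg: "a \<in> {1..n} \<Longrightarrow> b \<in> {1..n} \<Longrightarrow> 0 \<le> P a b"
  using \<phi>_law by (metis measure_nonneg)

lemma P_sum: "a \<in> {1..n} \<Longrightarrow> (\<Sum>b=1..n. P a b) = 1"
proof -
  assume a: "a \<in> {1..n}"
  have "ennreal (\<Sum>b=1..n. P a b) = (\<Sum>b=1..n. ennreal (P a b))"
    using P_nonneg[OF a] by (intro sum_ennreal[symmetric])
  also have "\<dots> = 1"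
    using \<phi>_law_nn[OF a, of "\<lambda>_. 1"] by (simp add: D.emeasure_space_1)
  finally have "ennreal (\<Sum>b=1..n. P a b) = 1" .
  then show ?thesis
    by (simp add: ennreal_eq_1)
qed

lemma stochastic_P: "stochastic_matrix n P"
  using P_nonneg P_sum by (simp add: stochastic_matrix_def)

lemma P_average_bound:
  assumes a: "a \<in> {1..n}" and g: "\<And>b. b \<in> {1..n} \<Longrightarrow> \<bar>g b\<bar> \<le> C"
  shows "\<bar>\<Sum>b=1..n. P a b * g b\<bar> \<le> C"
proof -
  have "\<bar>\<Sum>b=1..n. P a b * g b\<bar> \<le> (\<Sum>b=1..n. P a b * C)"
    using P_nonneg[OF a] g
    by (intro order_trans[OF sum_abs] sum_mono) (auto simp: abs_mult intro!: mult_left_mono)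
  also have "\<dots> = C"
    using P_sum[OF a] by (simp add: sum_distrib_right[symmetric])
  finally show ?thesis .
qed

lemma measurable_prob_section:
  fixes A :: "real \<Rightarrow> (real \<times> 'd) stream \<Rightarrow> bool"
  assumes [measurable]: "Measurable.pred BW (\<lambda>x. A (fst x) (snd x))"
  shows "(\<lambda>e. \<P>(\<omega> in W. A e \<omega>)) \<in> borel_measurable borel"
proof -
  have "(\<lambda>e. measure W (Pair e -` {x \<in> space BW. A (fst x) (snd x)})) \<in> borel_measurable borel"
    unfolding measure_def
    by (intro borel_measurable_enn2real W.measurable_emeasure_Pair) measurable
  moreover have "Pair e -` {x \<in> space BW. A (fst x) (snd x)} = {\<omega> \<in> space W. A e \<omega>}" for e :: real
    by (auto simp: space_pair_measure)
  ultimately show ?thesis by simp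
qed

text \<open>Independence of head and tail of the stream, in the form of Fubini's theorem: the
  waiting time and the seed of the first jump are integrated out, and the tail is again distributed
  as \<open>W\<close>.\<close>

lemma prob_first_jump:
  assumes a: "a \<in> {1..n}"
    and A[measurable]: "\<And>b. Measurable.pred BW (\<lambda>x. A b (fst x) (snd x))"
  shows "\<P>(\<omega> in W. A (\<phi> a (snd (shd \<omega>))) (fst (shd \<omega>)) (stl \<omega>))
    = (\<integral>e. (\<Sum>b=1..n. P a b * \<P>(\<omega> in W. A b e \<omega>)) \<partial>E)"
proof -
  have [measurable]: "(\<lambda>e. \<P>(\<omega> in W. A b e \<omega>)) \<in> borel_measurable borel" for b
    by (rule measurable_prob_section) measurable
  have [measurable]: "Measurable.pred W (\<lambda>\<omega>. A (\<phi> a (snd (shd \<omega>))) (fst (shd \<omega>)) (stl \<omega>))"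
  proof (rule measurable_compose_countable[where f = "\<lambda>b \<omega>. A b (fst (shd \<omega>)) (stl \<omega>)"])
    show "Measurable.pred W (\<lambda>\<omega>. A b (fst (shd \<omega>)) (stl \<omega>))" for b
    proof -
      have "(\<lambda>\<omega>. (fst (shd \<omega>), stl \<omega>)) \<in> measurable W BW"
        by measurable
      from measurable_compose[OF this A[of b]] show ?thesis by simp
    qed
    show "(\<lambda>\<omega>. \<phi> a (snd (shd \<omega>))) \<in> measurable W (count_space UNIV)"
      by measurable
  qed
  have [measurable]: "(\<lambda>x. \<P>(\<omega> in W. A (\<phi> a (snd x)) (fst x) \<omega>)) \<in> borel_measurable (E \<Otimes>\<^sub>M D)"
    by (rule measurable_compose_countable[where f = "\<lambda>b x. \<P>(\<omega> in W. A b (fst x) \<omega>)"]) measurable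
  have "ennreal (\<P>(\<omega> in W. A (\<phi> a (snd (shd \<omega>))) (fst (shd \<omega>)) (stl \<omega>)))
      = (\<integral>\<^sup>+x. ennreal (\<P>(\<omega> in W. A (\<phi> a (snd x)) (fst x) \<omega>)) \<partial>(E \<Otimes>\<^sub>M D))"
    unfolding W_def
    by (subst ED.prob_stream_space) (simp_all add: W_def[symmetric])
  also have "\<dots> = (\<integral>\<^sup>+e. \<integral>\<^sup>+d. ennreal (\<P>(\<omega> in W. A (\<phi> a d) e \<omega>)) \<partial>D \<partial>E)"
    by (subst D.nn_integral_fst[symmetric]) simp_all
  also have "\<dots> = (\<integral>\<^sup>+e. ennreal (\<Sum>b=1..n. P a b * \<P>(\<omega> in W. A b e \<omega>)) \<partial>E)"
    using P_nonneg[OF a]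
    by (intro nn_integral_cong, subst \<phi>_law_nn[OF a], subst sum_ennreal[symmetric])
      (auto simp: ennreal_mult'[symmetric])
  also have "\<dots> = ennreal (\<integral>e. (\<Sum>b=1..n. P a b * \<P>(\<omega> in W. A b e \<omega>)) \<partial>E)"
  proof (rule nn_integral_eq_integral)
    show "integrable E (\<lambda>e. \<Sum>b=1..n. P a b * \<P>(\<omega> in W. A b e \<omega>))"
      using P_average_bound[OF a]
      by (intro E.integrable_const_bound[where B = 1]) (auto intro!: AE_I2)
    show "AE e in E. 0 \<le> (\<Sum>b=1..n. P a b * \<P>(\<omega> in W. A b e \<omega>))"
      using P_nonneg[OF a] by (intro AE_I2 sum_nonneg mult_nonneg_nonneg) auto
  qed
  finally show ?thesis
    using P_nonneg[OF a] by (subst (asm) ennreal_inj) (auto intro!: integral_nonneg_AE AE_I2 sum_nonneg)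
qed

end

section \<open>Renewal equations\<close>

context jump_process
begin

lemma prob_step:
  assumes a: "a \<in> {1..n}" and [measurable]: "\<And>b. Measurable.pred W (A b)"
  shows "\<P>(\<omega> in W. A (\<phi> a (snd (shd \<omega>))) (stl \<omega>)) = (\<Sum>b=1..n. P a b * \<P>(\<omega> in W. A b \<omega>))"
  using prob_first_jump[OF a, of "\<lambda>b e \<omega>. A b \<omega>"] E.prob_space by simp

lemma prob_visit:
  assumes "a \<in> {1..n}"
  shows "\<P>(\<omega> in W. visit \<phi> k a \<omega> = x) = mat_power n P k a x"
  using assms
proof (induction k arbitrary: a)
  case 0
  then show ?case
    by (cases "a = x") (simp_all add: id_entry_def W.prob_space)
next
  case (Suc k)
  show ?case
    using prob_step[OF Suc.prems, of "\<lambda>b \<omega>. visit \<phi> k b \<omega> = x"] Suc.IH by simp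
qed

text \<open>The new factor belongs to the last step, but a stream opens only at its front. Hence the
  induction keeps \<open>a\<close> and \<open>y\<close> arbitrary, decomposes both sides after the
  first step and uses the hypothesis for the shifted sequence.\<close>

lemma prob_visits_Suc:
  assumes "a \<in> {1..n}" "\<And>k. k \<le> Suc m \<Longrightarrow> y k \<in> {1..n}"
  shows "\<P>(\<omega> in W. \<forall>k\<le>Suc m. visit \<phi> k a \<omega> = y k)
    = \<P>(\<omega> in W. \<forall>k\<le>m. visit \<phi> k a \<omega> = y k) * P (y m) (y (Suc m))"
  using assms
proof (induction m arbitrary: a y)
  have all_Suc: "(\<forall>k\<le>Suc m. Q k) \<longleftrightarrow> Q 0 \<and> (\<forall>k\<le>m. Q (Suc k))" for m and Q :: "nat \<Rightarrow> bool"
    by (metis Suc_le_mono le0 not0_implies_Suc)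
  have rec: "\<P>(\<omega> in W. \<forall>k\<le>Suc m. visit \<phi> k a \<omega> = y k)
      = (if a = y 0 then \<Sum>b=1..n. P a b * \<P>(\<omega> in W. \<forall>k\<le>m. visit \<phi> k b \<omega> = y (Suc k)) else 0)"
    if "a \<in> {1..n}" for a y m
    unfolding all_Suc using prob_step[OF that, of "\<lambda>b \<omega>. \<forall>k\<le>m. visit \<phi> k b \<omega> = y (Suc k)"]
    by (cases "a = y 0") simp_all
  {
    case 0
    have V0: "\<P>(\<omega> in W. \<forall>k\<le>0. visit \<phi> k b \<omega> = x k) = id_entry b (x 0)" for b x
    proof -
      have "(\<forall>k\<le>0. visit \<phi> k b \<omega> = x k) \<longleftrightarrow> b = x 0" for \<omega>
        by simp
      then show ?thesis
        using W.prob_space by (cases "b = x 0") (simp_all only: id_entry_def if_True if_False simp_thms, simp_all)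
    qed
    have "(\<Sum>b=1..n. P a b * id_entry b (y (Suc 0))) = P a (y (Suc 0))"
      using 0(2)[of "Suc 0"] by (intro sum_id_entry) auto
    then show ?case
      unfolding rec[OF 0(1)] V0 by (cases "a = y 0") (simp_all add: id_entry_def)
  next
    case (Suc m)
    have IH: "\<P>(\<omega> in W. \<forall>k\<le>Suc m. visit \<phi> k b \<omega> = y (Suc k))
        = \<P>(\<omega> in W. \<forall>k\<le>m. visit \<phi> k b \<omega> = y (Suc k)) * P (y (Suc m)) (y (Suc (Suc m)))"
      if "b \<in> {1..n}" for b
      using Suc.IH[OF that, of "\<lambda>k. y (Suc k)"] Suc.prems(2) by simp
    show ?case
      unfolding rec[OF Suc.prems(1), of "Suc m"] rec[OF Suc.prems(1), of m]
      using IH by (simp add: sum_distrib_right mult.assoc)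
  }
qed

text \<open>
  \<open>H a s \<omega>\<close> stands for an event concerning the path from time \<open>s\<close> on, started in \<open>a\<close>: it starts afresh at
  the first jump if this occurs before \<open>s\<close>, and otherwise depends on the first jump time only through
  the residual waiting time.
\<close>

definition regenerative :: "(nat \<Rightarrow> real \<Rightarrow> (real \<times> 'd) stream \<Rightarrow> bool) \<Rightarrow> bool" where
  "regenerative H \<longleftrightarrow>
     (\<forall>a. Measurable.pred BW (\<lambda>x. H a (fst x) (snd x))) \<and>
     (\<exists>H'. (\<forall>a b. Measurable.pred BW (\<lambda>x. H' a b (fst x) (snd x))) \<and>
       (\<forall>a s x \<omega>. H a s (x ## \<omega>) =
          (if fst x \<le> s then H (\<phi> a (snd x)) (s - fst x) \<omega> else H' a (\<phi> a (snd x)) (fst x - s) \<omega>)))"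

lemma regenerative_conj:
  assumes "regenerative G" "regenerative H"
  shows "regenerative (\<lambda>a s \<omega>. G a s \<omega> \<and> H a s \<omega>)"
proof -
  obtain G' H' where [measurable]:
      "\<And>a. Measurable.pred BW (\<lambda>x. G a (fst x) (snd x))"
      "\<And>a. Measurable.pred BW (\<lambda>x. H a (fst x) (snd x))"
      "\<And>a b. Measurable.pred BW (\<lambda>x. G' a b (fst x) (snd x))"
      "\<And>a b. Measurable.pred BW (\<lambda>x. H' a b (fst x) (snd x))"
    and eq: "\<And>a s x \<omega>. G a s (x ## \<omega>) =
          (if fst x \<le> s then G (\<phi> a (snd x)) (s - fst x) \<omega> else G' a (\<phi> a (snd x)) (fst x - s) \<omega>)"
      "\<And>a s x \<omega>. H a s (x ## \<omega>) =
          (if fst x \<le> s then H (\<phi> a (snd x)) (s - fst x) \<omega> else H' a (\<phi> a (snd x)) (fst x - s) \<omega>)"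
    using assms unfolding regenerative_def by blast
  show ?thesis
    unfolding regenerative_def
    by (intro conjI allI exI[of _ "\<lambda>a b e \<omega>. G' a b e \<omega> \<and> H' a b e \<omega>"]) (measurable, simp add: eq)
qed

lemma regenerative_path:
  assumes "0 \<le> t"
  shows "regenerative (\<lambda>a s \<omega>. jump_path \<phi> a (s + t) \<omega> = y)"
  unfolding regenerative_def
\<comment> \<open>If the residual waiting time at \<open>s\<close> is \<open>e\<close>, the state at
  \<open>s + t\<close> is still \<open>a\<close> for \<open>t < e\<close>; otherwise the path from
  the next state \<open>b\<close> has been running for time \<open>t - e\<close>.\<close>
proof (intro conjI allI exI[of _ "\<lambda>a b e \<omega>. (if t < e then a else jump_path \<phi> b (t - e) \<omega>) = y"])
  fix a s \<omega> and x :: "real \<times> 'd"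
  show "(jump_path \<phi> a (s + t) (x ## \<omega>) = y) =
      (if fst x \<le> s then jump_path \<phi> (\<phi> a (snd x)) (s - fst x + t) \<omega> = y
       else (if t < fst x - s then a else jump_path \<phi> (\<phi> a (snd x)) (t - (fst x - s)) \<omega>) = y)"
    using assms by (auto simp: path_Stream algebra_simps)
qed measurable

lemma regenerative_paths:
  fixes m :: nat
  assumes "\<And>k. k \<le> m \<Longrightarrow> 0 \<le> t k"
  shows "regenerative (\<lambda>a s \<omega>. \<forall>k\<le>m. jump_path \<phi> a (s + t k) \<omega> = y k)"
  using assms
proof (induction m)
  case 0
  then show ?case
    using regenerative_path[of "t 0" "y 0"] by simp
next
  case (Suc m)
  have "(\<forall>k\<le>Suc m. Q k) \<longleftrightarrow> (\<forall>k\<le>m. Q k) \<and> Q (Suc m)" for Q :: "nat \<Rightarrow> bool"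
    by (auto simp: le_Suc_eq)
  then show ?case
    using regenerative_conj[OF Suc.IH regenerative_path[of "t (Suc m)" "y (Suc m)"]] Suc.prems by simp
qed

lemma integral_E:
  fixes f :: "real \<Rightarrow> real"
  assumes [measurable]: "f \<in> borel_measurable borel"
  shows "(\<integral>e. f e \<partial>E) = (\<integral>e. exponential_density \<theta> e * f e \<partial>lborel)"
  unfolding E_def using \<theta> by (subst integral_density) (auto simp: erlang_density_nonneg)

lemma memoryless:
  assumes s: "0 \<le> s" and [measurable]: "q \<in> borel_measurable borel"
  shows "(\<integral>e. indicator {s<..} e * q (e - s) \<partial>E) = exp (- \<theta> * s) * (\<integral>e. indicator {0<..} e * q e \<partial>E)"
proof -
  have "(\<integral>e. indicator {s<..} e * q (e - s) \<partial>E)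
      = (\<integral>e. exponential_density \<theta> e * (indicator {s<..} e * q (e - s)) \<partial>lborel)"
    by (rule integral_E) measurable
  also have "\<dots> = (\<integral>e. exponential_density \<theta> (s + e) * (indicator {s<..} (s + e) * q e) \<partial>lborel)"
    by (subst lborel_integral_real_affine[where c = 1 and t = s]) simp_all
  also have "\<dots> = (\<integral>e. exp (- \<theta> * s) * (exponential_density \<theta> e * (indicator {0<..} e * q e)) \<partial>lborel)"
  proof (intro Bochner_Integration.integral_cong refl)
    fix e :: real
    have "exp (- (s + e) * \<theta>) = exp (- \<theta> * s) * exp (- e * \<theta>)"
      unfolding mult_exp_exp by (simp add: algebra_simps)
    then show "exponential_density \<theta> (s + e) * (indicator {s<..} (s + e) * q e)
        = exp (- \<theta> * s) * (exponential_density \<theta> e * (indicator {0<..} e * q e))"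
      using s by (cases "0 < e") (simp_all add: exponential_density_def)
  qed
  also have "\<dots> = exp (- \<theta> * s) * (\<integral>e. exponential_density \<theta> e * (indicator {0<..} e * q e) \<partial>lborel)"
    by simp
  also have "(\<integral>e. exponential_density \<theta> e * (indicator {0<..} e * q e) \<partial>lborel) = (\<integral>e. indicator {0<..} e * q e \<partial>E)"
    by (rule integral_E[symmetric]) measurable
  finally show ?thesis .
qed

lemma measure_E_atMost: "0 \<le> s \<Longrightarrow> measure E {..s} = 1 - exp (- \<theta> * s)"
  using emeasure_erlang_density[OF \<theta>, of 0 s] \<theta>
  by (simp add: E_def measure_def erlang_CDF_0)

lemma AE_E_nonneg: "AE e in E. 0 \<le> e"
  unfolding E_def by (subst AE_density) (auto simp: exponential_density_def)

text \<open>The bound holds only almost everywhere: \<open>d\<close> is controlled on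
  \<open>[0, s]\<close>, and \<open>s - e\<close> can exceed \<open>s\<close> on the null set of
  negative \<open>e\<close>.\<close>

lemma integrable_waiting:
  fixes d :: "nat \<Rightarrow> real \<Rightarrow> real"
  assumes a: "a \<in> {1..n}" and [measurable]: "\<And>b. d b \<in> borel_measurable borel"
    and d: "\<And>b u. b \<in> {1..n} \<Longrightarrow> 0 \<le> u \<Longrightarrow> u \<le> s \<Longrightarrow> \<bar>d b u\<bar> \<le> C"
  shows "integrable E (\<lambda>e. indicator {..s} e * (\<Sum>b=1..n. P a b * d b (s - e)))"
    and "AE e in E. \<bar>indicator {..s} e * (\<Sum>b=1..n. P a b * d b (s - e))\<bar> \<le> indicator {..s} e * C"
proof -
  let ?f = "\<lambda>e. indicator {..s} e * (\<Sum>b=1..n. P a b * d b (s - e))"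
  show *: "AE e in E. \<bar>?f e\<bar> \<le> indicator {..s} e * C"
    using AE_E_nonneg
  proof eventually_elim
    case (elim e)
    show ?case
    proof (cases "e \<le> s")
      case True
      then show ?thesis
        using elim P_average_bound[OF a, of "\<lambda>b. d b (s - e)" C] d by simp
    qed (simp add: indicator_def)
  qed
  have "AE e in E. norm (?f e) \<le> \<bar>C\<bar>"
    using * by eventually_elim (auto simp: indicator_def split: if_splits)
  then show "integrable E (?f)"
    by (rule E.integrable_const_bound) measurable
qed

text \<open>The factor is the probability of a jump before \<open>s\<close>. It is less than 1,
  which makes the renewal operator a contraction on bounded functions on
  \<open>[0, s]\<close>.\<close>

lemma waiting_bound:
  fixes d :: "nat \<Rightarrow> real \<Rightarrow> real"
  assumes a: "a \<in> {1..n}" and [measurable]: "\<And>b. d b \<in> borel_measurable borel"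
    and d: "\<And>b u. b \<in> {1..n} \<Longrightarrow> 0 \<le> u \<Longrightarrow> u \<le> s \<Longrightarrow> \<bar>d b u\<bar> \<le> C" and s: "0 \<le> s"
  shows "\<bar>\<integral>e. indicator {..s} e * (\<Sum>b=1..n. P a b * d b (s - e)) \<partial>E\<bar> \<le> (1 - exp (- \<theta> * s)) * C"
proof -
  let ?f = "\<lambda>e. indicator {..s} e * (\<Sum>b=1..n. P a b * d b (s - e))"
  have int: "integrable E (?f)"
    "AE e in E. \<bar>?f e\<bar> \<le> indicator {..s} e * C"
    by (rule integrable_waiting[where C = C]; use a d in simp)+
  have "integrable E (\<lambda>e. indicator {..s} e * C)"
    by (rule E.integrable_const_bound[where B = "\<bar>C\<bar>"]) (auto simp: indicator_def)
  have "\<bar>\<integral>e. ?f e \<partial>E\<bar>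
      \<le> (\<integral>e. \<bar>?f e\<bar> \<partial>E)"
    by (rule integral_abs_bound)
  also have "\<dots> \<le> (\<integral>e. indicator {..s} e * C \<partial>E)"
    using int \<open>integrable E (\<lambda>e. indicator {..s} e * C)\<close> by (intro integral_mono_AE integrable_abs)
  also have "\<dots> = (1 - exp (- \<theta> * s)) * C"
    using measure_E_atMost[OF s] by simp
  finally show ?thesis .
qed

text \<open>The contribution of paths without a jump before \<open>s\<close> is expressed by the
  value at time 0 alone. A solution is then determined by its values at time 0, whatever event it
  stems from.\<close>

definition renewal_solution :: "(nat \<Rightarrow> real \<Rightarrow> real) \<Rightarrow> bool" where
  "renewal_solution F \<longleftrightarrow> (\<forall>a. F a \<in> borel_measurable borel) \<and>
     (\<forall>a\<in>{1..n}. \<forall>s\<ge>0. \<bar>F a s\<bar> \<le> 1 \<and>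
        F a s = exp (- \<theta> * s) * F a 0 + (\<integral>e. indicator {..s} e * (\<Sum>b=1..n. P a b * F b (s - e)) \<partial>E))"

lemma renewal_unique:
  assumes F: "renewal_solution F" and G: "renewal_solution G"
    and 0: "\<And>a. a \<in> {1..n} \<Longrightarrow> F a 0 = G a 0" and a: "a \<in> {1..n}" and s: "0 \<le> s"
  shows "F a s = G a s"
proof -
  let ?I = "\<lambda>d a u. \<integral>e. indicator {..u} e * (\<Sum>b=1..n. P a b * d b (u - e)) \<partial>E"
  have [measurable]: "F a \<in> borel_measurable borel" "G a \<in> borel_measurable borel" for a
    using F G unfolding renewal_solution_def by blast+
  have bounded: "\<bar>F a u\<bar> \<le> 1" "\<bar>G a u\<bar> \<le> 1" if "a \<in> {1..n}" "0 \<le> u" for a u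
    using F G that unfolding renewal_solution_def by blast+
  define \<rho> where "\<rho> = 1 - exp (- \<theta> * s)"
  have \<rho>: "0 \<le> \<rho>" "\<rho> < 1"
    using \<theta> s by (auto simp: \<rho>_def)
  have bound: "\<bar>F a u - G a u\<bar> \<le> 2 * \<rho> ^ N" if "a \<in> {1..n}" "0 \<le> u" "u \<le> s" for N a u
    using that
  proof (induction N arbitrary: a u)
    case 0
    then show ?case
      using bounded[of a u] by simp
  next
    case (Suc N)
    have int: "integrable E (\<lambda>e. indicator {..u} e * (\<Sum>b=1..n. P a b * F b (u - e)))"
      "integrable E (\<lambda>e. indicator {..u} e * (\<Sum>b=1..n. P a b * G b (u - e)))"
      by (rule integrable_waiting(1)[where C = 1]; use bounded Suc.prems(1) in simp)+
    have "F a u - G a u = ?I F a u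
        - ?I G a u"
    proof -
      have "F a u = exp (- \<theta> * u) * F a 0 + ?I F a u"
        "G a u = exp (- \<theta> * u) * G a 0 + ?I G a u"
        using F G Suc.prems unfolding renewal_solution_def by blast+
      then show ?thesis
        unfolding 0[OF Suc.prems(1)] by linarith
    qed
    also have "\<dots> = ?I (\<lambda>b v. F b v - G b v) a u"
      using int by (subst Bochner_Integration.integral_diff[symmetric])
        (simp_all add: right_diff_distrib sum_subtractf)
    finally have "\<bar>F a u - G a u\<bar> \<le> (1 - exp (- \<theta> * u)) * (2 * \<rho> ^ N)"
      using waiting_bound[OF Suc.prems(1), of "\<lambda>b v. F b v - G b v" u "2 * \<rho> ^ N"] Suc by simp
    also have "\<dots> \<le> \<rho> * (2 * \<rho> ^ N)"
      using \<rho> \<theta> Suc.prems by (intro mult_right_mono) (auto simp: \<rho>_def)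
    finally show ?case by simp
  qed
  have "(\<lambda>N. 2 * \<rho> ^ N) \<longlonglongrightarrow> 2 * 0"
    using \<rho> by (intro tendsto_mult tendsto_const LIMSEQ_power_zero) simp
  then have "\<bar>F a s - G a s\<bar> \<le> 2 * 0"
    by (rule LIMSEQ_le_const) (use bound[OF a s order_refl] in blast)
  then show ?thesis by simp
qed

lemma regenerative_measurable:
  assumes "regenerative H"
  shows "Measurable.pred W (H a s)" and "(\<lambda>s. \<P>(\<omega> in W. H a s \<omega>)) \<in> borel_measurable borel"
proof -
  have H: "Measurable.pred BW (\<lambda>x. H a (fst x) (snd x))"
    using assms by (simp add: regenerative_def)
  have "(\<lambda>\<omega>. (s, \<omega>)) \<in> measurable W BW"
    by measurable
  from measurable_compose[OF this H] show "Measurable.pred W (H a s)"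
    by simp
  show "(\<lambda>s. \<P>(\<omega> in W. H a s \<omega>)) \<in> borel_measurable borel"
    by (rule measurable_prob_section[OF H])
qed

lemma renewal_regenerative:
  assumes H: "regenerative H"
  shows "renewal_solution (\<lambda>a s. \<P>(\<omega> in W. H a s \<omega>))"
  unfolding renewal_solution_def
proof (intro conjI allI ballI impI)
  define J where "J a s = \<P>(\<omega> in W. H a s \<omega>)" for a s
  have J[measurable]: "J a \<in> borel_measurable borel" for a
    unfolding J_def by (rule regenerative_measurable(2)[OF H])
  show "(\<lambda>s. \<P>(\<omega> in W. H a s \<omega>)) \<in> borel_measurable borel" for a
    by (rule regenerative_measurable(2)[OF H])
  fix a and s :: real assume a: "a \<in> {1..n}" and s: "0 \<le> s"
  let ?f = "\<lambda>s e. indicator {..s} e * (\<Sum>b=1..n. P a b * J b (s - e))"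
  show "\<bar>\<P>(\<omega> in W. H a s \<omega>)\<bar> \<le> 1" by simp
  obtain H' where
      H'[measurable]: "\<And>a b. Measurable.pred BW (\<lambda>x. H' a b (fst x) (snd x))"
    and eq: "\<And>a s x \<omega>. H a s (x ## \<omega>) =
          (if fst x \<le> s then H (\<phi> a (snd x)) (s - fst x) \<omega> else H' a (\<phi> a (snd x)) (fst x - s) \<omega>)"
    using H unfolding regenerative_def by blast
  have HM: "Measurable.pred BW (\<lambda>x. H a (fst x) (snd x))" for a
    using H by (simp add: regenerative_def)
  have J1: "\<bar>J b u\<bar> \<le> 1" for b u
    by (simp add: J_def)
  define q where "q e = (\<Sum>b=1..n. P a b * \<P>(\<omega> in W. H' a b e \<omega>))" for e
  have [measurable]: "(\<lambda>e. \<P>(\<omega> in W. H' a b e \<omega>)) \<in> borel_measurable borel" for b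
    by (rule measurable_prob_section[OF H'])
  have [measurable]: "q \<in> borel_measurable borel"
    unfolding q_def by measurable
  have q: "\<bar>q e\<bar> \<le> 1" for e
    unfolding q_def by (rule P_average_bound[OF a]) simp
  have step: "J a s = (\<integral>e. ?f s e \<partial>E)
      + (\<integral>e. indicator {s<..} e * q (e - s) \<partial>E)" for s
  proof -
    have "(\<lambda>x. (s - fst x, snd x)) \<in> measurable BW BW"
      "(\<lambda>x. (fst x - s, snd x)) \<in> measurable BW BW"
      by measurable
    from measurable_compose[OF this(1) HM] measurable_compose[OF this(2) H']
    have [measurable]: "Measurable.pred BW (\<lambda>x. H b (s - fst x) (snd x))"
      "Measurable.pred BW (\<lambda>x. H' a b (fst x - s) (snd x))" for b
      by simp_all
    have "J a s = \<P>(\<omega> in W. H a s (shd \<omega> ## stl \<omega>))"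
      by (simp add: J_def)
    also have "\<dots> = \<P>(\<omega> in W. (\<lambda>b e \<omega>. if e \<le> s then H b (s - e) \<omega> else H' a b (e - s) \<omega>)
        (\<phi> a (snd (shd \<omega>))) (fst (shd \<omega>)) (stl \<omega>))"
      by (simp only: eq)
    also have "\<dots> = (\<integral>e. (\<Sum>b=1..n. P a b * \<P>(\<omega> in W. if e \<le> s then H b (s - e) \<omega> else H' a b (e - s) \<omega>)) \<partial>E)"
      by (rule prob_first_jump[OF a]) measurable
    also have "\<dots> = (\<integral>e. ?f s e + indicator {s<..} e * q (e - s) \<partial>E)"
      by (intro Bochner_Integration.integral_cong) (auto simp: J_def q_def indicator_def)
    also have "\<dots> = (\<integral>e. ?f s e \<partial>E)
      + (\<integral>e. indicator {s<..} e * q (e - s) \<partial>E)"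
    proof (rule Bochner_Integration.integral_add)
      show "integrable E (?f s)"
        by (rule integrable_waiting(1)[of a J s 1, OF a J J1])
      show "integrable E (\<lambda>e. indicator {s<..} e * q (e - s))"
        using q by (intro E.integrable_const_bound[where B = 1]) (auto simp: indicator_def)
    qed
    finally show ?thesis .
  qed
  \<comment> \<open>At time 0 the jump term vanishes, so the no-jump term is all of
    \<open>J a 0\<close>. By memorylessness the no-jump term at \<open>s\<close> is
    \<open>exp (- \<theta> * s)\<close> times it, which eliminates \<open>H'\<close>.\<close>
  have "(\<integral>e. indicator {..0} e * (\<Sum>b=1..n. P a b * J b (0 - e)) \<partial>E) = 0"
    using waiting_bound[of a J 0 1, OF a J J1] by simp
  then have "J a 0 = (\<integral>e. indicator {0<..} e * q e \<partial>E)"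
    using step[of 0] by simp
  then have "J a s = exp (- \<theta> * s) * J a 0 + (\<integral>e. ?f s e \<partial>E)"
    using step[of s] memoryless[OF s, of q] by simp
  then show "\<P>(\<omega> in W. H a s \<omega>) = exp (- \<theta> * s) * \<P>(\<omega> in W. H a 0 \<omega>)
      + (\<integral>e. indicator {..s} e * (\<Sum>b=1..n. P a b * \<P>(\<omega> in W. H b (s - e) \<omega>)) \<partial>E)"
    by (simp only: J_def)
qed

end

section \<open>The transition function\<close>

context jump_process
begin

definition trans_prob :: "real \<Rightarrow> nat \<Rightarrow> nat \<Rightarrow> real" where
  "trans_prob s a x = \<P>(\<omega> in W. jump_path \<phi> a s \<omega> = x)"

lemma regenerative_path_0: "regenerative (\<lambda>a s \<omega>. jump_path \<phi> a s \<omega> = x)"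
  using regenerative_path[of 0 x] by simp

lemma trans_prob_measurable[measurable]: "(\<lambda>s. trans_prob s a x) \<in> borel_measurable borel"
  unfolding trans_prob_def by (rule regenerative_measurable(2)[OF regenerative_path_0])

text \<open>The sample space contains streams with nonpositive first waiting time, on which the path
  may have left \<open>a\<close> already at time 0. They form a null set.\<close>

lemma AE_path_0: "AE \<omega> in W. jump_path \<phi> a 0 \<omega> = a"
proof -
  have "\<P>(\<omega> in W. fst (shd \<omega>) \<le> 0) = (\<integral>e. (\<Sum>b=1..n. P 1 b * \<P>(\<omega> in W. e \<le> 0)) \<partial>E)"
    using n by (intro prob_first_jump[where A = "\<lambda>b e \<omega>. e \<le> 0"]) auto
  also have "\<dots> = (\<integral>e. indicator {..0} e \<partial>E)"
  proof (intro Bochner_Integration.integral_cong refl)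
    fix e :: real
    have "(\<Sum>b=1..n. P 1 b * indicator {..0} e) = indicator {..0} e"
      using P_sum[of 1] n by (simp add: sum_distrib_right[symmetric])
    moreover have "\<P>(\<omega> in W. e \<le> 0) = indicator {..0} e"
      using W.prob_space by (cases "e \<le> 0") simp_all
    ultimately show "(\<Sum>b=1..n. P 1 b * \<P>(\<omega> in W. e \<le> 0)) = indicator {..0} e"
      by simp
  qed
  also have "\<dots> = 0"
    using measure_E_atMost[of 0] by simp
  finally have "AE \<omega> in W. \<not> fst (shd \<omega>) \<le> 0"
    by (subst (asm) W.prob_eq_0) auto
  then show ?thesis
  proof eventually_elim
    case (elim \<omega>)
    then show ?case
      using path_Stream[of \<phi> a 0 "shd \<omega>" "stl \<omega>"] by simp
  qed
qed

lemma prob_path_0: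
  assumes [measurable]: "Measurable.pred W Q"
  shows "\<P>(\<omega> in W. jump_path \<phi> a 0 \<omega> = x \<and> Q \<omega>) = id_entry a x * \<P>(\<omega> in W. Q \<omega>)"
proof -
  have "\<P>(\<omega> in W. jump_path \<phi> a 0 \<omega> = x \<and> Q \<omega>) = \<P>(\<omega> in W. a = x \<and> Q \<omega>)"
    using AE_path_0[of a] by (intro W.prob_eq_AE) auto
  then show ?thesis
    by (cases "a = x") (simp_all add: id_entry_def)
qed

lemma trans_prob_0: "trans_prob 0 a x = id_entry a x"
  using prob_path_0[of "\<lambda>_. True" a x] by (simp add: trans_prob_def W.prob_space)

lemma renewal_trans_prob: "renewal_solution (\<lambda>a s. trans_prob s a x)"
  unfolding trans_prob_def by (rule renewal_regenerative[OF regenerative_path_0])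

lemma trans_prob_bounds: "0 \<le> trans_prob s a x" "trans_prob s a x \<le> 1"
  by (simp_all add: trans_prob_def)

text \<open>Both sides solve the same renewal equation with the same initial values.\<close>

lemma markov_property:
  assumes H: "regenerative H" and a: "a \<in> {1..n}" and s: "0 \<le> s"
  shows "\<P>(\<omega> in W. jump_path \<phi> a s \<omega> = x \<and> H a s \<omega>) = trans_prob s a x * \<P>(\<omega> in W. H x 0 \<omega>)"
proof -
  let ?c = "\<P>(\<omega> in W. H x 0 \<omega>)"
  \<comment> \<open>The renewal equation is linear, so the constant \<open>?c \<le> 1\<close>
    preserves both the equation and the bound 1.\<close>
  have "renewal_solution (\<lambda>a s. trans_prob s a x * ?c)"
    unfolding renewal_solution_def
  proof (intro conjI allI ballI impI)
    fix a and s :: real assume "a \<in> {1..n}" "0 \<le> s"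
    have "\<bar>trans_prob s a x * ?c\<bar> \<le> 1 * 1"
      unfolding abs_mult by (intro mult_mono) (auto simp: trans_prob_bounds)
    then show "\<bar>trans_prob s a x * ?c\<bar> \<le> 1" by simp
    have "trans_prob s a x = exp (- \<theta> * s) * trans_prob 0 a x
        + (\<integral>e. indicator {..s} e * (\<Sum>b=1..n. P a b * trans_prob (s - e) b x) \<partial>E)"
      using renewal_trans_prob[of x] \<open>a \<in> {1..n}\<close> \<open>0 \<le> s\<close> unfolding renewal_solution_def by blast
    then have "trans_prob s a x * ?c = exp (- \<theta> * s) * (trans_prob 0 a x * ?c)
        + (\<integral>e. indicator {..s} e * (\<Sum>b=1..n. P a b * trans_prob (s - e) b x) \<partial>E) * ?c"
      by (metis (no_types, lifting) distrib_right mult.assoc)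
    also have "(\<integral>e. indicator {..s} e * (\<Sum>b=1..n. P a b * trans_prob (s - e) b x) \<partial>E) * ?c
        = (\<integral>e. indicator {..s} e * (\<Sum>b=1..n. P a b * (trans_prob (s - e) b x * ?c)) \<partial>E)"
      by (subst Bochner_Integration.integral_mult_left_zero[symmetric])
        (simp add: sum_distrib_right mult.assoc)
    finally show "trans_prob s a x * ?c = exp (- \<theta> * s) * (trans_prob 0 a x * ?c)
        + (\<integral>e. indicator {..s} e * (\<Sum>b=1..n. P a b * (trans_prob (s - e) b x * ?c)) \<partial>E)" .
  qed measurable
  moreover have "renewal_solution (\<lambda>a s. \<P>(\<omega> in W. jump_path \<phi> a s \<omega> = x \<and> H a s \<omega>))"
    by (intro renewal_regenerative regenerative_conj regenerative_path_0 H)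
  moreover have "\<P>(\<omega> in W. jump_path \<phi> a 0 \<omega> = x \<and> H a 0 \<omega>) = trans_prob 0 a x * ?c" for a
    using prob_path_0[OF regenerative_measurable(1)[OF H], of a x a 0]
    by (cases "a = x") (simp_all add: trans_prob_0 id_entry_def)
  ultimately show ?thesis
    using renewal_unique[OF _ _ _ a s, of "\<lambda>a s. \<P>(\<omega> in W. jump_path \<phi> a s \<omega> = x \<and> H a s \<omega>)"
        "\<lambda>a s. trans_prob s a x * ?c"] by blast
qed

lemma prob_split_path:
  assumes a: "a \<in> {1..n}" and [measurable]: "Measurable.pred W Q"
  shows "\<P>(\<omega> in W. Q \<omega>) = (\<Sum>x=1..n. \<P>(\<omega> in W. jump_path \<phi> a s \<omega> = x \<and> Q \<omega>))"
proof -
  have "{\<omega> \<in> space W. Q \<omega>} = (\<Union>x\<in>{1..n}. {\<omega> \<in> space W. jump_path \<phi> a s \<omega> = x \<and> Q \<omega>})"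
    using path_range[OF a] by auto
  moreover have "measure W (\<Union>x\<in>{1..n}. {\<omega> \<in> space W. jump_path \<phi> a s \<omega> = x \<and> Q \<omega>})
      = (\<Sum>x=1..n. \<P>(\<omega> in W. jump_path \<phi> a s \<omega> = x \<and> Q \<omega>))"
    by (intro W.finite_measure_finite_Union) (auto simp: disjoint_family_on_def)
  ultimately show ?thesis by simp
qed

lemma transition_function_trans_prob: "transition_function n trans_prob"
  unfolding transition_function_def stochastic_matrix_def
proof (intro conjI allI impI ballI)
  fix a assume a: "a \<in> {1..n}"
  show "(\<Sum>c=1..n. trans_prob u a c) = 1" for u
    using prob_split_path[OF a, of "\<lambda>_. True" u] by (simp add: trans_prob_def W.prob_space)
  fix u v :: real and c assume "0 \<le> u" "0 \<le> v"
  have "trans_prob (u + v) a c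
      = (\<Sum>d=1..n. \<P>(\<omega> in W. jump_path \<phi> a u \<omega> = d \<and> jump_path \<phi> a (u + v) \<omega> = c))"
    unfolding trans_prob_def by (rule prob_split_path[OF a]) measurable
  also have "\<dots> = (\<Sum>d=1..n. trans_prob u a d * trans_prob v d c)"
    using markov_property[OF regenerative_path[OF \<open>0 \<le> v\<close>] a \<open>0 \<le> u\<close>, of _ c]
    by (simp add: trans_prob_def)
  finally show "trans_prob (u + v) a c = (\<Sum>d=1..n. trans_prob u a d * trans_prob v d c)" .
qed (auto simp: trans_prob_0 trans_prob_bounds)

text \<open>\<open>markov_property\<close> splits at the earliest time \<open>s 0\<close>, with the
  later observations as the regenerative event; the induction carries the split to the last
  time.\<close>

lemma prob_paths_Suc:
  fixes m :: nat
  assumes "a \<in> {1..n}" "0 \<le> s 0" "\<And>k. k \<le> m \<Longrightarrow> s k < s (Suc k)" "\<And>k. k \<le> Suc m \<Longrightarrow> x k \<in> {1..n}"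
  shows "\<P>(\<omega> in W. \<forall>k\<le>Suc m. jump_path \<phi> a (s k) \<omega> = x k)
    = \<P>(\<omega> in W. \<forall>k\<le>m. jump_path \<phi> a (s k) \<omega> = x k) * trans_prob (s (Suc m) - s m) (x m) (x (Suc m))"
  using assms
proof (induction m arbitrary: a s x)
  have all_Suc: "(\<forall>k\<le>Suc m. Q k) \<longleftrightarrow> Q 0 \<and> (\<forall>k\<le>m. Q (Suc k))" for m and Q :: "nat \<Rightarrow> bool"
    by (metis Suc_le_mono le0 not0_implies_Suc)
  have rec: "\<P>(\<omega> in W. \<forall>k\<le>Suc m. jump_path \<phi> a (s k) \<omega> = x k)
      = trans_prob (s 0) a (x 0) * \<P>(\<omega> in W. \<forall>k\<le>m. jump_path \<phi> (x 0) (s (Suc k) - s 0) \<omega> = x (Suc k))"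
    if a: "a \<in> {1..n}" and s: "0 \<le> s 0" "\<And>k. k \<le> m \<Longrightarrow> s k < s (Suc k)" for a s x m
  proof -
    have "s 0 \<le> s (Suc k)" if "k \<le> m" for k
      using that
    proof (induction k)
      case (Suc k)
      then show ?case using s(2)[of "Suc k"] by simp
    qed (use s(2)[of 0] in simp)
    then have "regenerative (\<lambda>a u \<omega>. \<forall>k\<le>m. jump_path \<phi> a (u + (s (Suc k) - s 0)) \<omega> = x (Suc k))"
      by (intro regenerative_paths) simp
    from markov_property[OF this a s(1), of "x 0"] show ?thesis
      unfolding all_Suc by simp
  qed
  have one: "(\<forall>k\<le>0. Q k) \<longleftrightarrow> Q 0" for Q :: "nat \<Rightarrow> bool"
    by simp
  {
    case 0
    have "\<P>(\<omega> in W. \<forall>k\<le>Suc 0. jump_path \<phi> a (s k) \<omega> = x k)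
        = trans_prob (s 0) a (x 0) * \<P>(\<omega> in W. \<forall>k\<le>0. jump_path \<phi> (x 0) (s (Suc k) - s 0) \<omega> = x (Suc k))"
      by (rule rec) (use 0 in auto)
    then show ?case
      unfolding one by (simp only: trans_prob_def)
  next
    case (Suc m)
    have x0: "x 0 \<in> {1..n}" using Suc.prems(4) by simp
    have s0: "0 \<le> s (Suc 0) - s 0" using Suc.prems(3)[of 0] by simp
    have "\<P>(\<omega> in W. \<forall>k\<le>Suc m. jump_path \<phi> (x 0) (s (Suc k) - s 0) \<omega> = x (Suc k))
        = \<P>(\<omega> in W. \<forall>k\<le>m. jump_path \<phi> (x 0) (s (Suc k) - s 0) \<omega> = x (Suc k))
          * trans_prob (s (Suc (Suc m)) - s (Suc m)) (x (Suc m)) (x (Suc (Suc m)))"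
      using Suc.IH[of "x 0" "\<lambda>k. s (Suc k) - s 0" "\<lambda>k. x (Suc k)"] x0 s0 Suc.prems(3,4) by simp
    then show ?case
      using Suc.prems rec[of a s "Suc m" x] rec[of a s m x] by simp
  }
qed

section \<open>Poisson series, generator and Gamma mixture of the transition function\<close>

abbreviation poisson :: "nat \<Rightarrow> real \<Rightarrow> real" where "poisson k u \<equiv> erlang_density k \<theta> u / \<theta>"

text \<open>\<open>poisson k\<close> is the probability of exactly \<open>k\<close> jumps, an Erlang
  density divided by its rate. Convolution with one more exponential waiting time turns
  \<open>k\<close> jumps into \<open>Suc k\<close>.\<close>

lemma erlang_renewal:
  assumes "0 \<le> s"
  shows "(\<integral>e. indicator {..s} e * poisson k (s - e) \<partial>E) = poisson (Suc k) s"
    and "integrable E (\<lambda>e. indicator {..s} e * poisson k (s - e))"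
proof -
  let ?g = "\<lambda>e. indicator {..s} e * poisson k (s - e)"
  have "(\<integral>\<^sup>+e. ennreal (?g e) \<partial>E)
      = (\<integral>\<^sup>+e. ennreal (1 / \<theta>) * (ennreal (erlang_density k \<theta> (s - e)) * ennreal (erlang_density 0 \<theta> e)) \<partial>lborel)"
    unfolding E_def
  proof (subst nn_integral_density)
    have "ennreal (erlang_density 0 \<theta> e) * ennreal (?g e)
        = ennreal (1 / \<theta>) * (ennreal (erlang_density k \<theta> (s - e)) * ennreal (erlang_density 0 \<theta> e))" for e
    proof -
      have "indicator {..s} e * erlang_density k \<theta> (s - e) = erlang_density k \<theta> (s - e)"
        by (simp add: indicator_def erlang_density_def)
      then have "?g e = poisson k (s - e)"
        by simp
      then show ?thesis
        using \<theta> by (simp add: ennreal_mult'[symmetric] mult_ac)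
    qed
    then show "(\<integral>\<^sup>+e. ennreal (erlang_density 0 \<theta> e) * ennreal (?g e) \<partial>lborel)
        = (\<integral>\<^sup>+e. ennreal (1 / \<theta>) * (ennreal (erlang_density k \<theta> (s - e)) * ennreal (erlang_density 0 \<theta> e)) \<partial>lborel)"
      by simp
  qed measurable
  also have "\<dots> = ennreal (1 / \<theta>) * ennreal (erlang_density (Suc k) \<theta> s)"
    using fun_cong[OF convolution_erlang_density[OF \<theta>, of k 0], of s] by (subst nn_integral_cmult) simp_all
  also have "\<dots> = ennreal (poisson (Suc k) s)"
    using \<theta> by (simp add: ennreal_mult'[symmetric])
  finally have *: "(\<integral>\<^sup>+e. ennreal (?g e) \<partial>E)
      = ennreal (poisson (Suc k) s)" .
  have nonneg: "0 \<le> ?g e" "0 \<le> poisson (Suc k) s" for e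
    using \<theta> by (simp_all add: erlang_density_nonneg)
  show "(\<integral>e. ?g e \<partial>E) = poisson (Suc k) s"
  proof -
    have "(\<integral>e. ?g e \<partial>E)
        = enn2real (\<integral>\<^sup>+e. ennreal (?g e) \<partial>E)"
      by (rule integral_eq_nn_integral) (use nonneg in auto)
    also have "\<dots> = poisson (Suc k) s"
      unfolding * using nonneg(2) by (rule enn2real_ennreal)
    finally show ?thesis .
  qed
  show "integrable E (?g)"
    by (rule integrableI_nn_integral_finite[OF _ _ *]) (use nonneg in auto)
qed

text \<open>Uniformisation: given \<open>k\<close> jumps, the state has the law of \<open>k\<close>
  steps of \<open>P\<close>. The partial sums \<open>F N\<close> are the Picard iterates of the
  renewal equation started at 0, and the contraction gives the error
  \<open>\<rho> ^ N\<close>.\<close>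

lemma trans_prob_sums:
  assumes a: "a \<in> {1..n}" and s: "0 \<le> s"
  shows "(\<lambda>k. poisson k s * mat_power n P k a x) sums trans_prob s a x"
proof -
  let ?I = "\<lambda>d a u. \<integral>e. indicator {..u} e * (\<Sum>b=1..n. P a b * d b (u - e)) \<partial>E"
  define F where "F N a u = (\<Sum>k<N. poisson k u * mat_power n P k a x)" for N a u
  have [measurable]: "F N a \<in> borel_measurable borel" for N a
    unfolding F_def by measurable
  define \<rho> where "\<rho> = 1 - exp (- \<theta> * s)"
  have \<rho>: "0 \<le> \<rho>" "\<rho> < 1"
    using \<theta> s by (auto simp: \<rho>_def)
  have F_Suc: "F (Suc N) a u = exp (- \<theta> * u) * id_entry a x
      + ?I (F N) a u"
    and F_int: "integrable E (\<lambda>e. indicator {..u} e * (\<Sum>b=1..n. P a b * F N b (u - e)))"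
    if "a \<in> {1..n}" "0 \<le> u" for N a u
  proof -
    have "indicator {..u} e * (\<Sum>b=1..n. P a b * F N b (u - e))
        = (\<Sum>k<N. mat_power n P (Suc k) a x * (indicator {..u} e * poisson k (u - e)))" for e :: real
    proof -
      have "(\<Sum>b=1..n. P a b * F N b (u - e))
          = (\<Sum>k<N. \<Sum>b=1..n. P a b * (poisson k (u - e) * mat_power n P k b x))"
        unfolding F_def sum_distrib_left by (rule sum.swap)
      also have "\<dots> = (\<Sum>k<N. mat_power n P (Suc k) a x * poisson k (u - e))"
        unfolding mat_power.simps(2) sum_distrib_right by (intro sum.cong refl) (simp only: mult_ac)
      finally have "(\<Sum>b=1..n. P a b * F N b (u - e))
          = (\<Sum>k<N. mat_power n P (Suc k) a x * poisson k (u - e))" .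
      then have "indicator {..u} e * (\<Sum>b=1..n. P a b * F N b (u - e))
          = indicator {..u} e * (\<Sum>k<N. mat_power n P (Suc k) a x * poisson k (u - e))"
        by (rule arg_cong)
      also have "\<dots> = (\<Sum>k<N. mat_power n P (Suc k) a x * (indicator {..u} e * poisson k (u - e)))"
        unfolding sum_distrib_left by (intro sum.cong refl) (simp only: mult_ac)
      finally show ?thesis .
    qed
    then have eq: "(\<lambda>e. indicator {..u} e * (\<Sum>b=1..n. P a b * F N b (u - e)))
        = (\<lambda>e. \<Sum>k<N. mat_power n P (Suc k) a x * (indicator {..u} e * poisson k (u - e)))"
      by (rule ext)
    show "integrable E (\<lambda>e. indicator {..u} e * (\<Sum>b=1..n. P a b * F N b (u - e)))"
      unfolding eq by (intro Bochner_Integration.integrable_sum integrable_mult_right erlang_renewal that)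
    have "?I (F N) a u
        = (\<Sum>k<N. mat_power n P (Suc k) a x * poisson (Suc k) u)"
      unfolding eq
      by (subst Bochner_Integration.integral_sum)
        (simp_all only: integral_mult_right_zero erlang_renewal[OF that(2)] integrable_mult_right)
    moreover have "poisson 0 u = exp (- \<theta> * u)"
      using that \<theta> by (simp add: erlang_density_def)
    ultimately show "F (Suc N) a u = exp (- \<theta> * u) * id_entry a x
      + ?I (F N) a u"
      unfolding F_def sum.lessThan_Suc_shift by (simp only: mat_power.simps(1) mult.commute)
  qed
  have bound: "\<bar>trans_prob u a x - F N a u\<bar> \<le> \<rho> ^ N" if "a \<in> {1..n}" "0 \<le> u" "u \<le> s" for N a u
    using that
  proof (induction N arbitrary: a u)
    case 0
    then show ?case
      by (simp add: F_def trans_prob_bounds)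
  next
    case (Suc N)
    have int: "integrable E (\<lambda>e. indicator {..u} e * (\<Sum>b=1..n. P a b * trans_prob (u - e) b x))"
      by (rule integrable_waiting(1)[where C = 1]) (use Suc.prems in \<open>auto simp: trans_prob_bounds\<close>)
    have "trans_prob u a x = exp (- \<theta> * u) * id_entry a x
        + ?I (\<lambda>b v. trans_prob v b x) a u"
      using renewal_trans_prob[of x] Suc.prems unfolding renewal_solution_def trans_prob_0 by blast
    then have "trans_prob u a x - F (Suc N) a u
        = ?I (\<lambda>b v. trans_prob v b x) a u
        - ?I (F N) a u"
      using F_Suc[OF Suc.prems(1,2), of N] by linarith
    also have "\<dots> = ?I (\<lambda>b v. trans_prob v b x - F N b v) a u"
      using int F_int[OF Suc.prems(1,2), of N]
      by (subst Bochner_Integration.integral_diff[symmetric]) (simp_all add: right_diff_distrib sum_subtractf)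
    finally have "\<bar>trans_prob u a x - F (Suc N) a u\<bar> \<le> (1 - exp (- \<theta> * u)) * \<rho> ^ N"
      using waiting_bound[OF Suc.prems(1), of "\<lambda>b v. trans_prob v b x - F N b v" u "\<rho> ^ N"] Suc by simp
    also have "\<dots> \<le> \<rho> * \<rho> ^ N"
      using \<rho> \<theta> Suc.prems by (intro mult_right_mono) (auto simp: \<rho>_def)
    finally show ?case by simp
  qed
  have "(\<lambda>N. \<rho> ^ N) \<longlonglongrightarrow> 0"
    using \<rho> by (intro LIMSEQ_power_zero) simp
  then have "(\<lambda>N. F N a s - trans_prob s a x) \<longlonglongrightarrow> 0"
    by (rule Lim_null_comparison[rotated])
      (use bound[OF a s order_refl] in \<open>auto simp: abs_minus_commute\<close>)
  then have "(\<lambda>N. F N a s) \<longlonglongrightarrow> trans_prob s a x"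
    by (rule LIM_zero_cancel)
  then show ?thesis
    by (simp add: sums_def F_def)
qed

text \<open>The main term describes at most one jump, and two jumps by time \<open>s\<close> have
  probability at most \<open>(1 - exp (- \<theta> * s))^2\<close>. Formally, the entries move by at
  most \<open>?\<rho> s\<close>, and inserting this into the renewal equation once more squares the
  bound.\<close>

lemma trans_prob_first_order:
  assumes a: "a \<in> {1..n}" and x: "x \<in> {1..n}" and s: "0 \<le> s"
  shows "\<bar>trans_prob s a x - id_entry a x - (1 - exp (- \<theta> * s)) * (P a x - id_entry a x)\<bar>
    \<le> (1 - exp (- \<theta> * s))\<^sup>2"
proof -
  let ?\<rho> = "\<lambda>u. 1 - exp (- \<theta> * u)"
  let ?I = "\<lambda>d a u. \<integral>e. indicator {..u} e * (\<Sum>b=1..n. P a b * d b (u - e)) \<partial>E"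
  let ?J = "?I (\<lambda>b v. trans_prob v b x)"
  have eq: "trans_prob u a x = exp (- \<theta> * u) * id_entry a x + ?J a u"
    if "a \<in> {1..n}" "0 \<le> u" for a u
    using renewal_trans_prob[of x] that unfolding renewal_solution_def trans_prob_0 by blast
  have near: "\<bar>trans_prob u b x - id_entry b x\<bar> \<le> ?\<rho> s" if b: "b \<in> {1..n}" and u: "0 \<le> u" "u \<le> s" for b u
  proof -
    have I1: "\<bar>?J b u\<bar> \<le> ?\<rho> u * 1"
      by (rule waiting_bound[OF b]) (use u in \<open>auto simp: trans_prob_bounds\<close>)
    have I1: "?J b u \<le> ?\<rho> u"
      using abs_le_D1[OF I1] by (simp only: mult_1_right)
    have I0: "0 \<le> ?J b u"
      using P_nonneg[OF b] by (intro integral_nonneg_AE AE_I2) (auto intro!: sum_nonneg mult_nonneg_nonneg trans_prob_bounds)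
    have \<rho>: "?\<rho> u \<le> ?\<rho> s"
      using u \<theta> by simp
    show ?thesis
    proof (cases "b = x")
      case True
      then have "trans_prob u b x = exp (- \<theta> * u) + ?J b u" "id_entry b x = 1"
        using eq[OF b u(1)] by (simp_all only: id_entry_def if_True mult_1_right simp_thms)
      then show ?thesis
        using I1 I0 \<rho> by (intro abs_leI; linarith)
    next
      case False
      then have "trans_prob u b x = ?J b u" "id_entry b x = 0"
        using eq[OF b u(1)] by (simp_all only: id_entry_def if_False mult_zero_right add_0)
      then show ?thesis
        using I1 I0 \<rho> by (intro abs_leI; linarith)
    qed
  qed
  have int: "integrable E (\<lambda>e. indicator {..s} e * (\<Sum>b=1..n. P a b * trans_prob (s - e) b x))"
    by (rule integrable_waiting(1)[where C = 1]) (use a in \<open>auto simp: trans_prob_bounds\<close>)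
  have "(\<Sum>b=1..n. P a b * id_entry b x) = P a x"
    using x by (intro sum_id_entry) auto
  then have "?\<rho> s * P a x = (\<integral>e. indicator {..s} e * (\<Sum>b=1..n. P a b * id_entry b x) \<partial>E)"
    using measure_E_atMost[OF s] by simp
  moreover have "integrable E (\<lambda>e. indicator {..s} e * (\<Sum>b=1..n. P a b * id_entry b x))"
    by (rule integrable_waiting(1)[where C = 1]) (use a in \<open>auto simp: id_entry_def\<close>)
  ultimately have "?J a s - ?\<rho> s * P a x
      = ?I (\<lambda>b v. trans_prob v b x - id_entry b x) a s"
    using int by (simp only:, subst Bochner_Integration.integral_diff[symmetric])
      (simp_all add: right_diff_distrib sum_subtractf)
  moreover have "\<bar>?I (\<lambda>b v. trans_prob v b x - id_entry b x) a s\<bar> \<le> ?\<rho> s * ?\<rho> s"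
    by (rule waiting_bound[OF a]) (use near s in auto)
  ultimately show ?thesis
    unfolding eq[OF a s] by (simp add: algebra_simps power2_eq_square)
qed

lemma trans_prob_generator:
  assumes a: "a \<in> {1..n}" and x: "x \<in> {1..n}"
  shows "((\<lambda>u. (trans_prob u a x - id_entry a x) / u) \<longlongrightarrow> \<theta> * (P a x - id_entry a x)) (at_right 0)"
proof -
  let ?\<rho> = "\<lambda>u. 1 - exp (- \<theta> * u)"
  have "((\<lambda>u. 1 - exp (- \<theta> * u)) has_real_derivative \<theta>) (at 0)"
    by (auto intro!: derivative_eq_intros)
  then have d: "((\<lambda>u. ?\<rho> u / u) \<longlongrightarrow> \<theta>) (at_right 0)"
    by (auto simp: has_field_derivative_iff intro: filterlim_mono[OF _ order_refl at_le])
  have "((\<lambda>u. ?\<rho> u / u * ?\<rho> u) \<longlongrightarrow> \<theta> * (1 - exp (- \<theta> * 0))) (at_right 0)"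
    by (intro tendsto_intros d)
  then have "((\<lambda>u. ?\<rho> u / u * ?\<rho> u) \<longlongrightarrow> 0) (at_right 0)"
    by simp
  then have "((\<lambda>u. (trans_prob u a x - id_entry a x) / u - ?\<rho> u / u * (P a x - id_entry a x)) \<longlongrightarrow> 0) (at_right 0)"
  proof (rule Lim_null_comparison[rotated])
    show "\<forall>\<^sub>F u in at_right 0. norm ((trans_prob u a x - id_entry a x) / u - ?\<rho> u / u * (P a x - id_entry a x))
        \<le> ?\<rho> u / u * ?\<rho> u"
      using eventually_at_right_less[of 0]
    proof eventually_elim
      case (elim u)
      have "norm ((trans_prob u a x - id_entry a x) / u - ?\<rho> u / u * (P a x - id_entry a x))
          = \<bar>trans_prob u a x - id_entry a x - ?\<rho> u * (P a x - id_entry a x)\<bar> / u"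
        using elim by (simp add: diff_divide_distrib[symmetric] abs_divide)
      also have "\<dots> \<le> (?\<rho> u)\<^sup>2 / u"
        using elim trans_prob_first_order[OF a x, of u] by (intro divide_right_mono) auto
      finally show ?case
        by (simp add: power2_eq_square)
    qed
  qed
  moreover have "((\<lambda>u. ?\<rho> u / u * (P a x - id_entry a x)) \<longlongrightarrow> \<theta> * (P a x - id_entry a x)) (at_right 0)"
    by (intro tendsto_intros d)
  ultimately show ?thesis
    using tendsto_add by fastforce
qed

text \<open>An Erlang density with index \<open>r\<close> has shape \<open>Suc r\<close>, which
  accounts for the order of the mixture.\<close>

lemma trans_prob_erlang_mixture:
  assumes a: "a \<in> {1..n}" and x: "x \<in> {1..n}" and l: "0 < l"
  shows "(\<integral>\<^sup>+u. ennreal (erlang_density r l u) * ennreal (trans_prob u a x) \<partial>lborel)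
    = ennreal (nb_mixture n P (Suc r) (\<theta> / (l + \<theta>)) a x)"
proof -
  let ?a = "\<theta> / (l + \<theta>)"
  have ratio: "0 \<le> ?a" "?a < 1" "1 - ?a = l / (l + \<theta>)"
    using \<theta> l by (auto simp: field_simps)
  have mp: "0 \<le> mat_power n P k a x" for k
    using stochastic_matrix_le_1(1)[OF stochastic_mat_power[OF stochastic_P] a x] .
  have pt: "ennreal (erlang_density r l u) * ennreal (trans_prob u a x)
      = (\<Sum>k. ennreal (nb_mass (Suc r) ?a k * mat_power n P k a x) * ennreal (erlang_density (r + k) (l + \<theta>) u))" for u
  proof (cases "u < 0")
    case False
    \<comment> \<open>Pointwise in \<open>u\<close>, Gamma density times Poisson weight is the
      negative binomial mass times the Erlang density of index \<open>r + k\<close> and rate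
      \<open>l + \<theta>\<close>; the latter integrates to 1.\<close>
    have e: "erlang_density r l u * (poisson k u * mat_power n P k a x)
        = nb_mass (Suc r) ?a k * mat_power n P k a x * erlang_density (r + k) (l + \<theta>) u" for k
    proof -
      have "real ((r + k) choose k) = fact (r + k) / (fact k * fact r)"
        using binomial_fact[of k "r + k"] by simp
      then have nb: "nb_mass (Suc r) ?a k = fact (r + k) / (fact k * fact r) * (\<theta> ^ k / (l + \<theta>) ^ k) * (l ^ Suc r / (l + \<theta>) ^ Suc r)"
        unfolding nb_mass_def ratio(3) power_divide by simp
      have "exp (- l * u) * exp (- \<theta> * u) = exp (- (l + \<theta>) * u)"
        unfolding mult_exp_exp by (simp add: algebra_simps)
      then have "erlang_density r l u * poisson k u
          = l ^ Suc r * \<theta> ^ k * u ^ (r + k) * exp (- (l + \<theta>) * u) / (fact r * fact k)"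
        using False \<theta> by (simp add: erlang_density_def power_add field_simps)
      also have "\<dots> = nb_mass (Suc r) ?a k * erlang_density (r + k) (l + \<theta>) u"
        unfolding nb using False \<theta> l by (simp add: erlang_density_def power_add mult_ac)
      finally have "erlang_density r l u * poisson k u * mat_power n P k a x
          = nb_mass (Suc r) ?a k * erlang_density (r + k) (l + \<theta>) u * mat_power n P k a x"
        by (rule arg_cong)
      then show ?thesis by (simp only: mult_ac)
    qed
    have "(\<lambda>k. erlang_density r l u * (poisson k u * mat_power n P k a x))
        sums (erlang_density r l u * trans_prob u a x)"
      using False by (intro sums_mult trans_prob_sums[OF a]) simp
    then have "(\<Sum>k. ennreal (nb_mass (Suc r) ?a k * mat_power n P k a x * erlang_density (r + k) (l + \<theta>) u))
        = ennreal (erlang_density r l u * trans_prob u a x)"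
      unfolding e using mp nb_mass_nonneg[OF ratio(1,2)] \<theta> l by (intro suminf_ennreal_eq) simp_all
    then show ?thesis
      using l \<theta> mp nb_mass_nonneg[OF ratio(1,2)] trans_prob_bounds by (simp add: ennreal_mult)
  qed (simp add: erlang_density_def)
  have "(\<integral>\<^sup>+u. ennreal (erlang_density r l u) * ennreal (trans_prob u a x) \<partial>lborel)
      = (\<Sum>k. \<integral>\<^sup>+u. ennreal (nb_mass (Suc r) ?a k * mat_power n P k a x) * ennreal (erlang_density (r + k) (l + \<theta>) u) \<partial>lborel)"
    unfolding pt by (rule nn_integral_suminf) measurable
  also have "\<dots> = (\<Sum>k. ennreal (nb_mass (Suc r) ?a k * mat_power n P k a x))"
    using nn_integral_erlang_ith_moment[of "l + \<theta>" _ 0] l \<theta> by (simp add: nn_integral_cmult)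
  also have "\<dots> = ennreal (nb_mixture n P (Suc r) ?a a x)"
    unfolding nb_mixture_def
    using mp nb_mass_nonneg[OF ratio(1,2)] nb_mixture_summable[OF stochastic_P ratio(1,2) a x]
    by (intro suminf_ennreal2) simp_all
  finally show ?thesis .
qed

end

section \<open>Chains with an independent random time\<close>

lemma indep_of_process_pair:
  assumes A: "prob_space A" and K: "prob_space K" and Z[measurable]: "Z \<in> measurable K L"
    and Y: "\<And>s. s \<in> I \<Longrightarrow> Y s \<in> measurable A (count_space S)"
  shows "indep_of_process (A \<Otimes>\<^sub>M K) L (\<lambda>w. Z (snd w)) I S (\<lambda>s w. Y s (fst w))"
proof -
  interpret A: prob_space A by fact
  interpret K: prob_space K by fact
  interpret AK: pair_prob_space A K ..
  let ?Y = "\<lambda>x. \<lambda>s\<in>I. Y s x"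
  have Ym: "?Y \<in> measurable A (Pi\<^sub>M I (\<lambda>_. count_space S))"
    using Y by (rule measurable_restrict)
  have YM: "(\<lambda>w. ?Y (fst w)) \<in> measurable (A \<Otimes>\<^sub>M K) (Pi\<^sub>M I (\<lambda>_. count_space S))"
    using measurable_compose[OF measurable_fst Ym] .
  have ZM: "(\<lambda>w. Z (snd w)) \<in> measurable (A \<Otimes>\<^sub>M K) L"
    by measurable
  have sets: "sets (vimage_algebra (space (A \<Otimes>\<^sub>M K)) f M) = {f -` B \<inter> space (A \<Otimes>\<^sub>M K) | B. B \<in> sets M}"
    if "f \<in> measurable (A \<Otimes>\<^sub>M K) M" for f and M :: "'x measure"
    using measurable_space[OF that] by (intro sets_vimage_algebra2) auto
  show ?thesis
    unfolding indep_of_process_def sets[OF ZM] sets[OF YM]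
  proof (rule AK.indep_setI)
    fix a b
    assume "a \<in> {(\<lambda>w. Z (snd w)) -` B \<inter> space (A \<Otimes>\<^sub>M K) |B. B \<in> sets L}"
      "b \<in> {(\<lambda>w. ?Y (fst w)) -` B \<inter> space (A \<Otimes>\<^sub>M K) |B. B \<in> sets (Pi\<^sub>M I (\<lambda>_. count_space S))}"
    then obtain B C where B: "B \<in> sets L" "a = (\<lambda>w. Z (snd w)) -` B \<inter> space (A \<Otimes>\<^sub>M K)"
      and C: "C \<in> sets (Pi\<^sub>M I (\<lambda>_. count_space S))" "b = (\<lambda>w. ?Y (fst w)) -` C \<inter> space (A \<Otimes>\<^sub>M K)"
      by blast
    let ?B = "Z -` B \<inter> space K" and ?C = "?Y -` C \<inter> space A"
    have [measurable]: "?B \<in> sets K" "?C \<in> sets A"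
      using measurable_sets[OF Z B(1)] measurable_sets[OF Ym C(1)] by auto
    have "a = space A \<times> ?B" "b = ?C \<times> space K" "a \<inter> b = ?C \<times> ?B"
      unfolding B C by (auto simp: space_pair_measure)
    then show "measure (A \<Otimes>\<^sub>M K) (a \<inter> b) = measure (A \<Otimes>\<^sub>M K) a * measure (A \<Otimes>\<^sub>M K) b"
      by (simp add: measure_def K.emeasure_pair_measure_Times enn2real_mult A.emeasure_space_1 K.emeasure_space_1)
  qed (use measurable_sets[OF ZM] measurable_sets[OF YM] in auto)
qed

text \<open>The first component of the sample space has a prescribed type, so the seed, consisting
  of an initial state and a stream, is transported along an injection \<open>code\<close>. A uniform
  initial state gives every start positive probability, and the factor \<open>K\<close> carries the
  independent time.\<close>

locale realized_process =
  jump_process D n P \<theta> \<phi> + K: prob_space K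
  for D :: "'d measure" and n P \<theta> \<phi> and K :: "'z measure" +
  fixes code :: "nat \<times> (real \<times> 'd) stream \<Rightarrow> 'c"
  assumes inj_code: "inj code"
begin

definition U :: "nat measure" where "U = uniform_count_measure {1..n}"

definition A :: "'c measure" where "A = embed_measure (U \<Otimes>\<^sub>M W) code"

definition origin :: "'c \<Rightarrow> nat" where "origin x = fst (inv code x)"

definition drive :: "'c \<Rightarrow> (real \<times> 'd) stream" where "drive x = snd (inv code x)"

sublocale U: prob_space U
  unfolding U_def using n by (intro prob_space_uniform_count_measure) auto

sublocale UW: pair_prob_space U W ..

lemma sets_U[measurable_cong]: "sets U = sets (count_space {1..n})"
  unfolding U_def by (rule sets_uniform_count_measure_count_space)

lemma space_U: "space U = {1..n}"
  by (simp add: U_def space_uniform_count_measure)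

sublocale A: prob_space A
  unfolding A_def
  by (subst embed_measure_eq_distr[OF inj_code])
    (rule UW.prob_space_distr, rule measurable_embed_measure2[OF inj_code])

sublocale AK: pair_prob_space A K ..

abbreviation AK :: "('c \<times> 'z) measure" where "AK \<equiv> A \<Otimes>\<^sub>M K"

lemma decode: "origin (code x) = fst x" "drive (code x) = snd x"
  using inj_code by (simp_all add: origin_def drive_def)

lemma measurable_fst_U: "fst \<in> measurable (U \<Otimes>\<^sub>M W) (count_space UNIV)"
  by (rule measurable_compose[OF measurable_fst]) (simp cong: measurable_cong_sets[OF sets_U])

lemma measurable_origin[measurable]: "origin \<in> measurable A (count_space UNIV)"
  unfolding A_def by (rule measurable_embed_measure1) (simp add: decode measurable_fst_U)

lemma measurable_drive[measurable]: "drive \<in> measurable A W"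
  unfolding A_def by (rule measurable_embed_measure1) (simp add: decode)

lemma origin_range: "x \<in> space A \<Longrightarrow> origin x \<in> {1..n}"
  by (auto simp: A_def space_embed_measure decode space_pair_measure space_U)

lemma drive_space: "x \<in> space A \<Longrightarrow> drive x \<in> space W"
  using measurable_space[OF measurable_drive] .

text \<open>\<open>Q\<close> may depend on the coordinate in \<open>K\<close>, which is how random
  times enter. Fubini freezes that coordinate, and the uniform origin becomes an average over the
  starting states.\<close>

lemma prob_realized:
  assumes Q[measurable]: "\<And>a. Measurable.pred (W \<Otimes>\<^sub>M K) (\<lambda>x. Q a (fst x) (snd x))"
  shows "ennreal (\<P>(w in AK. Q (origin (fst w)) (drive (fst w)) (snd w)))
    = (\<Sum>a=1..n. ennreal (1 / n) * (\<integral>\<^sup>+z. ennreal (\<P>(\<omega> in W. Q a \<omega> z)) \<partial>K))"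
proof -
  let ?E = "{w \<in> space AK. Q (origin (fst w)) (drive (fst w)) (snd w)}"
  have QM: "Measurable.pred N (\<lambda>x. Q (f x) (g x) (k x))"
    if [measurable]: "f \<in> measurable N (count_space UNIV)" "g \<in> measurable N W" "k \<in> measurable N K"
    for f g k and N :: "'y measure"
  proof (rule measurable_compose_countable[where f = "\<lambda>a x. Q a (g x) (k x)"])
    show "Measurable.pred N (\<lambda>x. Q a (g x) (k x))" for a
      using measurable_compose[OF measurable_Pair[OF that(2,3)] Q[of a]] by simp
  qed measurable
  have [measurable]: "Measurable.pred AK (\<lambda>w. Q (origin (fst w)) (drive (fst w)) (snd w))"
    by (rule QM) measurable
  have S1: "Measurable.pred A (\<lambda>x. Q (origin x) (drive x) z)" if "z \<in> space K" for z
    by (rule QM) (use that in measurable)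
  have S2: "Measurable.pred (U \<Otimes>\<^sub>M W) (\<lambda>x. Q (fst x) (snd x) z)" if "z \<in> space K" for z
    by (rule QM) (use that measurable_fst_U in measurable)
  have S3: "Measurable.pred W (\<lambda>\<omega>. Q a \<omega> z)" if "z \<in> space K" for z a
    by (rule QM[of "\<lambda>_. a"]) (use that in measurable)
  have "ennreal (\<P>(w in AK. Q (origin (fst w)) (drive (fst w)) (snd w)))
      = (\<integral>\<^sup>+w. indicator ?E w \<partial>AK)"
    by (simp add: AK.emeasure_eq_measure)
  also have "\<dots> = (\<integral>\<^sup>+z. \<integral>\<^sup>+x. indicator ?E (x, z) \<partial>A \<partial>K)"
    by (rule AK.nn_integral_snd[symmetric]) measurable
  also have "\<dots> = (\<integral>\<^sup>+z. (\<Sum>a=1..n. ennreal (1 / n) * ennreal (\<P>(\<omega> in W. Q a \<omega> z))) \<partial>K)"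
  proof (rule nn_integral_cong)
    fix z assume z: "z \<in> space K"
    let ?F = "{x \<in> space (U \<Otimes>\<^sub>M W). Q (fst x) (snd x) z}"
    have "(\<integral>\<^sup>+x. indicator ?E (x, z) \<partial>A)
        = (\<integral>\<^sup>+x. indicator {x \<in> space A. Q (origin x) (drive x) z} x \<partial>A)"
      using z by (intro nn_integral_cong) (auto simp: space_pair_measure indicator_def)
    also have "\<dots> = (\<integral>\<^sup>+x. indicator {x \<in> space A. Q (origin x) (drive x) z} (code x) \<partial>(U \<Otimes>\<^sub>M W))"
      unfolding A_def
      by (rule nn_integral_embed_measure[OF inj_code]) (use S1[OF z] in \<open>simp add: A_def[symmetric]\<close>)
    also have "\<dots> = (\<integral>\<^sup>+x. indicator ?F x \<partial>(U \<Otimes>\<^sub>M W))"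
      by (intro nn_integral_cong) (auto simp: indicator_def decode A_def space_embed_measure)
    also have "\<dots> = (\<integral>\<^sup>+a. \<integral>\<^sup>+\<omega>. indicator ?F (a, \<omega>) \<partial>W \<partial>U)"
      by (rule W.nn_integral_fst[symmetric]) (use S2[OF z] in measurable)
    also have "\<dots> = (\<integral>\<^sup>+a. ennreal (\<P>(\<omega> in W. Q a \<omega> z)) \<partial>U)"
    proof (rule nn_integral_cong)
      fix a assume "a \<in> space U"
      then have "(\<integral>\<^sup>+\<omega>. indicator ?F (a, \<omega>) \<partial>W)
          = (\<integral>\<^sup>+\<omega>. indicator {\<omega> \<in> space W. Q a \<omega> z} \<omega> \<partial>W)"
        by (intro nn_integral_cong) (auto simp: indicator_def space_pair_measure)
      also have "\<dots> = ennreal (\<P>(\<omega> in W. Q a \<omega> z))"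
        using S3[OF z, of a] by (subst nn_integral_indicator) (auto simp: W.emeasure_eq_measure)
      finally show "(\<integral>\<^sup>+\<omega>. indicator ?F (a, \<omega>) \<partial>W)
          = ennreal (\<P>(\<omega> in W. Q a \<omega> z))" .
    qed
    also have "\<dots> = (\<Sum>a=1..n. ennreal (1 / n) * ennreal (\<P>(\<omega> in W. Q a \<omega> z)))"
      unfolding U_def uniform_count_measure_def by (subst nn_integral_point_measure_finite) simp_all
    finally show "(\<integral>\<^sup>+x. indicator ?E (x, z) \<partial>A)
        = (\<Sum>a=1..n. ennreal (1 / n) * ennreal (\<P>(\<omega> in W. Q a \<omega> z)))" .
  qed
  also have "\<dots> = (\<Sum>a=1..n. ennreal (1 / n) * (\<integral>\<^sup>+z. ennreal (\<P>(\<omega> in W. Q a \<omega> z)) \<partial>K))"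
  proof -
    have [measurable]: "(\<lambda>z. \<P>(\<omega> in W. Q a \<omega> z)) \<in> borel_measurable K" for a
    proof -
      have "(\<lambda>z. measure W ((\<lambda>\<omega>. (\<omega>, z)) -` {x \<in> space (W \<Otimes>\<^sub>M K). Q a (fst x) (snd x)})) \<in> borel_measurable K"
        unfolding measure_def
        by (intro borel_measurable_enn2real pair_sigma_finite.measurable_emeasure_Pair2) (auto simp: pair_sigma_finite_def W.sigma_finite_measure_axioms K.sigma_finite_measure_axioms)
      moreover have "measure W ((\<lambda>\<omega>. (\<omega>, z)) -` {x \<in> space (W \<Otimes>\<^sub>M K). Q a (fst x) (snd x)}) = \<P>(\<omega> in W. Q a \<omega> z)"
        if "z \<in> space K" for z
        using that by (simp add: space_pair_measure)
      ultimately show ?thesis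
        by (simp cong: measurable_cong)
    qed
    show ?thesis
      by (subst nn_integral_sum) (auto intro!: sum.cong nn_integral_cmult)
  qed
  finally show ?thesis .
qed

lemma prob_realized_path:
  assumes Q: "\<And>a. Measurable.pred W (Q a)"
  shows "\<P>(w in AK. Q (origin (fst w)) (drive (fst w))) = (\<Sum>a=1..n. \<P>(\<omega> in W. Q a \<omega>)) / n"
proof -
  have "Measurable.pred (W \<Otimes>\<^sub>M K) (\<lambda>x. Q a (fst x))" for a
    using measurable_compose[OF measurable_fst Q] .
  from prob_realized[OF this]
  have "ennreal (\<P>(w in AK. Q (origin (fst w)) (drive (fst w))))
      = (\<Sum>a=1..n. ennreal (1 / n) * ennreal (\<P>(\<omega> in W. Q a \<omega>)))"
    by (simp add: K.emeasure_space_1)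
  also have "\<dots> = (\<Sum>a=1..n. ennreal (\<P>(\<omega> in W. Q a \<omega>) / n))"
    by (simp add: ennreal_mult'[symmetric])
  also have "\<dots> = ennreal (\<Sum>a=1..n. \<P>(\<omega> in W. Q a \<omega>) / n)"
    by (rule sum_ennreal) simp
  finally have "ennreal (\<P>(w in AK. Q (origin (fst w)) (drive (fst w))))
      = ennreal (\<Sum>a=1..n. \<P>(\<omega> in W. Q a \<omega>) / n)" .
  then show ?thesis
    by (subst (asm) ennreal_inj) (auto intro!: sum_nonneg simp: sum_divide_distrib)
qed

lemma prob_snd:
  assumes "B \<in> sets K"
  shows "\<P>(w in AK. snd w \<in> B) = measure K B"
proof -
  have "{w \<in> space AK. snd w \<in> B} = space A \<times> B"
    using sets.sets_into_space[OF assms] by (auto simp: space_pair_measure)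
  then show ?thesis
    using assms by (simp add: measure_def K.emeasure_pair_measure_Times A.emeasure_space_1)
qed

lemma distr_snd: "distr AK K snd = K"
proof (rule measure_eqI)
  fix B assume "B \<in> sets (distr AK K snd)"
  then have B: "B \<in> sets K" by simp
  have "snd -` B \<inter> space AK = space A \<times> B"
    using sets.sets_into_space[OF B] by (auto simp: space_pair_measure)
  then show "emeasure (distr AK K snd) B = emeasure K B"
    using B by (simp add: emeasure_distr K.emeasure_pair_measure_Times A.emeasure_space_1)
qed simp

end

lemma measurable_relabel:
  assumes f: "f \<in> measurable N (count_space UNIV)" and B: "\<And>x. x \<in> space N \<Longrightarrow> f x \<in> B"
  shows "(\<lambda>x. st (f x)) \<in> measurable N (count_space (st ` B))"
proof (rule measurableI)
  fix C assume "C \<in> sets (count_space (st ` B))"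
  have "(\<lambda>x. st (f x)) -` C \<inter> space N = f -` (st -` C) \<inter> space N"
    by auto
  also have "\<dots> \<in> sets N"
    using f by (rule measurable_sets) simp
  finally show "(\<lambda>x. st (f x)) -` C \<inter> space N \<in> sets N" .
qed (use B in auto)

context realized_process
begin

lemma space_AK: "w \<in> space AK \<Longrightarrow> fst w \<in> space A"
  by (auto simp: space_pair_measure)

section \<open>The two chains on the coded sample space and their Markov properties\<close>

definition discrete_chain :: "(nat \<Rightarrow> 's) \<Rightarrow> real \<Rightarrow> real \<Rightarrow> 'c \<Rightarrow> 's" where
  "discrete_chain st h s x = st (visit \<phi> (nat \<lfloor>s / h\<rfloor>) (origin x) (drive x))"

definition continuous_chain :: "(nat \<Rightarrow> 's) \<Rightarrow> real \<Rightarrow> 'c \<Rightarrow> 's" where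
  "continuous_chain st s x = st (jump_path \<phi> (origin x) s (drive x))"

lemma measurable_visit_decoded: "(\<lambda>x. visit \<phi> k (origin x) (drive x)) \<in> measurable A (count_space UNIV)"
  by (rule measurable_compose_countable[where f = "\<lambda>a x. visit \<phi> k a (drive x)"]) measurable

lemma measurable_path_decoded: "(\<lambda>x. jump_path \<phi> (origin x) s (drive x)) \<in> measurable A (count_space UNIV)"
  by (rule measurable_compose_countable[where f = "\<lambda>a x. jump_path \<phi> a s (drive x)"]) measurable

lemma measurable_discrete_chain: "discrete_chain st h s \<in> measurable A (count_space (st ` {1..n}))"
  unfolding discrete_chain_def
  by (intro measurable_relabel measurable_visit_decoded visit_range origin_range drive_space)

lemma measurable_continuous_chain: "continuous_chain st s \<in> measurable A (count_space (st ` {1..n}))"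
  unfolding continuous_chain_def
  by (intro measurable_relabel measurable_path_decoded path_range origin_range drive_space)

context
  fixes st :: "nat \<Rightarrow> 's" and h :: real
  assumes st: "inj_on st {1..n}" and h: "0 < h"
begin

lemma discrete_chain_eq_iff:
  assumes "x \<in> space A" "y \<in> {1..n}"
  shows "discrete_chain st h (h * real k) x = st y \<longleftrightarrow> visit \<phi> k (origin x) (drive x) = y"
proof -
  have "nat \<lfloor>h * real k / h\<rfloor> = k"
    using h by simp
  then show ?thesis
    unfolding discrete_chain_def
    using inj_on_eq_iff[OF st visit_range[OF origin_range drive_space] assms(2)] assms(1) by simp
qed

lemma continuous_chain_eq_iff:
  assumes "x \<in> space A" "y \<in> {1..n}"
  shows "continuous_chain st s x = st y \<longleftrightarrow> jump_path \<phi> (origin x) s (drive x) = y"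
  unfolding continuous_chain_def
  using inj_on_eq_iff[OF st path_range[OF origin_range drive_space] assms(2)] assms(1) by simp

lemma prob_discrete_chain:
  assumes "\<And>k. k \<le> m \<Longrightarrow> x k \<in> {1..n}"
  shows "\<P>(w in AK. \<forall>k\<le>m. discrete_chain st h (h * real k) (fst w) = st (x k))
    = (\<Sum>a=1..n. \<P>(\<omega> in W. \<forall>k\<le>m. visit \<phi> k a \<omega> = x k)) / n"
proof -
  have "\<P>(w in AK. \<forall>k\<le>m. discrete_chain st h (h * real k) (fst w) = st (x k))
      = \<P>(w in AK. \<forall>k\<le>m. visit \<phi> k (origin (fst w)) (drive (fst w)) = x k)"
    using assms space_AK discrete_chain_eq_iff by (intro arg_cong[where f = "measure _"] Collect_cong) blast
  also have "\<dots> = (\<Sum>a=1..n. \<P>(\<omega> in W. \<forall>k\<le>m. visit \<phi> k a \<omega> = x k)) / n"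
    by (rule prob_realized_path) measurable
  finally show ?thesis .
qed

lemma prob_continuous_chain:
  fixes m :: nat
  assumes "\<And>k. k \<le> m \<Longrightarrow> x k \<in> {1..n}"
  shows "\<P>(w in AK. \<forall>k\<le>m. continuous_chain st (s k) (fst w) = st (x k))
    = (\<Sum>a=1..n. \<P>(\<omega> in W. \<forall>k\<le>m. jump_path \<phi> a (s k) \<omega> = x k)) / n"
proof -
  have "\<P>(w in AK. \<forall>k\<le>m. continuous_chain st (s k) (fst w) = st (x k))
      = \<P>(w in AK. \<forall>k\<le>m. jump_path \<phi> (origin (fst w)) (s k) (drive (fst w)) = x k)"
    using assms space_AK continuous_chain_eq_iff by (intro arg_cong[where f = "measure _"] Collect_cong) blast
  also have "\<dots> = (\<Sum>a=1..n. \<P>(\<omega> in W. \<forall>k\<le>m. jump_path \<phi> a (s k) \<omega> = x k)) / n"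
    by (rule prob_realized_path) measurable
  finally show ?thesis .
qed

lemma sum_id_entry_column: "a \<in> {1..n} \<Longrightarrow> (\<Sum>b=1..n. id_entry b a) = 1"
  using sum_id_entry(2)[of "{1..n}" a "\<lambda>_. 1"] by simp

lemma prob_discrete_chain_0:
  assumes a: "a \<in> {1..n}"
  shows "\<P>(w in AK. discrete_chain st h 0 (fst w) = st a) = 1 / n"
proof -
  have "(\<forall>k\<le>0. visit \<phi> k b \<omega> = a) \<longleftrightarrow> b = a" for b \<omega>
    by simp
  then have "\<P>(\<omega> in W. \<forall>k\<le>0. visit \<phi> k b \<omega> = a) = id_entry b a" for b
    using W.prob_space by (cases "b = a") (simp_all only: id_entry_def if_True if_False simp_thms, simp_all)
  then show ?thesis
    using prob_discrete_chain[of 0 "\<lambda>_. a"] sum_id_entry_column[OF a] a by simp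
qed

lemma prob_continuous_chain_0:
  assumes a: "a \<in> {1..n}"
  shows "\<P>(w in AK. continuous_chain st 0 (fst w) = st a) = 1 / n"
proof -
  have "\<P>(\<omega> in W. \<forall>k\<le>0::nat. jump_path \<phi> b 0 \<omega> = a) = id_entry b a" for b
    using trans_prob_0[of b a] by (simp add: trans_prob_def)
  then show ?thesis
    using prob_continuous_chain[of 0 "\<lambda>_. a" "\<lambda>_. 0"] sum_id_entry_column[OF a] a by simp
qed

lemma discrete_markov_chain_realized:
  "discrete_markov_chain AK h n st P (\<lambda>s w. discrete_chain st h s (fst w))"
  unfolding discrete_markov_chain_def
proof (intro conjI allI impI)
  show "prob_space AK" by (rule AK.prob_space_axioms)
  show "0 < h" by (rule h)
  show "stochastic_matrix n P" by (rule stochastic_P)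
  show "(\<lambda>w. discrete_chain st h (h * real k) (fst w)) \<in> measurable AK (count_space (st ` {1..n}))" for k
    by (rule measurable_compose[OF measurable_fst measurable_discrete_chain])
  fix m :: nat and x
  let ?X = "\<lambda>k w. discrete_chain st h (h * real k) (fst w)"
  assume x: "\<forall>k\<le>Suc m. x k \<in> {1..n}"
    and pos: "0 < \<P>(w in AK. \<forall>k\<le>m. ?X k w = st (x k))"
  have "\<P>(w in AK. ?X (Suc m) w = st (x (Suc m)) \<and> (\<forall>k\<le>m. ?X k w = st (x k)))
      = \<P>(w in AK. \<forall>k\<le>Suc m. ?X k w = st (x k))"
    by (intro arg_cong[where f = "measure _"] Collect_cong) (auto simp: le_Suc_eq)
  also have "\<dots> = (\<Sum>a=1..n. \<P>(\<omega> in W. \<forall>k\<le>Suc m. visit \<phi> k a \<omega> = x k)) / n"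
    using x by (intro prob_discrete_chain) auto
  also have "\<dots> = (\<Sum>a=1..n. \<P>(\<omega> in W. \<forall>k\<le>m. visit \<phi> k a \<omega> = x k) * P (x m) (x (Suc m))) / n"
    using x by (intro arg_cong[where f = "\<lambda>z. z / n"] sum.cong refl prob_visits_Suc) auto
  also have "\<dots> = \<P>(w in AK. \<forall>k\<le>m. ?X k w = st (x k)) * P (x m) (x (Suc m))"
    using x by (subst prob_discrete_chain) (auto simp: sum_distrib_right)
  finally show "\<P>(w in AK. ?X (Suc m) w = st (x (Suc m)) \<bar> \<forall>k\<le>m. ?X k w = st (x k)) = P (x m) (x (Suc m))"
    using pos by (simp add: cond_prob_def)
qed

lemma continuous_markov_chain_realized:
  assumes G: "\<And>a c. a \<in> {1..n} \<Longrightarrow> c \<in> {1..n} \<Longrightarrow> G a c = \<theta> * (P a c - id_entry a c)"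
  shows "continuous_markov_chain AK n st G (\<lambda>s w. continuous_chain st s (fst w))"
  unfolding continuous_markov_chain_def
proof (intro conjI exI[of _ trans_prob] allI impI ballI)
  show "prob_space AK" by (rule AK.prob_space_axioms)
  show "(\<lambda>w. continuous_chain st s (fst w)) \<in> measurable AK (count_space (st ` {1..n}))" for s
    by (rule measurable_compose[OF measurable_fst measurable_continuous_chain])
  show "\<forall>\<^sub>F u in at_right s. continuous_chain st u (fst w) = continuous_chain st s (fst w)" for s w
    unfolding continuous_chain_def
    using path_right_continuous[where s = s and \<phi> = \<phi> and a = "origin (fst w)" and \<omega> = "drive (fst w)"] by eventually_elim simp
  show "transition_function n trans_prob"
    by (rule transition_function_trans_prob)
  show "((\<lambda>u. (trans_prob u a c - id_entry a c) / u) \<longlongrightarrow> G a c) (at_right 0)"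
    if "a \<in> {1..n}" "c \<in> {1..n}" for a c
    unfolding G[OF that] by (rule trans_prob_generator[OF that])
  fix m :: nat and s :: "nat \<Rightarrow> real" and x :: "nat \<Rightarrow> nat"
  let ?X = "\<lambda>k w. continuous_chain st (s k) (fst w)"
  assume s: "0 \<le> s 0" "\<forall>k\<le>m. s k < s (Suc k)" and x: "\<forall>k\<le>Suc m. x k \<in> {1..n}"
    and pos: "0 < \<P>(w in AK. \<forall>k\<le>m. ?X k w = st (x k))"
  have "\<P>(w in AK. ?X (Suc m) w = st (x (Suc m)) \<and> (\<forall>k\<le>m. ?X k w = st (x k)))
      = \<P>(w in AK. \<forall>k\<le>Suc m. ?X k w = st (x k))"
    by (intro arg_cong[where f = "measure _"] Collect_cong) (auto simp: le_Suc_eq)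
  also have "\<dots> = (\<Sum>a=1..n. \<P>(\<omega> in W. \<forall>k\<le>Suc m. jump_path \<phi> a (s k) \<omega> = x k)) / n"
    using x by (intro prob_continuous_chain) auto
  also have "\<dots> = (\<Sum>a=1..n. \<P>(\<omega> in W. \<forall>k\<le>m. jump_path \<phi> a (s k) \<omega> = x k)
      * trans_prob (s (Suc m) - s m) (x m) (x (Suc m))) / n"
    using x s by (intro arg_cong[where f = "\<lambda>z. z / n"] sum.cong refl prob_paths_Suc) auto
  also have "\<dots> = \<P>(w in AK. \<forall>k\<le>m. ?X k w = st (x k)) * trans_prob (s (Suc m) - s m) (x m) (x (Suc m))"
    using x by (subst prob_continuous_chain) (auto simp: sum_distrib_right)
  finally show "\<P>(w in AK. ?X (Suc m) w = st (x (Suc m)) \<bar> \<forall>k\<le>m. ?X k w = st (x k))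
      = trans_prob (s (Suc m) - s m) (x m) (x (Suc m))"
    using pos by (simp add: cond_prob_def)
qed

end

lemma sum_start: "x \<in> {1..n} \<Longrightarrow> (\<Sum>a=1..n. ennreal (1 / n) * (ennreal (id_entry a x) * g a)) = ennreal (1 / n) * g x"
proof -
  assume x: "x \<in> {1..n}"
  have "(\<Sum>a=1..n. ennreal (1 / n) * (ennreal (id_entry a x) * g a)) = (\<Sum>a=1..n. if a = x then ennreal (1 / n) * g a else 0)"
    by (intro sum.cong) (auto simp: id_entry_def)
  then show ?thesis using x by simp
qed

end

text \<open>The joint probability with the start \<open>x\<close> is \<open>1 / n\<close> times the
  mixture, by averaging the matrix powers over the independent time; \<open>1 / n\<close> is also
  the probability of the start and cancels.\<close>

lemma discrete_chain_at_random_time: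
  fixes K :: "nat measure"
  assumes "realized_process D n P \<theta> \<phi> K code" and K: "K = measure_pmf (neg_binomial_pmf r (1 - a))"
    and a: "0 \<le> a" "a < 1" and st: "inj_on st {1..n}" and h: "0 < h"
    and x: "x \<in> {1..n}" and y: "y \<in> {1..n}"
  defines "X \<equiv> realized_process.discrete_chain \<phi> code st h"
    and "\<Omega> \<equiv> realized_process.A D n \<theta> code \<Otimes>\<^sub>M K"
  shows "\<P>(w in \<Omega>. X (h * real (snd w)) (fst w) = st y \<bar> X 0 (fst w) = st x) = nb_mixture n P r a x y"
proof -
  interpret realized_process D n P \<theta> \<phi> K code by fact
  let ?p = "\<P>(w in AK. visit \<phi> (snd w) (origin (fst w)) (drive (fst w)) = y \<and> origin (fst w) = x)"
  have n0: "0 < n" using n by simp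
  have [measurable]: "Measurable.pred (W \<Otimes>\<^sub>M K) (\<lambda>v. visit \<phi> (snd v) b (fst v) = y \<and> b = x)" for b
  proof -
    have "(\<lambda>v. visit \<phi> (snd v) b (fst v)) \<in> measurable (W \<Otimes>\<^sub>M K) (count_space UNIV)"
    proof (rule measurable_compose_countable[where f = "\<lambda>k v. visit \<phi> k b (fst v)"])
      show "snd \<in> measurable (W \<Otimes>\<^sub>M K) (count_space UNIV)"
        unfolding K by (rule measurable_compose[OF measurable_snd]) simp
    qed measurable
    then show ?thesis by measurable
  qed
  have "\<P>(w in \<Omega>. X (h * real (snd w)) (fst w) = st y \<and> X 0 (fst w) = st x)
      = ?p"
    unfolding \<Omega>_def X_def
  proof (intro arg_cong[where f = "measure _"] Collect_cong conj_cong refl)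
    fix w assume w: "w \<in> space AK"
    show "(discrete_chain st h (h * real (snd w)) (fst w) = st y)
        = (visit \<phi> (snd w) (origin (fst w)) (drive (fst w)) = y)"
      by (rule discrete_chain_eq_iff[OF st h space_AK[OF w] y])
    show "(discrete_chain st h 0 (fst w) = st x) = (origin (fst w) = x)"
      using discrete_chain_eq_iff[OF st h space_AK[OF w] x, of 0] by simp
  qed
  moreover have "ennreal ?p
      = ennreal (nb_mixture n P r a x y / n)"
  proof -
    have V: "\<P>(\<omega> in W. visit \<phi> z b \<omega> = y \<and> b = x) = id_entry b x * mat_power n P z b y" if "b \<in> {1..n}" for z b
      using prob_visit[OF that, of z y] by (cases "b = x") (simp_all add: id_entry_def)
    have "ennreal ?p
      = (\<Sum>b=1..n. ennreal (1 / n) * (\<integral>\<^sup>+z. ennreal (\<P>(\<omega> in W. visit \<phi> z b \<omega> = y \<and> b = x)) \<partial>K))"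
      by (rule prob_realized[where Q = "\<lambda>b \<omega> z. visit \<phi> z b \<omega> = y \<and> b = x"]) measurable
    also have "\<dots> = (\<Sum>b=1..n. ennreal (1 / n) * (ennreal (id_entry b x) * (\<integral>\<^sup>+z. ennreal (mat_power n P z b y) \<partial>K)))"
    proof (intro sum.cong refl arg_cong[where f = "(*) (ennreal (1 / real n))"])
      fix b assume b: "b \<in> {1..n}"
      have "(\<integral>\<^sup>+z. ennreal (\<P>(\<omega> in W. visit \<phi> z b \<omega> = y \<and> b = x)) \<partial>K)
          = (\<integral>\<^sup>+z. ennreal (id_entry b x) * ennreal (mat_power n P z b y) \<partial>K)"
        unfolding V[OF b] by (simp add: id_entry_def)
      also have "\<dots> = ennreal (id_entry b x) * (\<integral>\<^sup>+z. ennreal (mat_power n P z b y) \<partial>K)"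
        by (rule nn_integral_cmult) (simp add: K)
      finally show "(\<integral>\<^sup>+z. ennreal (\<P>(\<omega> in W. visit \<phi> z b \<omega> = y \<and> b = x)) \<partial>K)
          = ennreal (id_entry b x) * (\<integral>\<^sup>+z. ennreal (mat_power n P z b y) \<partial>K)" .
    qed
    also have "\<dots> = ennreal (1 / n) * (\<integral>\<^sup>+z. ennreal (mat_power n P z x y) \<partial>K)"
      by (rule sum_start[OF x])
    also have "(\<integral>\<^sup>+z. ennreal (mat_power n P z x y) \<partial>K) = (\<Sum>z. ennreal (nb_mass r a z * mat_power n P z x y))"
      using nb_mass_nonneg[OF a]
      by (simp add: K nn_integral_measure_pmf nn_integral_count_space_nat nb_mass_eq_pmf[OF a, symmetric] ennreal_mult')
    also have "\<dots> = ennreal (nb_mixture n P r a x y)"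
      unfolding nb_mixture_def
      using nb_mass_nonneg[OF a] nb_mixture_summable[OF stochastic_P a x y]
        stochastic_matrix_le_1(1)[OF stochastic_mat_power[OF stochastic_P] x y]
      by (intro suminf_ennreal2) simp_all
    finally show ?thesis
      by (simp add: ennreal_mult'[symmetric])
  qed
  ultimately have "\<P>(w in \<Omega>. X (h * real (snd w)) (fst w) = st y \<and> X 0 (fst w) = st x) = nb_mixture n P r a x y / n"
    using stochastic_matrix_le_1(1)[OF stochastic_nb_mixture[OF stochastic_P a] x y]
    by (subst (asm) ennreal_inj) auto
  then show ?thesis
    using prob_discrete_chain_0[OF st h x] n0 unfolding X_def \<Omega>_def by (simp add: cond_prob_def)
qed

text \<open>The time is cut at 0 because it has to be nonnegative at every sample point, whereas
  \<open>snd w\<close> is so only almost surely. The start is the path at time 0, which agrees with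
  \<open>origin\<close> only almost surely.\<close>

lemma continuous_chain_at_random_time:
  fixes K :: "real measure"
  assumes "realized_process D n P \<theta> \<phi> K code" and K: "K = density lborel (erlang_density r l)"
    and l: "0 < l" and st: "inj_on st {1..n}" and x: "x \<in> {1..n}" and y: "y \<in> {1..n}"
  defines "Y \<equiv> realized_process.continuous_chain \<phi> code st"
    and "\<Omega> \<equiv> realized_process.A D n \<theta> code \<Otimes>\<^sub>M K"
  shows "\<P>(w in \<Omega>. Y (max 0 (snd w)) (fst w) = st y \<bar> Y 0 (fst w) = st x)
    = nb_mixture n P (Suc r) (\<theta> / (l + \<theta>)) x y"
proof -
  interpret realized_process D n P \<theta> \<phi> K code by fact
  let ?p = "\<P>(w in AK. jump_path \<phi> (origin (fst w)) 0 (drive (fst w)) = x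
          \<and> jump_path \<phi> (origin (fst w)) (max 0 (snd w)) (drive (fst w)) = y)"
  have n0: "0 < n" using n by simp
  have a: "0 \<le> \<theta> / (l + \<theta>)" "\<theta> / (l + \<theta>) < 1"
    using \<theta> l by auto
  have sets_K[measurable_cong]: "sets K = sets borel"
    by (simp add: K)
  have "\<P>(w in \<Omega>. Y (max 0 (snd w)) (fst w) = st y \<and> Y 0 (fst w) = st x)
      = ?p"
    unfolding \<Omega>_def Y_def
    using continuous_chain_eq_iff[OF st _ _ x] continuous_chain_eq_iff[OF st _ _ y] space_AK
    by (intro arg_cong[where f = "measure _"] Collect_cong) (metis zero_less_one)
  moreover have "ennreal ?p
      = ennreal (nb_mixture n P (Suc r) (\<theta> / (l + \<theta>)) x y / n)"
  proof -
    have V: "\<P>(\<omega> in W. jump_path \<phi> b 0 \<omega> = x \<and> jump_path \<phi> b (max 0 z) \<omega> = y)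
        = id_entry b x * trans_prob (max 0 z) b y" for z b
      unfolding trans_prob_def by (rule prob_path_0) measurable
    have "ennreal ?p
      = (\<Sum>b=1..n. ennreal (1 / n) * (\<integral>\<^sup>+z. ennreal (\<P>(\<omega> in W. jump_path \<phi> b 0 \<omega> = x \<and> jump_path \<phi> b (max 0 z) \<omega> = y)) \<partial>K))"
      by (rule prob_realized[where Q = "\<lambda>b \<omega> z. jump_path \<phi> b 0 \<omega> = x \<and> jump_path \<phi> b (max 0 z) \<omega> = y"]) measurable
    also have "\<dots> = (\<Sum>b=1..n. ennreal (1 / n) * (ennreal (id_entry b x) * (\<integral>\<^sup>+z. ennreal (trans_prob (max 0 z) b y) \<partial>K)))"
      unfolding V
      by (intro sum.cong refl arg_cong[where f = "(*) (ennreal (1 / real n))"], subst nn_integral_cmult[symmetric])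
        (auto simp: id_entry_def)
    also have "\<dots> = ennreal (1 / n) * (\<integral>\<^sup>+z. ennreal (trans_prob (max 0 z) x y) \<partial>K)"
      by (rule sum_start[OF x])
    also have "(\<integral>\<^sup>+z. ennreal (trans_prob (max 0 z) x y) \<partial>K)
        = (\<integral>\<^sup>+z. ennreal (erlang_density r l z) * ennreal (trans_prob z x y) \<partial>lborel)"
      unfolding K by (subst nn_integral_density) (auto intro!: nn_integral_cong simp: erlang_density_def max_def)
    also have "\<dots> = ennreal (nb_mixture n P (Suc r) (\<theta> / (l + \<theta>)) x y)"
      by (rule trans_prob_erlang_mixture[OF x y l])
    finally show ?thesis
      by (simp add: ennreal_mult'[symmetric])
  qed
  ultimately have "\<P>(w in \<Omega>. Y (max 0 (snd w)) (fst w) = st y \<and> Y 0 (fst w) = st x)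
      = nb_mixture n P (Suc r) (\<theta> / (l + \<theta>)) x y / n"
    using stochastic_matrix_le_1(1)[OF stochastic_nb_mixture[OF stochastic_P a] x y]
    by (subst (asm) ennreal_inj) auto
  then show ?thesis
    using prob_continuous_chain_0[OF st zero_less_one x] n0 unfolding Y_def \<Omega>_def by (simp add: cond_prob_def)
qed

section \<open>Existence of the chains\<close>

definition matrix_row :: "nat \<Rightarrow> (nat \<Rightarrow> nat \<Rightarrow> real) \<Rightarrow> nat \<Rightarrow> nat pmf" where
  "matrix_row n P a = embed_pmf (\<lambda>b. if b \<in> {1..n} then P a b else 0)"

lemma pmf_matrix_row:
  assumes P: "stochastic_matrix n P" and a: "a \<in> {1..n}"
  shows "pmf (matrix_row n P a) b = (if b \<in> {1..n} then P a b else 0)"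
  unfolding matrix_row_def
proof (rule pmf_embed_pmf)
  have nonneg: "0 \<le> P a b" if "b \<in> {1..n}" for b
    using P a that by (simp add: stochastic_matrix_def)
  then show "0 \<le> (if b \<in> {1..n} then P a b else 0)" for b
    by simp
  have "(\<integral>\<^sup>+b. ennreal (if b \<in> {1..n} then P a b else 0) \<partial>count_space UNIV) = (\<Sum>b=1..n. ennreal (P a b))"
    by (subst nn_integral_count_space'[of "{1..n}"]) auto
  also have "\<dots> = ennreal (\<Sum>b=1..n. P a b)"
    using nonneg by (rule sum_ennreal)
  also have "\<dots> = 1"
    using P a by (simp add: stochastic_matrix_def)
  finally show "(\<integral>\<^sup>+b. ennreal (if b \<in> {1..n} then P a b else 0) \<partial>count_space UNIV) = 1" .
qed

text \<open>A seed draws a next state from each row of \<open>P\<close>, independently; its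
  component \<open>a\<close> is the move from state \<open>a\<close>.\<close>

definition driver :: "nat \<Rightarrow> (nat \<Rightarrow> nat \<Rightarrow> real) \<Rightarrow> (nat \<Rightarrow> nat) measure" where
  "driver n P = measure_pmf (Pi_pmf {1..n} 1 (matrix_row n P))"

text \<open>The default 1 keeps the next state in \<open>{1..n}\<close> for every seed, including
  those of probability 0.\<close>

definition move :: "nat \<Rightarrow> nat \<Rightarrow> (nat \<Rightarrow> nat) \<Rightarrow> nat" where
  "move n a u = (if u a \<in> {1..n} then u a else 1)"

lemma jump_process_driver:
  assumes P: "stochastic_matrix n P" and n: "1 \<le> n" and \<theta>: "0 < \<theta>"
  shows "jump_process (driver n P) n P \<theta> (move n)"
proof -
  interpret prob_space "driver n P"
    unfolding driver_def by (rule prob_space_measure_pmf)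
  have law: "measure (driver n P) {u \<in> space (driver n P). move n a u = b} = P a b"
    if a: "a \<in> {1..n}" and b: "b \<in> {1..n}" for a b
  proof -
    let ?f = "\<lambda>c. if c \<in> {1..n} then c else 1"
    have "measure (driver n P) {u \<in> space (driver n P). move n a u = b}
        = measure_pmf.prob (map_pmf (\<lambda>u. u a) (Pi_pmf {1..n} 1 (matrix_row n P))) {c. ?f c = b}"
      by (simp add: driver_def move_def vimage_def)
    also have "\<dots> = measure_pmf.prob (matrix_row n P a) {c. ?f c = b}"
      using a by (subst Pi_pmf_component) simp_all
    also have "\<dots> = measure_pmf.prob (matrix_row n P a) {b}"
    proof (rule measure_pmf.finite_measure_eq_AE)
      have "c \<in> {1..n}" if "c \<in> set_pmf (matrix_row n P a)" for c
        using that pmf_matrix_row[OF P a, of c] by (auto simp: set_pmf_iff split: if_splits)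
      then show "AE c in measure_pmf (matrix_row n P a). (c \<in> {c. ?f c = b}) = (c \<in> {b})"
        by (intro AE_pmfI) auto
    qed auto
    also have "\<dots> = P a b"
      using pmf_matrix_row[OF P a, of b] b by (simp add: measure_pmf_single)
    finally show ?thesis .
  qed
  show ?thesis
    using n \<theta> law by unfold_locales (auto simp: move_def driver_def)
qed

text \<open>
  The sample space of the theorem has the first component \<^typ>\<open>real \<Rightarrow> real option\<close>, into which the
  random seed is embedded.
\<close>

definition encode_seed :: "nat \<times> (real \<times> (nat \<Rightarrow> nat)) stream \<Rightarrow> real \<Rightarrow> real option" where
  "encode_seed x s =
     (if s < 0 then Some (real (fst x))
      else case prod_decode (nat \<lfloor>s\<rfloor>) of
        (k, 0) \<Rightarrow> Some (fst (snd x !! k))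
      | (k, Suc m) \<Rightarrow> Some (real (snd (snd x !! k) m)))"

text \<open>The seed can be read off the function: the initial state at \<open>-1\<close>, waiting
  time number \<open>k\<close> at \<open>prod_encode (k, 0)\<close>, and entry \<open>m\<close> of
  driver value number \<open>k\<close> at \<open>prod_encode (k, Suc m)\<close>.\<close>

lemma inj_encode_seed: "inj encode_seed"
proof (rule injI)
  fix x y assume eq: "encode_seed x = encode_seed y"
  have "fst x = fst y"
    using fun_cong[OF eq, of "-1"] by (simp add: encode_seed_def)
  moreover have "snd x !! k = snd y !! k" for k
  proof (rule prod_eqI)
    show "fst (snd x !! k) = fst (snd y !! k)"
      using fun_cong[OF eq, of "real (prod_encode (k, 0))"] by (simp add: encode_seed_def)
    show "snd (snd x !! k) = snd (snd y !! k)"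
    proof
      fix m
      show "snd (snd x !! k) m = snd (snd y !! k) m"
        using fun_cong[OF eq, of "real (prod_encode (k, Suc m))"] by (simp add: encode_seed_def)
    qed
  qed
  then have "snd x = snd y"
    by (metis ext smap_alt stream.map_id0 id_apply stream_smap_fromN)
  ultimately show "x = y"
    by (rule prod_eqI)
qed

lemma realized_process_driver:
  assumes "stochastic_matrix n P" "1 \<le> n" "0 < \<theta>" "prob_space K"
  shows "realized_process (driver n P) n P \<theta> (move n) K encode_seed"
  using jump_process_driver[OF assms(1-3)] assms(4) inj_encode_seed
  by (simp add: realized_process_def realized_process_axioms_def)

theorem discrete_chain_exists:
  fixes st :: "nat \<Rightarrow> 's"
  assumes P: "stochastic_matrix n P" and n: "1 \<le> n" and h: "0 < h" and st: "inj_on st {1..n}"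
    and a: "0 \<le> a" "a < 1"
  obtains \<Omega> :: "((real \<Rightarrow> real option) \<times> nat) measure" and X \<tau>
  where "discrete_markov_chain \<Omega> h n st P X" "initial_full_support \<Omega> n st X" "has_NB_law \<Omega> \<tau> r a"
    "indep_of_process \<Omega> (count_space UNIV) \<tau> (range (\<lambda>n::nat. h * real n)) (st ` {1..n}) X"
    "(\<integral>w. h * real (\<tau> w) \<partial>\<Omega>) = h * (real r * a / (1 - a))"
    "\<And>x y. x \<in> {1..n} \<Longrightarrow> y \<in> {1..n} \<Longrightarrow>
       \<P>(w in \<Omega>. X (h * real (\<tau> w)) w = st y \<bar> X 0 w = st x) = nb_mixture n P r a x y"
proof -
  define K :: "nat measure" where "K = measure_pmf (neg_binomial_pmf r (1 - a))"
  have K: "prob_space K"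
    unfolding K_def by (rule prob_space_measure_pmf)
  \<comment> \<open>The discrete chain follows the visited states, which do not depend on the clock;
    the rate is set to 1.\<close>
  interpret realized_process "driver n P" n P 1 "move n" K encode_seed
    by (rule realized_process_driver[OF P n zero_less_one K])
  let ?X = "\<lambda>s w. discrete_chain st h s (fst w)"
  have a1: "1 - a \<in> {0<..1}" using a by simp
  show thesis
  proof (rule that[of AK ?X snd])
    show "discrete_markov_chain AK h n st P ?X"
      by (rule discrete_markov_chain_realized[OF st h])
    show "initial_full_support AK n st ?X"
      unfolding initial_full_support_def using prob_discrete_chain_0[OF st h] n by simp
    show "has_NB_law AK snd r a"
      unfolding has_NB_law_def
    proof (intro conjI allI)
      show "snd \<in> measurable AK (count_space UNIV)"
        by (rule measurable_compose[OF measurable_snd]) (simp add: K_def)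
      fix m
      have "\<P>(w in AK. snd w = m) = measure K {m}"
        using prob_snd[of "{m}"] by (simp add: K_def)
      also have "\<dots> = nb_mass r a m"
        unfolding K_def by (simp add: measure_pmf_single nb_mass_eq_pmf[OF a])
      finally show "\<P>(w in AK. snd w = m) = real ((r + m - 1) choose m) * a ^ m * (1 - a) ^ r"
        by (simp add: nb_mass_def)
    qed
    show "indep_of_process AK (count_space UNIV) snd (range (\<lambda>n. h * real n)) (st ` {1..n}) ?X"
      by (rule indep_of_process_pair[OF A.prob_space_axioms K _ measurable_discrete_chain, where Z = "\<lambda>z. z"])
        (simp add: K_def)
    have "(\<integral>w. h * real (snd w) \<partial>AK) = (\<integral>z. h * real z \<partial>(distr AK K snd))"
      by (rule integral_distr[symmetric]) (simp_all add: K_def)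
    also have "\<dots> = h * (\<integral>z. real z \<partial>K)"
      unfolding distr_snd by simp
    also have "(\<integral>z. real z \<partial>K) = real r * a / (1 - a)"
      unfolding K_def using expectation_neg_binomial_pmf[OF a1, of r] by simp
    finally show "(\<integral>w. h * real (snd w) \<partial>AK) = h * (real r * a / (1 - a))" .
    show "\<P>(w in AK. ?X (h * real (snd w)) w = st y \<bar> ?X 0 w = st x) = nb_mixture n P r a x y"
      if "x \<in> {1..n}" "y \<in> {1..n}" for x y
      by (rule discrete_chain_at_random_time[OF realized_process_axioms K_def a st h that])
  qed
qed

theorem continuous_chain_exists:
  fixes st :: "nat \<Rightarrow> 's"
  assumes P: "stochastic_matrix n P" and n: "1 \<le> n" and \<theta>: "0 < \<theta>" and st: "inj_on st {1..n}"
    and l: "0 < l" and G: "\<And>a c. a \<in> {1..n} \<Longrightarrow> c \<in> {1..n} \<Longrightarrow> G a c = \<theta> * (P a c - id_entry a c)"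
  obtains \<Omega> :: "((real \<Rightarrow> real option) \<times> real) measure" and Y T
  where "continuous_markov_chain \<Omega> n st G Y" "initial_full_support \<Omega> n st Y" "\<forall>w\<in>space \<Omega>. 0 \<le> T w"
    "distributed \<Omega> lborel T (\<lambda>x. ennreal (erlang_density r l x))"
    "indep_of_process \<Omega> borel T {0..} (st ` {1..n}) Y"
    "(\<integral>w. T w \<partial>\<Omega>) = real (Suc r) / l"
    "\<And>x y. x \<in> {1..n} \<Longrightarrow> y \<in> {1..n} \<Longrightarrow>
       \<P>(w in \<Omega>. Y (T w) w = st y \<bar> Y 0 w = st x) = nb_mixture n P (Suc r) (\<theta> / (l + \<theta>)) x y"
proof -
  define K where "K = density lborel (\<lambda>x. ennreal (erlang_density r l x))"
  have K: "prob_space K"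
    unfolding K_def by (rule prob_space_erlang_density[OF l])
  interpret realized_process "driver n P" n P \<theta> "move n" K encode_seed
    by (rule realized_process_driver[OF P n \<theta> K])
  have sets_K[measurable_cong]: "sets K = sets borel"
    by (simp add: K_def)
  let ?Y = "\<lambda>s w. continuous_chain st s (fst w)"
  let ?T = "\<lambda>w. max 0 (snd w)"
  have dist: "distributed AK lborel ?T (\<lambda>x. ennreal (erlang_density r l x))"
    unfolding distributed_def
  proof (intro conjI)
    show "?T \<in> measurable AK lborel"
      by measurable
    \<comment> \<open>Cutting at 0 changes the time only where the Erlang density vanishes.\<close>
    have "distr AK lborel ?T = distr (distr AK K snd) lborel (max 0)"
      by (subst distr_distr) (auto simp: o_def)
    also have "\<dots> = distr K lborel (\<lambda>x. x)"
      unfolding distr_snd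
    proof (rule distr_cong_AE)
      show "AE x in K. max 0 x = x"
        unfolding K_def by (subst AE_density) (auto simp: erlang_density_def)
    qed auto
    also have "\<dots> = K"
      by (rule distr_id2) (simp add: K_def)
    finally show "distr AK lborel ?T = density lborel (\<lambda>x. ennreal (erlang_density r l x))"
      by (simp add: K_def)
  qed auto
  show thesis
  proof (rule that[of AK ?Y ?T])
    show "continuous_markov_chain AK n st G ?Y"
      by (rule continuous_markov_chain_realized[OF st zero_less_one G])
    show "initial_full_support AK n st ?Y"
      unfolding initial_full_support_def using prob_continuous_chain_0[OF st zero_less_one] n by simp
    show "\<forall>w\<in>space AK. 0 \<le> ?T w"
      by simp
    show "distributed AK lborel ?T (\<lambda>x. ennreal (erlang_density r l x))"
      by (rule dist)
    show "indep_of_process AK borel ?T {0..} (st ` {1..n}) ?Y"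
      by (rule indep_of_process_pair[OF A.prob_space_axioms K _ measurable_continuous_chain]) measurable
    show "(\<integral>w. ?T w \<partial>AK) = real (Suc r) / l"
      using AK.erlang_ith_moment[OF l dist, of 1] by simp
    show "\<P>(w in AK. ?Y (?T w) w = st y \<bar> ?Y 0 w = st x) = nb_mixture n P (Suc r) (\<theta> / (l + \<theta>)) x y"
      if "x \<in> {1..n}" "y \<in> {1..n}" for x y
      by (rule continuous_chain_at_random_time[OF realized_process_axioms K_def l st that])
  qed
qed

section \<open>The matrices of the statement and the proof of the theorem\<close>

lemma trans_matrix_eq_euler_step:
  "trans_matrix M i b k lam h = euler_step (bd_generator M (q_up i b) (q_down i b) (ktilde M i k) lam) h"
proof (intro ext)
  fix j m
  show "trans_matrix M i b k lam h j m
      = euler_step (bd_generator M (q_up i b) (q_down i b) (ktilde M i k) lam) h j m"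
  proof (cases "j \<in> {2..M-1}")
    case True
    then have "j + 1 \<noteq> j" "j - 1 \<noteq> j" "M + 1 \<noteq> j"
      by auto
    then show ?thesis
      using True by (auto simp: trans_matrix_def euler_step_def bd_generator_def id_entry_def)
  next
    case False
    then show ?thesis
      unfolding trans_matrix_def euler_step_def bd_generator_def by (simp only: if_False)
  qed
qed

text \<open>The one-step matrix is affine in the step, so the difference quotient is constant for
  positive steps.\<close>

lemma intensity_matrix_eq_generator:
  "intensity_matrix M i b k lam = bd_generator M (q_up i b) (q_down i b) (ktilde M i k) lam"
proof (intro ext)
  fix j m
  let ?G = "bd_generator M (q_up i b) (q_down i b) (ktilde M i k) lam"
  have "((\<lambda>h. (trans_matrix M i b k lam h j m - id_entry j m) / h) \<longlongrightarrow> ?G j m) (at_right 0)"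
  proof (rule tendsto_eventually)
    show "\<forall>\<^sub>F h in at_right 0. (trans_matrix M i b k lam h j m - id_entry j m) / h = ?G j m"
      using eventually_at_right_less[of 0]
      by eventually_elim (simp add: trans_matrix_eq_euler_step euler_step_def)
  qed
  then show "intensity_matrix M i b k lam j m = ?G j m"
    unfolding intensity_matrix_def by (intro tendsto_Lim) auto
qed

lemma gamma_density_eq_erlang:
  assumes "0 < t"
  shows "gamma_density (Suc r) t = erlang_density r (real (Suc r) / t)"
proof
  fix x
  have "Gamma (real (Suc r)) = fact r"
    using Gamma_fact[of r, where 'a = real] by (simp add: add.commute)
  then show "gamma_density (Suc r) t x = erlang_density r (real (Suc r) / t) x"
    using assms by (simp add: gamma_density_def erlang_density_def power_divide mult_ac)
qed

theorem theorem5p2: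
  fixes M r :: nat and t :: real and i p b k :: "nat \<Rightarrow> real"
  assumes "M \<ge> 3"
    and "t > 0"
    and "\<forall>j\<in>{1..<M}. i j < i (j + 1)"
    and "\<forall>j\<in>{1..M}. 0 < p j \<and> p j < 1"
    and "(\<Sum>j=1..M. p j) = 1"
    and "\<forall>j\<in>{2..M-1}. - 1 / (i (j + 1) - i j) < b j \<and> b j < 1 / (i j - i (j - 1))"
    and "\<forall>j\<in>{2..M-1}. 0 \<le> k j"
    and "r \<ge> 1"
  shows "\<exists>l\<in>{2..M}. \<exists>lam :: nat \<Rightarrow> real. \<exists>\<beta>\<in>{0<..1::real}. \<exists>h\<^sub>0\<in>{0<..<1::real}.
    (\<forall>j\<in>{2..M-1}. 0 \<le> lam j) \<and>
    (\<forall>h\<in>{0<..<h\<^sub>0}. \<exists>\<alpha>\<in>alpha_interval M i k lam t r.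
      \<exists>(\<Omega> :: ((real \<Rightarrow> real option) \<times> nat) measure) X \<tau>.
        discrete_markov_chain \<Omega> h (M + 1) (state M i) (trans_matrix M i b k lam h) X \<and>
        initial_full_support \<Omega> (M + 1) (state M i) X \<and>
        has_NB_law \<Omega> \<tau> r (t / (t + h * real r)) \<and>
        indep_of_process \<Omega> (count_space UNIV) \<tau>
          (range (\<lambda>n::nat. h * real n)) (state M i ` {1..M+1}) X \<and>
        (\<integral>w. h * real (\<tau> w) \<partial>\<Omega>) = t \<and>
        (\<forall>j\<in>{1..M}.
          (1 - \<beta>) * \<P>(w in \<Omega>. X (h * real (\<tau> w)) w = state M i j \<bar> X 0 w = state M i (l - 1))
          + \<beta> * \<P>(w in \<Omega>. X (h * real (\<tau> w)) w = state M i j \<bar> X 0 w = state M i l)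
          = \<alpha> * p j)) \<and>
    (\<exists>\<alpha>\<in>alpha_interval M i k lam t r.
      \<exists>(\<Omega> :: ((real \<Rightarrow> real option) \<times> real) measure) Y T.
        continuous_markov_chain \<Omega> (M + 1) (state M i) (intensity_matrix M i b k lam) Y \<and>
        initial_full_support \<Omega> (M + 1) (state M i) Y \<and>
        (\<forall>w\<in>space \<Omega>. 0 \<le> T w) \<and>
        distributed \<Omega> lborel T (\<lambda>x. ennreal (gamma_density r t x)) \<and>
        indep_of_process \<Omega> borel T {0..} (state M i ` {1..M+1}) Y \<and>
        (\<integral>w. T w \<partial>\<Omega>) = t \<and>
        (\<forall>j\<in>{1..M}.
          (1 - \<beta>) * \<P>(w in \<Omega>. Y (T w) w = state M i j \<bar> Y 0 w = state M i (l - 1))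
          + \<beta> * \<P>(w in \<Omega>. Y (T w) w = state M i j \<bar> Y 0 w = state M i l)
          = \<alpha> * p j))"
proof -
  note M = assms(1) and t = assms(2) and inc = assms(3) and p = assms(4) and psum = assms(5)
    and b = assms(6) and k = assms(7)
  define n where "n = M + 1"
  define kt where "kt = ktilde M i k"
  define G where "G = bd_generator M (q_up i b) (q_down i b) kt"
  \<comment> \<open>The scale at which both negative binomial parameters,
    \<open>t / (t + h r)\<close> and \<open>(1 / h) / (r / t + 1 / h)\<close>, become
    \<open>c / (c + h)\<close>.\<close>
  define c where "c = t / real r"
  obtain r' where r': "r = Suc r'"
    using assms(8) by (metis Suc_le_D One_nat_def)
  have r0: "0 < real r"
    using r' by simp
  then have c: "0 < c"
    using t by (simp add: c_def)
  have gap: "0 < i (j + 1) - i j" "0 < i j - i (j - 1)" if "j \<in> {2..M-1}" for j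
  proof -
    have "j \<in> {1..<M}"
      using that by auto
    then show "0 < i (j + 1) - i j"
      using inc by (metis diff_gt_0_iff_gt)
    have "j - 1 \<in> {1..<M}" "j - 1 + 1 = j"
      using that by auto
    then show "0 < i j - i (j - 1)"
      using inc by (metis diff_gt_0_iff_gt)
  qed
  interpret birth_death M "q_up i b" "q_down i b" kt
  proof
    fix j assume j: "j \<in> {2..M-1}"
    define u d where "u = i (j + 1) - i j" and "d = i j - i (j - 1)"
    have ud: "0 < u" "0 < d" "i (j + 1) - i (j - 1) = u + d"
      using gap[OF j] by (simp_all add: u_def d_def)
    have bj: "- 1 / u < b j" "b j < 1 / d"
      using b j by (simp_all only: u_def d_def)
    have "0 < 1 + u * b j" "0 < 1 - d * b j"
      using bj ud by (simp_all add: field_simps)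
    then show "0 < q_up i b j" "0 < q_down i b j"
      unfolding q_up_def q_down_def ud(3) u_def[symmetric] d_def[symmetric] using ud by simp_all
    have "q_up i b j + q_down i b j = (d * (1 + u * b j) + u * (1 - d * b j)) / (u + d)"
      unfolding q_up_def q_down_def ud(3) u_def[symmetric] d_def[symmetric] by (simp add: add_divide_distrib)
    also have "d * (1 + u * b j) + u * (1 - d * b j) = u + d"
      by (simp add: algebra_simps)
    finally show "q_up i b j + q_down i b j = 1"
      using ud by simp
    show "0 \<le> kt j"
      using gap[OF j] k j by (auto simp: kt_def ktilde_def)
  qed (rule M)
  have p_pos: "0 < p j" if "j \<in> {1..M}" for j
    using p that by blast
  obtain l lam \<beta> \<alpha> h where l: "l \<in> {2..M}" and \<beta>: "0 < \<beta>" "\<beta> \<le> 1"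
    and bd: "birth_death_resolvent M (q_up i b) (q_down i b) kt lam c h"
    and raw: "\<And>j. j \<in> {1..M} \<Longrightarrow> (1 - \<beta>) * resolvent_power (M + 1) (gen lam) c h (Suc r') (l - 1) j
        + \<beta> * resolvent_power (M + 1) (gen lam) c h (Suc r') l j = \<alpha> * p j"
    by (rule embedding_exists[OF p_pos psum c, where r = r'], assumption) (rule that)
  let ?R = "resolvent_power n (G lam) c h r" and ?P = "euler_step (G lam)"
  have emb: "(1 - \<beta>) * ?R (l - 1) j
        + \<beta> * ?R l j = \<alpha> * p j" if "j \<in> {1..M}" for j
    using raw[OF that] by (simp only: n_def G_def r')
  interpret birth_death_resolvent M "q_up i b" "q_down i b" kt lam c h
    by (rule bd)
  have l': "l - 1 \<in> {1..M}" "l \<in> {1..M}" "l - 1 \<in> {1..n}" "l \<in> {1..n}"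
    using l by (auto simp: n_def)
  have \<alpha>: "\<alpha> \<in> alpha_interval M i k lam t r"
  proof -
    define \<kappa> where "\<kappa> = klam_max M i k lam"
    have \<kappa>: "kt j * lam j \<le> \<kappa>" if "j \<in> {2..M-1}" for j
      unfolding \<kappa>_def klam_max_def kt_def[symmetric] using that by (intro Max_ge) auto
    have "2 \<in> {2..M-1}" using M by simp
    then have \<kappa>0: "0 \<le> \<kappa>"
      using \<kappa>[of 2] kt[of 2] lam[of 2] by (meson mult_nonneg_nonneg order_trans)
    \<comment> \<open>Summing the embedding identity over \<open>j\<close> identifies \<alpha> as
      the survival probability of the mixed start, to which the bounds on \<open>alive\<close>
      apply.\<close>
    have "(\<Sum>j=1..M. \<alpha> * p j) = (1 - \<beta>) * alive r (l - 1) + \<beta> * alive r l"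
    proof -
      have "(\<Sum>j=1..M. \<alpha> * p j) = (\<Sum>j=1..M. (1 - \<beta>) * S r (l - 1) j + \<beta> * S r l j)"
        using emb unfolding n_def G_def by (intro sum.cong refl) (rule sym)
      then show ?thesis
        by (simp only: sum.distrib sum_distrib_left)
    qed
    then have \<alpha>: "\<alpha> = (1 - \<beta>) * alive r (l - 1) + \<beta> * alive r l"
      using psum by (simp add: sum_distrib_left[symmetric])
    have "\<alpha> \<le> (1 - \<beta>) * 1 + \<beta> * 1"
      unfolding \<alpha> using \<beta> alive_le_1[OF l'(1)] alive_le_1[OF l'(2)] by (intro add_mono mult_left_mono) auto
    moreover have "inverse ((1 + c * \<kappa>) ^ r) \<le> \<alpha>"
    proof -
      have pos: "0 < (1 + c * \<kappa>) ^ r"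
        using c \<kappa>0 by (intro zero_less_power add_pos_nonneg) auto
      have "inverse ((1 + c * \<kappa>) ^ r) \<le> alive r x" if "x \<in> {1..M}" for x
        using alive_lower_bound[OF that \<kappa>0 \<kappa>, of r] pos by (simp add: inverse_eq_divide divide_le_eq mult.commute)
      then have "(1 - \<beta>) * inverse ((1 + c * \<kappa>) ^ r) + \<beta> * inverse ((1 + c * \<kappa>) ^ r) \<le> \<alpha>"
        unfolding \<alpha> using \<beta> l' by (intro add_mono mult_left_mono) auto
      moreover have "(1 - \<beta>) * v + \<beta> * v = v" for v
        by (simp add: algebra_simps)
      ultimately show ?thesis by simp
    qed
    moreover have "(1 + \<kappa> * t / real r) powi (- int r) = inverse ((1 + c * \<kappa>) ^ r)"
      by (simp add: power_int_minus c_def mult.commute)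
    ultimately show ?thesis
      by (simp add: alpha_interval_def \<kappa>_def)
  qed
  have st: "inj_on (state M i) {1..n}"
  proof -
    have "strict_mono_on {1..M} i"
    proof (rule strict_mono_onI)
      fix x y assume xy: "x \<in> {1..M}" "y \<in> {1..M}" "x < y"
      from xy(3) xy(1,2) show "i x < i y"
      proof (induction rule: less_Suc_induct)
        case (1 j)
        then show ?case using bspec[OF inc, of j] by simp
      next
        case (2 x y z)
        then show ?case by simp
      qed
    qed
    then have "inj_on i {1..M}"
      by (rule strict_mono_on_imp_inj_on)
    then show ?thesis
      by (intro inj_onI) (auto simp: state_def n_def dest: inj_onD split: if_splits)
  qed
  have n1: "1 \<le> n" by (simp add: n_def)
  \<comment> \<open>Any smaller step keeps the matrix stochastic and, by step independence, leaves
    the mixture unchanged. Hence the same \<open>lam\<close>, \<beta> and \<alpha> serve all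
    \<open>h' \<le> h\<close>.\<close>
  have mixture: "nb_mixture n (?P h') r (c / (c + h')) x y = ?R x y"
    and stoch': "stochastic_matrix n (?P h')"
    if h': "0 < h'" "h' \<le> h" and xy: "x \<in> {1..n}" "y \<in> {1..n}" for h' x y
  proof -
    have "h' * (lam j * (1 + kt j)) \<le> 1" if "j \<in> {2..M-1}" for j
    proof -
      have "h' * (lam j * (1 + kt j)) \<le> h * (lam j * (1 + kt j))"
        using h' lam kt[OF that] by (intro mult_right_mono) auto
      then show ?thesis using hlam[OF that] by simp
    qed
    then have "birth_death_resolvent M (q_up i b) (q_down i b) kt lam c h'"
      using lam c h'(1) by unfold_locales auto
    then interpret h': birth_death_resolvent M "q_up i b" "q_down i b" kt lam c h' .
    show "stochastic_matrix n (?P h')"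
      using h'.stoch by (simp add: n_def G_def)
    have "resolvent_power n (G lam) c h' r x y = ?R x y"
      using xy unfolding n_def G_def
      by (intro resolvent_power_step_independent h'.resolvent_axioms resolvent_axioms)
    then show "nb_mixture n (?P h') r (c / (c + h')) x y = ?R x y"
      by (simp add: resolvent_power_def)
  qed
  have emb': "(1 - \<beta>) * ?R (l - 1) j + \<beta> * ?R l j = \<alpha> * p j"
    "j \<in> {1..n}" if "j \<in> {1..M}" for j
    using emb[OF that] that by (auto simp: n_def)
  have discrete: "\<exists>(\<Omega> :: ((real \<Rightarrow> real option) \<times> nat) measure) X \<tau>.
        discrete_markov_chain \<Omega> h' (M + 1) (state M i) (trans_matrix M i b k lam h') X \<and>
        initial_full_support \<Omega> (M + 1) (state M i) X \<and>
        has_NB_law \<Omega> \<tau> r (t / (t + h' * real r)) \<and>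
        indep_of_process \<Omega> (count_space UNIV) \<tau>
          (range (\<lambda>n::nat. h' * real n)) (state M i ` {1..M+1}) X \<and>
        (\<integral>w. h' * real (\<tau> w) \<partial>\<Omega>) = t \<and>
        (\<forall>j\<in>{1..M}.
          (1 - \<beta>) * \<P>(w in \<Omega>. X (h' * real (\<tau> w)) w = state M i j \<bar> X 0 w = state M i (l - 1))
          + \<beta> * \<P>(w in \<Omega>. X (h' * real (\<tau> w)) w = state M i j \<bar> X 0 w = state M i l)
          = \<alpha> * p j)" if h': "0 < h'" "h' \<le> h" for h'
  proof -
    have a_eq: "c / (c + h') = t / (t + h' * real r)"
      using t h' r0 by (simp add: c_def field_simps)
    have a: "0 \<le> c / (c + h')" "c / (c + h') < 1"
      using c h' by auto
    have mean: "h' * (real r * (c / (c + h')) / (1 - c / (c + h'))) = t"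
    proof -
      have "1 - c / (c + h') = h' / (c + h')"
        using c h' by (simp add: field_simps)
      then show ?thesis
        using c h' r0 by (simp add: c_def)
    qed
    obtain \<Omega> :: "((real \<Rightarrow> real option) \<times> nat) measure" and X \<tau>
      where X: "discrete_markov_chain \<Omega> h' n (state M i) (?P h') X"
        "initial_full_support \<Omega> n (state M i) X" "has_NB_law \<Omega> \<tau> r (c / (c + h'))"
        "indep_of_process \<Omega> (count_space UNIV) \<tau> (range (\<lambda>n::nat. h' * real n)) (state M i ` {1..n}) X"
        "(\<integral>w. h' * real (\<tau> w) \<partial>\<Omega>) = h' * (real r * (c / (c + h')) / (1 - c / (c + h')))"
      and mix: "\<And>x y. x \<in> {1..n} \<Longrightarrow> y \<in> {1..n} \<Longrightarrow>
         \<P>(w in \<Omega>. X (h' * real (\<tau> w)) w = state M i y \<bar> X 0 w = state M i x)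
           = nb_mixture n (?P h') r (c / (c + h')) x y"
      by (rule discrete_chain_exists[OF stoch'[OF h' l'(3,3)] n1 h'(1) st a, where r = r]) (rule that)
    have "(1 - \<beta>) * \<P>(w in \<Omega>. X (h' * real (\<tau> w)) w = state M i j \<bar> X 0 w = state M i (l - 1))
          + \<beta> * \<P>(w in \<Omega>. X (h' * real (\<tau> w)) w = state M i j \<bar> X 0 w = state M i l)
          = \<alpha> * p j" if j: "j \<in> {1..M}" for j
      using emb'(1)[OF j]
      by (simp only: mix[OF l'(3) emb'(2)[OF j]] mix[OF l'(4) emb'(2)[OF j]]
          mixture[OF h' l'(3) emb'(2)[OF j]] mixture[OF h' l'(4) emb'(2)[OF j]])
    then show ?thesis
      using X(1,2,4) X(3)[unfolded a_eq] X(5)[unfolded mean]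
      unfolding trans_matrix_eq_euler_step n_def G_def kt_def by blast
  qed
  have continuous: "\<exists>(\<Omega> :: ((real \<Rightarrow> real option) \<times> real) measure) Y T.
        continuous_markov_chain \<Omega> (M + 1) (state M i) (intensity_matrix M i b k lam) Y \<and>
        initial_full_support \<Omega> (M + 1) (state M i) Y \<and>
        (\<forall>w\<in>space \<Omega>. 0 \<le> T w) \<and>
        distributed \<Omega> lborel T (\<lambda>x. ennreal (gamma_density r t x)) \<and>
        indep_of_process \<Omega> borel T {0..} (state M i ` {1..M+1}) Y \<and>
        (\<integral>w. T w \<partial>\<Omega>) = t \<and>
        (\<forall>j\<in>{1..M}.
          (1 - \<beta>) * \<P>(w in \<Omega>. Y (T w) w = state M i j \<bar> Y 0 w = state M i (l - 1))
          + \<beta> * \<P>(w in \<Omega>. Y (T w) w = state M i j \<bar> Y 0 w = state M i l)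
          = \<alpha> * p j)"
  proof -
    have lam0: "0 < real r / t"
      using t r' by simp
    \<comment> \<open>A clock of rate \<open>1 / h\<close> with jump matrix \<open>I + h G\<close>
      has generator \<open>G\<close>, and a Gamma time of rate \<open>r / t\<close> then produces
      the mixture of the discrete chain with step \<open>h\<close>; so the same \<alpha>
      results.\<close>
    have a_eq: "(1 / h) / (real r / t + 1 / h) = c / (c + h)"
      using t h r0 by (simp add: c_def field_simps)
    have \<theta>: "0 < 1 / h"
      using h by simp
    have gen: "G lam x y = 1 / h * (?P h x y - id_entry x y)" for x y
      using h by (simp add: euler_step_def)
    have mean: "real r / (real r / t) = t"
      using r' t by simp
    obtain \<Omega> :: "((real \<Rightarrow> real option) \<times> real) measure" and Y T
      where Y: "continuous_markov_chain \<Omega> n (state M i) (G lam) Y" "initial_full_support \<Omega> n (state M i) Y"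
        "\<forall>w\<in>space \<Omega>. 0 \<le> T w"
        "distributed \<Omega> lborel T (\<lambda>x. ennreal (erlang_density r' (real r / t) x))"
        "indep_of_process \<Omega> borel T {0..} (state M i ` {1..n}) Y"
        "(\<integral>w. T w \<partial>\<Omega>) = real r / (real r / t)"
      and mix: "\<And>x y. x \<in> {1..n} \<Longrightarrow> y \<in> {1..n} \<Longrightarrow>
         \<P>(w in \<Omega>. Y (T w) w = state M i y \<bar> Y 0 w = state M i x)
           = nb_mixture n (?P h) r ((1 / h) / (real r / t + 1 / h)) x y"
      by (rule continuous_chain_exists[OF stoch'[OF h order_refl l'(3,3)] n1 \<theta> st lam0 gen, where r = r', folded r'])
        (rule that)
    have "(1 - \<beta>) * \<P>(w in \<Omega>. Y (T w) w = state M i j \<bar> Y 0 w = state M i (l - 1))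
          + \<beta> * \<P>(w in \<Omega>. Y (T w) w = state M i j \<bar> Y 0 w = state M i l)
          = \<alpha> * p j" if j: "j \<in> {1..M}" for j
      using emb'(1)[OF j]
      by (simp only: mix[OF l'(3) emb'(2)[OF j]] mix[OF l'(4) emb'(2)[OF j]] a_eq
          mixture[OF h order_refl l'(3) emb'(2)[OF j]] mixture[OF h order_refl l'(4) emb'(2)[OF j]])
    moreover have gamma: "gamma_density r t = erlang_density r' (real r / t)"
      unfolding r' by (rule gamma_density_eq_erlang[OF t])
    ultimately show ?thesis
      using Y(1-5) Y(6)[unfolded mean]
      unfolding gamma intensity_matrix_eq_generator n_def G_def kt_def by blast
  qed
  \<comment> \<open>At this point \<open>h\<close> is only known to be positive; the minimum ensures
    that the bound on the steps is below 1.\<close>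
  have h0: "min h (1 / 2) \<in> {0<..<1}"
    using h by auto
  show ?thesis
    using l \<beta> h0 \<alpha> lam discrete continuous
    by (intro bexI[of _ l] exI[of _ lam] bexI[of _ \<beta>] bexI[of _ "min h (1 / 2)"] conjI ballI bexI[of _ \<alpha>]) auto
qed

end
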